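(* Fix an integer $c \ge 0$. There is an algorithm that, given an instance $I=(G,X,k)$ of a-$c$-tdmod-IS with $G=(V,E,\mathcal{H})$ and $R=V\setminus X$, runs in time polynomial in the size of $I$ and outputs an equivalent instance $\tilde I=(\tilde G,\tilde X,\tilde k)$ of a-$c$-tdmod-IS, with $\tilde G=(\tilde V,\tilde E,\tilde{\mathcal{H}})$ and $\tilde R=\tilde V\setminus\tilde X$, such that $|\tilde X| = O(|X|^{2^{(c+1)(c+2)/2}})$, $|\tilde{\mathcal{H}}| = |\mathcal{H}| + O(|X|^{2^{(c+1)(c+2)/2}})$, and $\tilde R=\emptyset$. In particular, a-$c$-tdmod-IS parameterized by $|X|+|\mathcal{H}|$ admits a polynomial kernel.
   Context: Treedepth ${\sf td}$ of a graph: minimum height of a rooted forest whose closure (each vertex joined to all its ancestors) contains the graph as a subgraph. The problem a-$c$-tdmod-IS (Annotated $c$-treedepth modulator Independent Set): an instance is $(G,X,k)$ where $G=(V,E,\mathcal{H})$ has vertex set $V=X\uplus R$, a set $E$ of (2-element) edges each having either one endpoint in $X$ and one in $R$ or both endpoints in $R$, and a set $\mathcal{H}$ of hyperedges, each a subset of $X$; moreover ${\sf td}(G[R])\le c$ (where $G[R]$ is the ordinary graph $(R,\{e\in E: e\subseteq R\})$), and $k$ is a positive integer. An independent set of $G$ is a set $S\subseteq V$ containing no $h\in E\cup\mathcal{H}$ (i.e. $h\not\subseteq S$ for all such $h$); $\alpha(G)$ is the maximum size of an independent set. The question is whether $\alpha(G)\ge k$. Two instances are equivalent if both are yes-instances or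 both are no-instances. *)

theory Defs
  imports
    "HOL-Computational_Algebra.Polynomial"
    "HOL-Library.Landau_Symbols"
begin

section \<open>Rooted forests and treedepth\<close>

text \<open>
  A rooted forest is given by its vertex set \<open>W\<close> and its child-to-parent relation \<open>P\<close>,
  i.e. \<open>(u, v) \<in> P\<close> means that \<open>v\<close> is the parent of \<open>u\<close>; roots are the vertices without a parent.
  Thus \<open>(u, v) \<in> P\<^sup>+\<close> says that \<open>v\<close> is a proper ancestor of \<open>u\<close>.
\<close>

definition rooted_forest :: "'v set \<Rightarrow> ('v \<times> 'v) set \<Rightarrow> bool" where
  "rooted_forest W P \<longleftrightarrow> finite W \<and> P \<subseteq> W \<times> W \<and> single_valued P \<and> acyclic P"

text \<open>
  The height counts vertices: the edgeless nonempty graphs are those of treedepth 1. The path from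
  \<open>v\<close> to its root consists of the vertices \<open>u\<close> with \<open>(v, u) \<in> P\<^sup>*\<close>. On \<open>nat\<close>, the supremum of the
  empty set is 0, so the empty forest has height 0.
\<close>

definition forest_height :: "'v set \<Rightarrow> ('v \<times> 'v) set \<Rightarrow> nat" where
  "forest_height W P = (SUP v\<in>W. card {u. (v, u) \<in> P\<^sup>*})"

definition forest_closure :: "('v \<times> 'v) set \<Rightarrow> 'v set set" where
  "forest_closure P = {{u, v} | u v. (u, v) \<in> P\<^sup>+}"

definition treedepth :: "'v set \<Rightarrow> 'v set set \<Rightarrow> nat" where
  "treedepth U E = (LEAST h. \<exists>W P. rooted_forest W P \<and> U \<subseteq> W \<and> E \<subseteq> forest_closure P
                                  \<and> forest_height W P = h)"


section \<open>Annotated independent set with a treedepth modulator\<close>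

record 'v tdmod =
  verts :: "'v set"
  edges :: "'v set set"
  hyperedges :: "'v set set"
  modulator :: "'v set"
  target :: nat

definition remainder :: "'v tdmod \<Rightarrow> 'v set" where
  "remainder I = verts I - modulator I"

definition tdmod_instance :: "nat \<Rightarrow> 'v tdmod \<Rightarrow> bool" where
  "tdmod_instance c I \<longleftrightarrow>
     finite (verts I) \<and> modulator I \<subseteq> verts I \<and>
     (\<forall>e\<in>edges I.
        (\<exists>x\<in>modulator I. \<exists>r\<in>remainder I. e = {x, r}) \<or>
        (\<exists>r\<in>remainder I. \<exists>r'\<in>remainder I. r \<noteq> r' \<and> e = {r, r'})) \<and>
     (\<forall>h\<in>hyperedges I. h \<subseteq> modulator I) \<and>
     treedepth (remainder I) {e \<in> edges I. e \<subseteq> remainder I} \<le> c \<and>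
     target I > 0"

definition independent :: "'v tdmod \<Rightarrow> 'v set \<Rightarrow> bool" where
  "independent I S \<longleftrightarrow> S \<subseteq> verts I \<and> (\<forall>h \<in> edges I \<union> hyperedges I. \<not> h \<subseteq> S)"

text \<open>
  If the empty set is a hyperedge, no set is independent. Then \<open>alpha\<close> is the supremum
  of the empty set of naturals, which is 0, and the instance is a no-instance.
\<close>

definition alpha :: "'v tdmod \<Rightarrow> nat" where
  "alpha I = Sup (card ` {S. independent I S})"

definition yes_instance :: "'v tdmod \<Rightarrow> bool" where
  "yes_instance I \<longleftrightarrow> alpha I \<ge> target I"

definition equivalent_instances :: "'v tdmod \<Rightarrow> 'v tdmod \<Rightarrow> bool" where
  "equivalent_instances I I' \<longleftrightarrow> (yes_instance I \<longleftrightarrow> yes_instance I')"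


section \<open>Machine model\<close>

text \<open>
  Algorithms are programs of Jones' WHILE language, whose data are finite binary trees. Reading
  a variable is charged the full size of its value, so that the cost of evaluating an expression
  bounds the size of the result from above; repeated copying (\<open>Pair_of (Var x) (Var x)\<close>) therefore
  cannot build exponentially large data in polynomial time. With this cost measure, WHILE
  programs and Turing machines simulate each other with polynomial overhead.
\<close>

datatype tree = Leaf | Node tree tree

primrec tsize :: "tree \<Rightarrow> nat" where
  "tsize Leaf = 1"
| "tsize (Node l r) = 1 + tsize l + tsize r"

primrec left :: "tree \<Rightarrow> tree" where
  "left Leaf = Leaf"
| "left (Node l r) = l"

primrec right :: "tree \<Rightarrow> tree" where
  "right Leaf = Leaf"
| "right (Node l r) = r"

datatype expr =
    Var nat
  | Leaf_const
  | Pair_of expr expr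
  | Left_of expr
  | Right_of expr
  | Equal expr expr

datatype com =
    Skip
  | Assign nat expr
  | Seq com com
  | Cond expr com com
  | Loop expr com

type_synonym state = "nat \<Rightarrow> tree"

primrec evaluate :: "expr \<Rightarrow> state \<Rightarrow> tree" where
  "evaluate (Var x) s = s x"
| "evaluate Leaf_const s = Leaf"
| "evaluate (Pair_of a b) s = Node (evaluate a s) (evaluate b s)"
| "evaluate (Left_of a) s = left (evaluate a s)"
| "evaluate (Right_of a) s = right (evaluate a s)"
| "evaluate (Equal a b) s = (if evaluate a s = evaluate b s then Node Leaf Leaf else Leaf)"

primrec cost :: "expr \<Rightarrow> state \<Rightarrow> nat" where
  "cost (Var x) s = tsize (s x)"
| "cost Leaf_const s = 1"
| "cost (Pair_of a b) s = 1 + cost a s + cost b s"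
| "cost (Left_of a) s = 1 + cost a s"
| "cost (Right_of a) s = 1 + cost a s"
| "cost (Equal a b) s = 1 + cost a s + cost b s"

text \<open>
  \<open>exec P s n s'\<close>: program \<open>P\<close>, started in state \<open>s\<close>, terminates in state \<open>s'\<close> after time \<open>n\<close>.
  In tests, \<open>Leaf\<close> stands for false and every other tree for true.
\<close>

inductive exec :: "com \<Rightarrow> state \<Rightarrow> nat \<Rightarrow> state \<Rightarrow> bool" where
  Skip: "exec Skip s 1 s"
| Assign: "exec (Assign x e) s (1 + cost e s) (s(x := evaluate e s))"
| Seq: "exec P s m s1 \<Longrightarrow> exec Q s1 n s2 \<Longrightarrow> exec (Seq P Q) s (m + n) s2"
| Cond_true: "evaluate e s \<noteq> Leaf \<Longrightarrow> exec P s n s' \<Longrightarrow>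
    exec (Cond e P Q) s (1 + cost e s + n) s'"
| Cond_false: "evaluate e s = Leaf \<Longrightarrow> exec Q s n s' \<Longrightarrow>
    exec (Cond e P Q) s (1 + cost e s + n) s'"
| Loop_true: "evaluate e s \<noteq> Leaf \<Longrightarrow> exec P s m s1 \<Longrightarrow> exec (Loop e P) s1 n s2 \<Longrightarrow>
    exec (Loop e P) s (1 + cost e s + m + n) s2"
| Loop_false: "evaluate e s = Leaf \<Longrightarrow> exec (Loop e P) s (1 + cost e s) s"

definition outputs_in_time :: "com \<Rightarrow> tree \<Rightarrow> tree \<Rightarrow> nat \<Rightarrow> bool" where
  "outputs_in_time P t t' n \<longleftrightarrow> (\<exists>s. exec P ((\<lambda>_. Leaf)(0 := t)) n s \<and> s 0 = t')"

lemma tsize_pos: "0 < tsize t"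
  by (cases t) auto

lemma tsize_evaluate_le_cost: "tsize (evaluate e s) \<le> cost e s"
proof (induction e)
  case (Left_of e)
  then show ?case by (cases "evaluate e s") auto
next
  case (Right_of e)
  then show ?case by (cases "evaluate e s") auto
next
  case (Equal a b)
  then show ?case
    using tsize_pos[of "evaluate a s"] tsize_pos[of "evaluate b s"] by auto
qed auto

inductive_cases exec_SkipE: "exec Skip s n s'"
inductive_cases exec_AssignE: "exec (Assign x e) s n s'"
inductive_cases exec_SeqE: "exec (Seq P Q) s n s'"
inductive_cases exec_CondE: "exec (Cond e P Q) s n s'"
inductive_cases exec_LoopE: "exec (Loop e P) s n s'"

lemma exec_deterministic:
  assumes "exec P s n s1" and "exec P s m s2"
  shows "n = m \<and> s1 = s2"
  using assms
proof (induction arbitrary: m s2 rule: exec.induct)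
  case Skip
  then show ?case by (auto elim: exec_SkipE)
next
  case Assign
  then show ?case by (auto elim: exec_AssignE)
next
  case (Seq P s n1 t Q n2 u)
  from Seq.prems obtain m1 t' m2
    where m: "m = m1 + m2" and 1: "exec P s m1 t'" and 2: "exec Q t' m2 s2"
    by (rule exec_SeqE)
  from Seq.IH(1)[OF 1] have "n1 = m1" "t = t'" by simp_all
  with Seq.IH(2) 2 m show ?case by simp
next
  case (Cond_true e s P n t Q)
  from Cond_true.prems obtain m' where m: "m = 1 + cost e s + m'"
    and 1: "exec P s m' s2"
    by (rule exec_CondE) (use Cond_true.hyps(1) in auto)
  from Cond_true.IH[OF 1] m show ?case by simp
next
  case (Cond_false e s Q n t P)
  from Cond_false.prems obtain m' where m: "m = 1 + cost e s + m'"
    and 1: "exec Q s m' s2"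
    by (rule exec_CondE) (use Cond_false.hyps(1) in auto)
  from Cond_false.IH[OF 1] m show ?case by simp
next
  case (Loop_true e s P n1 t n2 u)
  from Loop_true.prems obtain m1 t' m2
    where m: "m = 1 + cost e s + m1 + m2" and 1: "exec P s m1 t'" and 2: "exec (Loop e P) t' m2 s2"
    by (rule exec_LoopE) (use Loop_true.hyps(1) in auto)
  from Loop_true.IH(1)[OF 1] have "n1 = m1" "t = t'" by simp_all
  with Loop_true.IH(2) 2 m show ?case by simp
next
  case (Loop_false e s P)
  from Loop_false.prems Loop_false.hyps show ?case
    by (auto elim: exec_LoopE)
qed


section \<open>Encoding of instances\<close>

text \<open>
  Numbers (vertex names and the target) are written in binary, least significant bit first.
\<close>

fun enc_nat :: "nat \<Rightarrow> tree" where
  "enc_nat n = (if n = 0 then Leaf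
     else Node (if odd n then Node Leaf Leaf else Leaf) (enc_nat (n div 2)))"

declare enc_nat.simps [simp del]

primrec enc_list :: "('a \<Rightarrow> tree) \<Rightarrow> 'a list \<Rightarrow> tree" where
  "enc_list f [] = Leaf"
| "enc_list f (x # xs) = Node (f x) (enc_list f xs)"

definition enc_pair :: "nat \<times> nat \<Rightarrow> tree" where
  "enc_pair p = Node (enc_nat (fst p)) (enc_nat (snd p))"

definition lists_once :: "'a list \<Rightarrow> 'a set \<Rightarrow> bool" where
  "lists_once xs A \<longleftrightarrow> distinct xs \<and> set xs = A"

text \<open>
  Sets are encoded by listing their elements without repetition, in any order; so an instance
  has several encodings (of the same size), and an algorithm has to cope with each of them.
\<close>

definition encodes :: "tree \<Rightarrow> nat tdmod \<Rightarrow> bool" where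
  "encodes t I \<longleftrightarrow> (\<exists>vs es hs xs.
     lists_once vs (verts I) \<and>
     lists_once (map (\<lambda>(u, v). {u, v}) es) (edges I) \<and>
     lists_once (map set hs) (hyperedges I) \<and> (\<forall>h\<in>set hs. distinct h) \<and>
     lists_once xs (modulator I) \<and>
     t = Node (enc_list enc_nat vs)
        (Node (enc_list enc_pair es)
        (Node (enc_list (enc_list enc_nat) hs)
        (Node (enc_list enc_nat xs) (enc_nat (target I))))))"

lemma enc_nat_inject: "enc_nat m = enc_nat n \<longleftrightarrow> m = n"
proof
  show "enc_nat m = enc_nat n \<Longrightarrow> m = n"
  proof (induction m arbitrary: n rule: less_induct)
    case (less m)
    show ?case
    proof (cases "m = 0 \<or> n = 0")
      case True
      then show ?thesis using less.prems
        by (auto simp: enc_nat.simps[of m] enc_nat.simps[of n] split: if_splits)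
    next
      case False
      with less.prems have "odd m = odd n" "enc_nat (m div 2) = enc_nat (n div 2)"
        by (auto simp: enc_nat.simps[of m] enc_nat.simps[of n] split: if_splits)
      moreover from False have "m div 2 < m" by simp
      ultimately have "odd m = odd n" "m div 2 = n div 2"
        using less.IH by blast+
      then show ?thesis by presburger
    qed
  qed
qed simp

lemma enc_list_inject:
  assumes "\<And>x y. f x = f y \<longleftrightarrow> x = y"
  shows "enc_list f xs = enc_list f ys \<longleftrightarrow> xs = ys"
proof (induction xs arbitrary: ys)
  case Nil
  then show ?case by (cases ys) auto
next
  case (Cons x xs)
  then show ?case by (cases ys) (auto simp: assms)
qed

lemma enc_pair_inject: "enc_pair p = enc_pair q \<longleftrightarrow> p = q"
  by (cases p; cases q) (simp add: enc_pair_def enc_nat_inject)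

lemma encodes_unique:
  assumes "encodes t I" and "encodes t I'"
  shows "I = I'"
proof -
  obtain vs es hs xs where I:
    "set vs = verts I" "set (map (\<lambda>(u, v). {u, v}) es) = edges I"
    "set (map set hs) = hyperedges I" "set xs = modulator I"
    "t = Node (enc_list enc_nat vs) (Node (enc_list enc_pair es)
      (Node (enc_list (enc_list enc_nat) hs) (Node (enc_list enc_nat xs) (enc_nat (target I)))))"
    using assms(1) unfolding encodes_def lists_once_def by blast
  obtain vs' es' hs' xs' where I':
    "set vs' = verts I'" "set (map (\<lambda>(u, v). {u, v}) es') = edges I'"
    "set (map set hs') = hyperedges I'" "set xs' = modulator I'"
    "t = Node (enc_list enc_nat vs') (Node (enc_list enc_pair es')
      (Node (enc_list (enc_list enc_nat) hs') (Node (enc_list enc_nat xs') (enc_nat (target I')))))"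
    using assms(2) unfolding encodes_def lists_once_def by blast
  have "vs = vs'" "es = es'" "hs = hs'" "xs = xs'" "target I = target I'"
    using I(5) I'(5) by (simp_all add: enc_nat_inject enc_list_inject enc_pair_inject)
  then show ?thesis
    using I(1-4) I'(1-4) by (intro tdmod.equality) simp_all
qed

lemma encodes_exists:
  assumes "tdmod_instance c I"
  shows "\<exists>t. encodes t I"
proof -
  have fin: "finite (verts I)" "finite (modulator I)"
    using assms by (auto simp: tdmod_instance_def intro: finite_subset)
  have ends_ex: "\<exists>u\<in>verts I. \<exists>v\<in>verts I. e = {u, v}" if "e \<in> edges I" for e
  proof -
    from assms that have "(\<exists>x\<in>modulator I. \<exists>r\<in>remainder I. e = {x, r}) \<or>
        (\<exists>r\<in>remainder I. \<exists>r'\<in>remainder I. r \<noteq> r' \<and> e = {r, r'})"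
      by (simp add: tdmod_instance_def)
    moreover have "modulator I \<subseteq> verts I" "remainder I \<subseteq> verts I"
      using assms by (simp_all add: tdmod_instance_def remainder_def)
    ultimately show ?thesis by (meson subsetD)
  qed
  have sub: "edges I \<subseteq> Pow (verts I)" "hyperedges I \<subseteq> Pow (modulator I)"
  proof -
    show "edges I \<subseteq> Pow (verts I)"
    proof
      fix e assume "e \<in> edges I"
      from ends_ex[OF this] show "e \<in> Pow (verts I)" by auto
    qed
    show "hyperedges I \<subseteq> Pow (modulator I)"
      using assms unfolding tdmod_instance_def by blast
  qed
  then have fin': "finite (edges I)" "finite (hyperedges I)"
    using fin finite_subset[of "edges I" "Pow (verts I)"]
      finite_subset[of "hyperedges I" "Pow (modulator I)"] by auto
  obtain vs where vs: "lists_once vs (verts I)"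
    using fin finite_distinct_list unfolding lists_once_def by blast
  obtain xs where xs: "lists_once xs (modulator I)"
    using fin finite_distinct_list unfolding lists_once_def by blast
  obtain es' where es': "lists_once es' (edges I)"
    using fin' finite_distinct_list unfolding lists_once_def by blast
  obtain hs' where hs': "lists_once hs' (hyperedges I)"
    using fin' finite_distinct_list unfolding lists_once_def by blast
  have "\<forall>e\<in>set es'. \<exists>p. (\<lambda>(u, v). {u, v}) p = e"
  proof
    fix e assume "e \<in> set es'"
    then have "e \<in> edges I" using es' by (simp add: lists_once_def)
    then obtain u v where "e = {u, v}" using ends_ex by meson
    then show "\<exists>p. (\<lambda>(u, v). {u, v}) p = e" by (intro exI[of _ "(u, v)"]) simp
  qed
  then obtain ends where ends: "\<forall>e\<in>set es'. (\<lambda>(u, v). {u, v}) (ends e) = e"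
    by metis
  define es where "es = map ends es'"
  have es: "map (\<lambda>(u, v). {u, v}) es = es'"
    using ends by (simp add: es_def map_idI)
  have "\<forall>h\<in>set hs'. \<exists>l. distinct l \<and> set l = h"
  proof
    fix h assume "h \<in> set hs'"
    then have "h \<subseteq> modulator I" using sub(2) hs' by (auto simp: lists_once_def)
    then have "finite h" using fin(2) by (rule finite_subset)
    then show "\<exists>l. distinct l \<and> set l = h" using finite_distinct_list by blast
  qed
  then obtain enum where enum: "\<forall>h\<in>set hs'. distinct (enum h) \<and> set (enum h) = h"
    by metis
  define hs where "hs = map enum hs'"
  have hs: "map set hs = hs'" "\<forall>h\<in>set hs. distinct h"
    using enum by (auto simp: hs_def map_idI)
  have "encodes (Node (enc_list enc_nat vs) (Node (enc_list enc_pair es)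
      (Node (enc_list (enc_list enc_nat) hs)
      (Node (enc_list enc_nat xs) (enc_nat (target I)))))) I"
    unfolding encodes_def
    by (rule exI[of _ vs], rule exI[of _ es], rule exI[of _ hs], rule exI[of _ xs])
      (use vs xs es es' hs hs' in simp)
  then show ?thesis ..
qed


section \<open>Kernelization\<close>

text \<open>
  For a problem with instances \<open>inst\<close>, yes-instances \<open>yes\<close>, parameter \<open>param\<close> and
  encoding \<open>enc\<close>: the encoded size of the output and its parameter are jointly bounded
  by a polynomial in the parameter of the input.
\<close>

definition polynomial_kernel ::
  "('i \<Rightarrow> bool) \<Rightarrow> ('i \<Rightarrow> bool) \<Rightarrow> ('i \<Rightarrow> nat) \<Rightarrow> (tree \<Rightarrow> 'i \<Rightarrow> bool) \<Rightarrow> bool" where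
  "polynomial_kernel inst yes param enc \<longleftrightarrow>
     (\<exists>(P :: com) (p :: nat poly) (q :: nat poly). \<forall>I t. inst I \<and> enc t I \<longrightarrow>
        (\<exists>n t' I'. outputs_in_time P t t' n \<and> n \<le> poly p (tsize t) \<and>
           inst I' \<and> enc t' I' \<and> (yes I \<longleftrightarrow> yes I') \<and>
           tsize t' + param I' \<le> poly q (param I)))"

end

theory Submission imports Defs begin

text \<open>
  Let \<open>R\<close> have treedepth at most \<open>c\<close>. Call a set \<open>Y \<subseteq> X\<close> in conflict with a connected component \<open>C\<close>
  of \<open>G[R]\<close> if deleting the neighbours of \<open>Y\<close> lowers the independence number of \<open>C\<close>. By induction on the
  treedepth, every conflict is already caused by at most \<open>2 ^ c\<close> elements of \<open>Y\<close>, so only the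
  polynomially many sets of that size (the chunks) matter. A chunk in conflict with more than \<open>|X|\<close>
  components is contained in no maximum independent set, as dropping all of \<open>X\<close> would be better; it becomes
  a hyperedge. Components in conflict with none of the other chunks can then always be filled optimally
  and leave the remainder. At most \<open>|X|\<close> components per chunk survive; moving their roots into the
  modulator lowers the treedepth of the remainder to \<open>c - 1\<close> while \<open>|X| + 1\<close> is raised to the power
  \<open>2 ^ c + 1\<close> at most. After \<open>c\<close> rounds the remainder is empty, the edges inside the modulator
  are turned into hyperedges, and the target drops by the independence number of the vertices left over.
  The vertices are renamed to \<open>0, 1, \<dots>\<close>, because the names in the input may be
  arbitrarily large compared with the parameter.

  The running time is obtained from closure properties of the polynomial-time functions on encoded data.
\<close>

section \<open>Polynomial time\<close>

text \<open>The graph and the target stay fixed during all rounds: \<open>solvable\<close> speaks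
  about the original vertex set, adjacency and \<open>k\<close>, and a round only adds hyperedges
  and moves vertices between three parts of \<open>V\<close>. So edges that come to lie inside the
  modulator need no attention before the very end. Vertices that leave the remainder are not deleted
  either: the invariant \<open>reduced\<close> records that no admissible choice in the modulator
  lowers their independence number, so one correction of the target pays for all rounds. The
  exponent in the theorem comes from the product of the factors \<open>2 ^ i + 1\<close> for i = c,
  ..., 1, one per round. It has to be doubled, because the final modulator may carry quadratically
  many edges. Two demands shape the output: the target must be positive although the vertices left
  over may already reach it, and small although the input target is an arbitrary binary number. No
  forest is part of the input, so the algorithms recurse on the constant \<open>c\<close> and try
  every vertex as a root.\<close>

definition poly_bounded :: "(nat \<Rightarrow> nat) \<Rightarrow> bool" where
  "poly_bounded g \<longleftrightarrow> mono g \<and> (\<exists>p :: nat poly. \<forall>n. g n \<le> poly p n)"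

lemma poly_nat_mono: "m \<le> n \<Longrightarrow> poly (p :: nat poly) m \<le> poly p n"
  by (induction p) (auto intro!: add_mono mult_mono)

text \<open>Monotonicity is part of \<open>poly_bounded\<close> because bounds are mostly evaluated
  at upper estimates of a size.\<close>

lemma poly_bounded_mono: "poly_bounded g \<Longrightarrow> m \<le> n \<Longrightarrow> g m \<le> g n"
  by (auto simp: poly_bounded_def mono_def)

lemma poly_bounded_const: "poly_bounded (\<lambda>_. k)"
  unfolding poly_bounded_def by (auto simp: mono_def intro!: exI[of _ "[:k:]"])

lemma poly_bounded_id: "poly_bounded (\<lambda>n. n)"
  unfolding poly_bounded_def by (auto simp: mono_def intro!: exI[of _ "[:0, 1:]"])

lemma poly_bounded_add:
  assumes "poly_bounded f" and "poly_bounded g"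
  shows "poly_bounded (\<lambda>n. f n + g n)"
proof -
  from assms obtain p q :: "nat poly" where "\<forall>n. f n \<le> poly p n" "\<forall>n. g n \<le> poly q n"
    by (auto simp: poly_bounded_def)
  then have "\<forall>n. f n + g n \<le> poly (p + q) n"
    by (simp add: add_mono)
  with assms show ?thesis
    unfolding poly_bounded_def mono_def by (meson add_mono)
qed

lemma poly_bounded_mult:
  assumes "poly_bounded f" and "poly_bounded g"
  shows "poly_bounded (\<lambda>n. f n * g n)"
proof -
  from assms obtain p q :: "nat poly" where "\<forall>n. f n \<le> poly p n" "\<forall>n. g n \<le> poly q n"
    by (auto simp: poly_bounded_def)
  then have "\<forall>n. f n * g n \<le> poly (p * q) n"
    by (simp add: mult_mono)
  with assms show ?thesis
    unfolding poly_bounded_def mono_def by (meson mult_le_mono)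
qed

lemma poly_bounded_Suc: "poly_bounded f \<Longrightarrow> poly_bounded (\<lambda>n. Suc (f n))"
  using poly_bounded_add[OF _ poly_bounded_const[of 1]] by fastforce

lemma poly_bounded_power: "poly_bounded f \<Longrightarrow> poly_bounded (\<lambda>n. f n ^ k)"
  by (induction k) (auto intro: poly_bounded_const poly_bounded_mult)

lemma poly_bounded_compose:
  assumes "poly_bounded f" and "poly_bounded g"
  shows "poly_bounded (\<lambda>n. f (g n))"
proof -
  from assms obtain p q :: "nat poly" where p: "\<forall>n. f n \<le> poly p n" and q: "\<forall>n. g n \<le> poly q n"
    by (auto simp: poly_bounded_def)
  have "f (g n) \<le> poly (pcompose p q) n" for n
    using p q poly_nat_mono[of "g n" "poly q n" p] by (simp add: poly_pcompose) (meson order_trans)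
  with assms show ?thesis
    unfolding poly_bounded_def mono_def by (meson)
qed

lemmas poly_bounded_intros =
  poly_bounded_const poly_bounded_id poly_bounded_add poly_bounded_mult poly_bounded_Suc
  poly_bounded_power

section \<open>Time-bounded execution of programs\<close>

lemma exec_tsize_le: "exec P s n s' \<Longrightarrow> tsize (s' x) \<le> tsize (s x) + n"
proof (induction rule: exec.induct)
  case (Assign y e s)
  then show ?case using tsize_evaluate_le_cost[of e s] by auto
qed auto

text \<open>A total-correctness triple with a time budget. The budget is only an upper bound, so it
  can be rounded up when programs are composed.\<close>

definition runs :: "com \<Rightarrow> state \<Rightarrow> nat \<Rightarrow> (state \<Rightarrow> bool) \<Rightarrow> bool" where
  "runs P s k Q \<longleftrightarrow> (\<exists>n s'. exec P s n s' \<and> n \<le> k \<and> Q s')"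

lemma runs_Assign: "1 + cost e s \<le> k \<Longrightarrow> Q (s(x := evaluate e s)) \<Longrightarrow> runs (Assign x e) s k Q"
  unfolding runs_def by (blast intro: exec.Assign)

lemma runs_Skip: "1 \<le> k \<Longrightarrow> Q s \<Longrightarrow> runs Skip s k Q"
  unfolding runs_def by (blast intro: exec.Skip)

lemma runs_Seq:
  assumes "runs P s k1 R" and "\<And>s'. R s' \<Longrightarrow> runs P' s' k2 Q" and "k1 + k2 \<le> k"
  shows "runs (Seq P P') s k Q"
  using assms unfolding runs_def by (meson add_mono exec.Seq order_trans)

lemma runs_Cond:
  assumes "evaluate e s \<noteq> Leaf \<Longrightarrow> runs P s k Q" and "evaluate e s = Leaf \<Longrightarrow> runs P' s k Q"
    and "1 + cost e s + k \<le> k'"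
  shows "runs (Cond e P P') s k' Q"
proof (cases "evaluate e s = Leaf")
  case True
  with assms(2) obtain n s' where "exec P' s n s'" "n \<le> k" "Q s'"
    unfolding runs_def by blast
  with True exec.Cond_false[of e s P' n s' P] assms(3) show ?thesis
    unfolding runs_def by (meson add_left_mono order_trans)
next
  case False
  with assms(1) obtain n s' where "exec P s n s'" "n \<le> k" "Q s'"
    unfolding runs_def by blast
  with False exec.Cond_true[of e s P n s' P'] assms(3) show ?thesis
    unfolding runs_def by (meson add_left_mono order_trans)
qed

text \<open>One unrolling, with the rest of the loop as the second half of a \<open>Seq\<close>, so
  that \<open>runs_Seq\<close> applies and an induction hypothesis can take over.\<close>

lemma runs_Loop_true:
  assumes "evaluate e s \<noteq> Leaf" and "runs (Seq P (Loop e P)) s k Q" and "1 + cost e s + k \<le> k'"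
  shows "runs (Loop e P) s k' Q"
proof -
  from assms(2) obtain n s' where s': "exec (Seq P (Loop e P)) s n s'" "n \<le> k" "Q s'"
    unfolding runs_def by blast
  from s'(1) obtain m1 m2 s1 where "n = m1 + m2" "exec P s m1 s1" "exec (Loop e P) s1 m2 s'"
    by (rule exec_SeqE)
  then have "exec (Loop e P) s (1 + cost e s + m1 + m2) s'" and "1 + cost e s + m1 + m2 \<le> k'"
    using exec.Loop_true[OF assms(1)] s'(2) assms(3) by auto
  with s'(3) show ?thesis unfolding runs_def by blast
qed

lemma runs_Loop_false:
  "evaluate e s = Leaf \<Longrightarrow> 1 + cost e s \<le> k \<Longrightarrow> Q s \<Longrightarrow> runs (Loop e P) s k Q"
  unfolding runs_def by (blast intro: exec.Loop_false)

lemma runs_weaken: "runs P s k Q \<Longrightarrow> k \<le> k' \<Longrightarrow> (\<And>s'. Q s' \<Longrightarrow> Q' s') \<Longrightarrow> runs P s k' Q'"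
  unfolding runs_def by (meson order_trans)

class encodable =
  fixes encode :: "'a \<Rightarrow> tree"
  assumes encode_inject: "encode x = encode y \<longleftrightarrow> x = y"
begin

abbreviation enc_size :: "'a \<Rightarrow> nat" where
  "enc_size x \<equiv> tsize (encode x)"

end

instantiation nat :: encodable
begin
definition "encode = enc_nat"
instance by standard (simp add: encode_nat_def enc_nat_inject)
end

instantiation bool :: encodable
begin
definition "encode b = (if b then Node Leaf Leaf else Leaf)"
instance by standard (simp add: encode_bool_def)
end

instantiation prod :: (encodable, encodable) encodable
begin
definition "encode p = Node (encode (fst p)) (encode (snd p))"
instance by standard (auto simp: encode_prod_def encode_inject)
end

instantiation list :: (encodable) encodable
begin
definition "encode xs = enc_list encode xs"
instance by standard (simp add: encode_list_def enc_list_inject encode_inject)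
end

lemma encode_Nil [simp]: "encode [] = Leaf"
  and encode_Cons [simp]: "encode (x # xs) = Node (encode x) (encode xs)"
  by (simp_all add: encode_list_def)

lemma encode_Pair [simp]: "encode (x, y) = Node (encode x) (encode y)"
  by (simp add: encode_prod_def)

lemma encode_bool [simp]: "encode True = Node Leaf Leaf" "encode False = Leaf"
  by (simp_all add: encode_bool_def)

text \<open>
  The variables from \<open>d\<close> on serve as a stack: a program for \<open>f\<close> finds the argument on top of the
  stack, replaces it by the result and leaves the variables below \<open>d\<close> alone.
\<close>

definition polytime :: "('a::encodable \<Rightarrow> 'b::encodable) \<Rightarrow> bool" where
  "polytime f \<longleftrightarrow> (\<exists>P g. poly_bounded g \<and> (\<forall>d s x. s d = encode x \<longrightarrow>
     runs (P d) s (g (enc_size x)) (\<lambda>s'. s' d = encode (f x) \<and> (\<forall>y<d. s' y = s y))))"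

lemma polytimeI:
  assumes "poly_bounded g"
    and "\<And>d s x. s d = encode x \<Longrightarrow>
      runs (P d) s (g (enc_size x)) (\<lambda>s'. s' d = encode (f x) \<and> (\<forall>y<d. s' y = s y))"
  shows "polytime f"
  using assms unfolding polytime_def by blast

lemma polytimeE:
  assumes "polytime f"
  obtains P g where "poly_bounded g" and "\<And>d s x. s d = encode x \<Longrightarrow>
      runs (P d) s (g (enc_size x)) (\<lambda>s'. s' d = encode (f x) \<and> (\<forall>y<d. s' y = s y))"
  using assms unfolding polytime_def by blast

text \<open>Storing a value costs at least its size, so by \<open>exec_tsize_le\<close> a result is
  no larger than the input and the running time together. This bound is needed whenever a result is
  handed to another program.\<close>

lemma polytime_enc_size:
  assumes "polytime f"
  obtains g where "poly_bounded g" and "\<And>x. enc_size (f x) \<le> g (enc_size x)"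
proof -
  from assms obtain P g where g: "poly_bounded g" and P: "\<And>d s x. s d = encode x \<Longrightarrow>
      runs (P d) s (g (enc_size x)) (\<lambda>s'. s' d = encode (f x) \<and> (\<forall>y<d. s' y = s y))"
    by (rule polytimeE) (rule that)
  have "enc_size (f x) \<le> enc_size x + g (enc_size x)" for x
  proof -
    obtain n s' where "exec (P 0) (\<lambda>_. encode x) n s'" "n \<le> g (enc_size x)" "s' 0 = encode (f x)"
      using P[of "\<lambda>_. encode x" 0 x] unfolding runs_def by auto
    then show ?thesis using exec_tsize_le[of "P 0" "\<lambda>_. encode x" n s' 0] by simp
  qed
  then show thesis
    using that[of "\<lambda>n. n + g n"] g by (simp add: poly_bounded_intros)
qed

section \<open>Closure under composition, pairing, case distinction and basic list
  operations\<close>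

lemma polytime_id: "polytime (\<lambda>x. x)"
  by (rule polytimeI[where P = "\<lambda>_. Skip" and g = "\<lambda>_. 1"])
    (auto intro: poly_bounded_const runs_Skip)

lemma polytime_compose:
  fixes f :: "'b::encodable \<Rightarrow> 'c::encodable" and g :: "'a::encodable \<Rightarrow> 'b"
  assumes "polytime f" and "polytime g"
  shows "polytime (\<lambda>x. f (g x))"
proof -
  from assms(1) obtain P p where p: "poly_bounded p" and P: "\<And>d s x. s d = encode x \<Longrightarrow>
      runs (P d) s (p (enc_size x)) (\<lambda>s'. s' d = encode (f x) \<and> (\<forall>y<d. s' y = s y))"
    by (rule polytimeE) (rule that)
  from assms(2) obtain Q q where q: "poly_bounded q" and Q: "\<And>d s x. s d = encode x \<Longrightarrow>
      runs (Q d) s (q (enc_size x)) (\<lambda>s'. s' d = encode (g x) \<and> (\<forall>y<d. s' y = s y))"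
    by (rule polytimeE) (rule that)
  from assms(2) obtain h where h: "poly_bounded h" and gh: "\<And>x. enc_size (g x) \<le> h (enc_size x)"
    by (rule polytime_enc_size) (rule that)
  show ?thesis
  proof (rule polytimeI[where P = "\<lambda>d. Seq (Q d) (P d)" and g = "\<lambda>n. q n + p (h n)"])
    show "poly_bounded (\<lambda>n. q n + p (h n))"
      by (rule poly_bounded_add[OF q poly_bounded_compose[OF p h]])
    fix d and s :: state and x :: 'a
    assume "s d = encode x"
    then show "runs (Seq (Q d) (P d)) s (q (enc_size x) + p (h (enc_size x)))
      (\<lambda>s'. s' d = encode (f (g x)) \<and> (\<forall>y<d. s' y = s y))"
      by (intro runs_Seq[OF Q] runs_weaken[OF P]) 
        (auto intro: poly_bounded_mono[OF p gh])
  qed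
qed

lemma polytime_simple:
  fixes f :: "'a::encodable \<Rightarrow> 'b::encodable"
  assumes g: "poly_bounded g"
    and "\<And>d s x. s d = encode x \<Longrightarrow> evaluate (e d) s = encode (f x)"
    and "\<And>d s (x :: 'a). s d = encode x \<Longrightarrow> cost (e d) s \<le> g (enc_size x)"
  shows "polytime f"
  by (rule polytimeI[where P = "\<lambda>d. Assign d (e d)" and g = "\<lambda>n. 1 + g n"])
    (auto intro!: poly_bounded_Suc g runs_Assign simp: assms(2,3))

fun tree_expr :: "tree \<Rightarrow> expr" where
  "tree_expr Leaf = Leaf_const"
| "tree_expr (Node l r) = Pair_of (tree_expr l) (tree_expr r)"

lemma evaluate_tree_expr [simp]: "evaluate (tree_expr t) s = t"
  and cost_tree_expr [simp]: "cost (tree_expr t) s = tsize t"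
  by (induction t) auto

lemma polytime_const: "polytime (\<lambda>_. c)"
  by (rule polytime_simple[where e = "\<lambda>_. tree_expr (encode c)" and g = "\<lambda>_. enc_size c"])
    (auto intro: poly_bounded_const)

lemma polytime_fst': "polytime fst"
  by (rule polytime_simple[where e = "\<lambda>d. Left_of (Var d)" and g = "\<lambda>n. 1 + n"])
    (simp_all add: encode_prod_def poly_bounded_intros)

lemma polytime_snd': "polytime snd"
  by (rule polytime_simple[where e = "\<lambda>d. Right_of (Var d)" and g = "\<lambda>n. 1 + n"])
    (simp_all add: encode_prod_def poly_bounded_intros)

lemmas polytime_fst = polytime_compose[OF polytime_fst']
lemmas polytime_snd = polytime_compose[OF polytime_snd']

lemma polytime_Pair:
  fixes f :: "'a::encodable \<Rightarrow> 'b::encodable" and g :: "'a \<Rightarrow> 'c::encodable"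
  assumes "polytime f" and "polytime g"
  shows "polytime (\<lambda>x. (f x, g x))"
proof -
  from assms(1) obtain P p where p: "poly_bounded p" and P: "\<And>d s x. s d = encode x \<Longrightarrow>
      runs (P d) s (p (enc_size x)) (\<lambda>s'. s' d = encode (f x) \<and> (\<forall>y<d. s' y = s y))"
    by (rule polytimeE) (rule that)
  from assms(2) obtain Q q where q: "poly_bounded q" and Q: "\<And>d s x. s d = encode x \<Longrightarrow>
      runs (Q d) s (q (enc_size x)) (\<lambda>s'. s' d = encode (g x) \<and> (\<forall>y<d. s' y = s y))"
    by (rule polytimeE) (rule that)
  from assms(1) obtain h where h: "poly_bounded h" and fh: "\<And>x. enc_size (f x) \<le> h (enc_size x)"
    by (rule polytime_enc_size) (rule that)
  from assms(2) obtain k where k: "poly_bounded k" and gk: "\<And>x. enc_size (g x) \<le> k (enc_size x)"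
    by (rule polytime_enc_size) (rule that)
  \<comment> \<open>Both programs overwrite their argument, so each works on a copy higher up on the
    stack while \<open>d\<close> keeps the original.\<close>
  show ?thesis
  proof (rule polytimeI[where P = "\<lambda>d. Seq (Assign (d + 1) (Var d)) (Seq (P (d + 1))
      (Seq (Assign (d + 2) (Var d)) (Seq (Q (d + 2)) (Assign d (Pair_of (Var (d + 1)) (Var (d + 2)))))))"
      and g = "\<lambda>n. (1 + n) + (p n + ((1 + n) + (q n + (2 + h n + k n))))"])
    show "poly_bounded (\<lambda>n. (1 + n) + (p n + ((1 + n) + (q n + (2 + h n + k n)))))"
      using p q h k by (intro poly_bounded_intros)
    fix d and s :: state and x :: 'a
    assume s: "s d = encode x"
    show "runs (Seq (Assign (d + 1) (Var d)) (Seq (P (d + 1))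
      (Seq (Assign (d + 2) (Var d)) (Seq (Q (d + 2)) (Assign d (Pair_of (Var (d + 1)) (Var (d + 2))))))))
      s ((1 + enc_size x) + (p (enc_size x) + ((1 + enc_size x) + (q (enc_size x) +
        (2 + h (enc_size x) + k (enc_size x))))))
      (\<lambda>s'. s' d = encode (f x, g x) \<and> (\<forall>y<d. s' y = s y))"
      apply (rule runs_Seq[where R = "\<lambda>s'. s' (d + 1) = encode x \<and> (\<forall>y\<le>d. s' y = s y)", OF runs_Assign _ order_refl])
        apply (simp add: s)
       apply (simp add: s)
      apply (rule runs_Seq[where R = "\<lambda>s'. s' (d + 1) = encode (f x) \<and> (\<forall>y\<le>d. s' y = s y)", OF runs_weaken[OF P] _ order_refl])
         apply simp
        apply simp
       apply simp
      apply (rule runs_Seq[where R = "\<lambda>s'. s' (d + 2) = encode x \<and> s' (d + 1) = encode (f x) \<and> (\<forall>y\<le>d. s' y = s y)", OF runs_Assign _ order_refl])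
        apply (simp add: s)
       apply (simp add: s)
      apply (rule runs_Seq[where R = "\<lambda>s'. s' (d + 2) = encode (g x) \<and> s' (d + 1) = encode (f x) \<and> (\<forall>y\<le>d. s' y = s y)", OF runs_weaken[OF Q] _ order_refl])
         apply simp
        apply simp
       apply simp
      apply (rule runs_Assign)
      using fh[of x] gk[of x] by (auto)
  qed
qed

lemma polytime_if:
  fixes f g :: "'a::encodable \<Rightarrow> 'b::encodable"
  assumes "polytime b" and "polytime f" and "polytime g"
  shows "polytime (\<lambda>x. if b x then f x else g x)"
proof -
  from assms(1) obtain B r where r: "poly_bounded r" and B: "\<And>d s x. s d = encode x \<Longrightarrow>
      runs (B d) s (r (enc_size x)) (\<lambda>s'. s' d = encode (b x) \<and> (\<forall>y<d. s' y = s y))"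
    by (rule polytimeE) (rule that)
  from assms(2) obtain P p where p: "poly_bounded p" and P: "\<And>d s x. s d = encode x \<Longrightarrow>
      runs (P d) s (p (enc_size x)) (\<lambda>s'. s' d = encode (f x) \<and> (\<forall>y<d. s' y = s y))"
    by (rule polytimeE) (rule that)
  from assms(3) obtain Q q where q: "poly_bounded q" and Q: "\<And>d s x. s d = encode x \<Longrightarrow>
      runs (Q d) s (q (enc_size x)) (\<lambda>s'. s' d = encode (g x) \<and> (\<forall>y<d. s' y = s y))"
    by (rule polytimeE) (rule that)
  show ?thesis
  proof (rule polytimeI[where P = "\<lambda>d. Seq (Assign (d + 1) (Var d)) (Seq (B (d + 1))
      (Cond (Var (d + 1)) (P d) (Q d)))"
      and g = "\<lambda>n. (1 + n) + (r n + (4 + p n + q n))"])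
    show "poly_bounded (\<lambda>n. (1 + n) + (r n + (4 + p n + q n)))"
      using p q r by (intro poly_bounded_intros)
    fix d and s :: state and x :: 'a
    assume s: "s d = encode x"
    show "runs (Seq (Assign (d + 1) (Var d)) (Seq (B (d + 1)) (Cond (Var (d + 1)) (P d) (Q d))))
      s ((1 + enc_size x) + (r (enc_size x) + (4 + p (enc_size x) + q (enc_size x))))
      (\<lambda>s'. s' d = encode (if b x then f x else g x) \<and> (\<forall>y<d. s' y = s y))"
      apply (rule runs_Seq[where R = "\<lambda>s'. s' (d + 1) = encode x \<and> (\<forall>y\<le>d. s' y = s y)", OF runs_Assign _ order_refl])
        apply (simp add: s)
       apply (simp add: s)
      apply (rule runs_Seq[where R = "\<lambda>s'. s' (d + 1) = encode (b x) \<and> (\<forall>y\<le>d. s' y = s y)", OF runs_weaken[OF B] _ order_refl])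
         apply simp
        apply simp
       apply simp
      apply (rule runs_Cond[where k = "p (enc_size x) + q (enc_size x)"])
        apply (rule runs_weaken[OF P[where x = x]])
          apply (auto simp: s encode_bool_def split: if_splits)[3]
       apply (rule runs_weaken[OF Q[where x = x]])
         apply (auto simp: s encode_bool_def split: if_splits)
      done
  qed
qed

text \<open>Encodings are injective, so comparing trees decides equality of the data.\<close>

lemma polytime_eq:
  assumes "polytime f" and "polytime g"
  shows "polytime (\<lambda>x. f x = g x)"
proof -
  have "polytime (\<lambda>p :: 'b \<times> 'b. fst p = snd p)"
    by (rule polytime_simple[where e = "\<lambda>d. Equal (Left_of (Var d)) (Right_of (Var d))"
        and g = "\<lambda>n. 3 + n + n"])
      (auto simp: encode_prod_def encode_inject intro!: poly_bounded_intros)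
  from polytime_compose[OF this polytime_Pair[OF assms]] show ?thesis by simp
qed

text \<open>A nonempty list has the same encoding as the pair of its head and its tail, so nothing
  is left to compute after \<open>polytime_Pair\<close>.\<close>

lemma polytime_Cons:
  assumes "polytime f" and "polytime g"
  shows "polytime (\<lambda>x. f x # g x)"
proof -
  have "polytime (\<lambda>p. fst p # snd p :: 'b list)"
    by (rule polytime_simple[where e = "\<lambda>d. Var d" and g = "\<lambda>n. n"])
      (auto simp: encode_prod_def intro!: poly_bounded_intros)
  from polytime_compose[OF this polytime_Pair[OF assms]] show ?thesis by simp
qed

lemma polytime_tl:
  assumes "polytime f"
  shows "polytime (\<lambda>x. tl (f x))"
proof -
  have "evaluate (Right_of (Var d)) s = encode (tl xs)" if "s d = encode xs" for d s and xs :: "'b list"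
    using that by (cases xs) auto
  then have "polytime (tl :: 'b list \<Rightarrow> _)"
    by (intro polytime_simple[where e = "\<lambda>d. Right_of (Var d)" and g = "\<lambda>n. 1 + n"])
      (auto intro!: poly_bounded_intros)
  from polytime_compose[OF this assms] show ?thesis .
qed

section \<open>Iteration over lists\<close>

lemma enc_size_ge_1: "1 \<le> enc_size x"
  using tsize_pos[of "encode x"] by simp

lemma length_le_enc_size: "length xs < enc_size xs"
  by (induction xs) auto

lemma enc_size_append: "enc_size (xs @ ys) + 1 = enc_size xs + enc_size ys"
  by (induction xs) auto

lemma enc_size_member: "x \<in> set xs \<Longrightarrow> enc_size x < enc_size xs"
  by (induction xs) auto

text \<open>Iterating a polynomial-time step can produce exponentially large data. Therefore a
  polynomial bound is demanded for every accumulator that occurs, that is, for the fold over each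
  prefix \<open>ys\<close> of the list.\<close>

lemma polytime_fold_bounded:
  fixes F :: "'a::encodable \<Rightarrow> 'b::encodable \<Rightarrow> 'c::encodable \<Rightarrow> 'c"
  assumes l: "polytime l" and a: "polytime a"
    and step: "polytime (\<lambda>p. F (fst (fst p)) (snd (fst p)) (snd p))"
    and g: "poly_bounded g"
    and bound: "\<And>x ys zs. l x = ys @ zs \<Longrightarrow> enc_size (fold (F x) ys (a x)) \<le> g (enc_size x)"
  shows "polytime (\<lambda>x. fold (F x) (l x) (a x))"
proof -
  from l obtain Pl pl where pl: "poly_bounded pl" and Pl: "\<And>d s x. s d = encode x \<Longrightarrow>
      runs (Pl d) s (pl (enc_size x)) (\<lambda>s'. s' d = encode (l x) \<and> (\<forall>y<d. s' y = s y))"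
    by (rule polytimeE) (rule that)
  from a obtain Pa pa where pa: "poly_bounded pa" and Pa: "\<And>d s x. s d = encode x \<Longrightarrow>
      runs (Pa d) s (pa (enc_size x)) (\<lambda>s'. s' d = encode (a x) \<and> (\<forall>y<d. s' y = s y))"
    by (rule polytimeE) (rule that)
  from step obtain Q q where q: "poly_bounded q" and "\<And>d s p. s d = encode p \<Longrightarrow>
      runs (Q d) s (q (enc_size p)) (\<lambda>s'. s' d = encode (F (fst (fst p)) (snd (fst p)) (snd p)) \<and> (\<forall>y<d. s' y = s y))"
    by (rule polytimeE) (rule that)
  from this(2)[where p = "((x, y), b)" for x y b]
  have Q: "runs (Q d) s (q (enc_size ((x, y), b))) (\<lambda>s'. s' d = encode (F x y b) \<and> (\<forall>y<d. s' y = s y))"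
    if "s d = encode ((x, y), b)" for d s x y b using that by simp
  from l obtain h where h: "poly_bounded h" and lh: "\<And>x. enc_size (l x) \<le> h (enc_size x)"
    by (rule polytime_enc_size) (rule that)
  \<comment> \<open>The budget of one pass: the body together with one test of the loop condition,
    generously rounded.\<close>
  define K where "K n = 20 + n + 3 * h n + 2 * g n + q (2 + n + h n + g n)" for n
  define body where "body d = Seq (Assign (d + 3) (Pair_of (Pair_of (Var d) (Left_of (Var (d + 1)))) (Var (d + 2))))
     (Seq (Q (d + 3)) (Seq (Assign (d + 2) (Var (d + 3))) (Assign (d + 1) (Right_of (Var (d + 1))))))" for d
  have K: "poly_bounded K"
    unfolding K_def
    by (rule poly_bounded_add[OF _ poly_bounded_compose[OF q]]; intro poly_bounded_intros g h)
  \<comment> \<open>Loop invariant: \<open>ys\<close> has been consumed, \<open>zs\<close> is still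
    stored in \<open>d + 1\<close>, and the accumulator for \<open>ys\<close> is in
    \<open>d + 2\<close>. The additional 1 in \<open>length zs + 1\<close> is for the final, failing
    test.\<close>
  have loop: "runs (Loop (Var (d + 1)) (body d)) s ((length zs + 1) * K (enc_size x))
      (\<lambda>s'. s' (d + 2) = encode (fold (F x) (l x) (a x)) \<and> (\<forall>y\<le>d. s' y = s y))"
    if "l x = ys @ zs" "s d = encode x" "s (d + 1) = encode zs"
      "s (d + 2) = encode (fold (F x) ys (a x))" for d s x ys zs
    using that
  proof (induction zs arbitrary: ys s)
    case Nil
    then show ?case by (intro runs_Loop_false) (auto simp: K_def)
  next
    case (Cons z zs)
    let ?n = "enc_size x" and ?b = "fold (F x) ys (a x)" and ?b' = "fold (F x) (ys @ [z]) (a x)"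
    have sz: "enc_size (z # zs) \<le> h ?n"
      using lh[of x] enc_size_append[of ys "z # zs"] enc_size_ge_1[of ys] Cons.prems(1)
      by simp
    have b: "enc_size ?b \<le> g ?n" "enc_size ?b' \<le> g ?n"
      using bound[of x ys "z # zs"] bound[of x "ys @ [z]" zs] Cons.prems(1) by simp_all
    have trip: "q (enc_size ((x, z), ?b)) \<le> q (2 + ?n + h ?n + g ?n)"
      using sz b by (intro poly_bounded_mono[OF q]) auto
    have body: "runs (body d) s (18 + ?n + 2 * h ?n + 2 * g ?n + q (2 + ?n + h ?n + g ?n))
      (\<lambda>s'. s' (d + 1) = encode zs \<and> s' (d + 2) = encode ?b' \<and> (\<forall>y\<le>d. s' y = s y))"
      unfolding body_def
      apply (rule runs_Seq[where R = "\<lambda>s'. s' (d + 3) = encode ((x, z), ?b) \<and> s' (d + 1) = encode (z # zs) \<and>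
            (\<forall>y\<le>d. s' y = s y)" and ?k1.0 = "4 + ?n + h ?n + g ?n"])
        apply (rule runs_Assign)
      subgoal using Cons.prems sz b by simp
      subgoal using Cons.prems by simp
       apply (rule runs_Seq[where R = "\<lambda>s'. s' (d + 3) = encode ?b' \<and> s' (d + 1) = encode (z # zs) \<and>
            (\<forall>y\<le>d. s' y = s y)", OF runs_weaken[OF Q[where x = x and y = z and b = ?b] trip] _ order_refl])
      subgoal by simp
      subgoal by simp
       apply (rule runs_Seq[where R = "\<lambda>s'. s' (d + 2) = encode ?b' \<and> s' (d + 1) = encode (z # zs) \<and>
            (\<forall>y\<le>d. s' y = s y)", OF runs_Assign[where k = "1 + g ?n"] _ order_refl])
      subgoal using b by simp
      subgoal by simp
       apply (rule runs_Assign[where k = "2 + h ?n"])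
      subgoal using sz by simp
      subgoal by simp
      apply simp
      done
    show ?case
    \<comment> \<open>The test takes at most \<open>1 + h ?n\<close> of the budget of the pass. The
      subtraction does not truncate, since \<open>K ?n\<close> contains \<open>20\<close> and
      \<open>3 * h ?n\<close>.\<close>
    proof (rule runs_Loop_true[where k = "K ?n - 2 - h ?n + (length zs + 1) * K ?n"])
      show "evaluate (Var (d + 1)) s \<noteq> Leaf" using Cons.prems by simp
      show "1 + cost (Var (d + 1)) s + (K ?n - 2 - h ?n + (length zs + 1) * K ?n)
          \<le> (length (z # zs) + 1) * K ?n"
        using Cons.prems(3) sz by (simp add: K_def)
      show "runs (Seq (body d) (Loop (Var (d + 1)) (body d))) s (K ?n - 2 - h ?n + (length zs + 1) * K ?n)
          (\<lambda>s'. s' (d + 2) = encode (fold (F x) (l x) (a x)) \<and> (\<forall>y\<le>d. s' y = s y))"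
      proof (rule runs_Seq[OF body])
        fix s' assume s': "s' (d + 1) = encode zs \<and> s' (d + 2) = encode ?b' \<and> (\<forall>y\<le>d. s' y = s y)"
        show "runs (Loop (Var (d + 1)) (body d)) s' ((length zs + 1) * K ?n)
            (\<lambda>s'. s' (d + 2) = encode (fold (F x) (l x) (a x)) \<and> (\<forall>y\<le>d. s' y = s y))"
          by (rule runs_weaken[OF Cons.IH[of "ys @ [z]"]]) (use s' Cons.prems in simp_all)
      qed (simp add: K_def)
    qed
  qed
  show ?thesis
  proof (rule polytimeI[where P = "\<lambda>d. Seq (Assign (d + 1) (Var d)) (Seq (Pl (d + 1))
      (Seq (Assign (d + 2) (Var d)) (Seq (Pa (d + 2)) (Seq (Loop (Var (d + 1)) (body d)) (Assign d (Var (d + 2)))))))"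
      and g = "\<lambda>n. (1 + n) + (pl n + ((1 + n) + (pa n + (h n * K n + (1 + g n)))))"])
    show "poly_bounded (\<lambda>n. (1 + n) + (pl n + ((1 + n) + (pa n + (h n * K n + (1 + g n))))))"
      using pl pa h K g by (intro poly_bounded_intros)
    fix d and s :: state and x :: 'a
    assume s: "s d = encode x"
    have len: "(length (l x) + 1) * K (enc_size x) \<le> h (enc_size x) * K (enc_size x)"
      using length_le_enc_size[of "l x"] lh[of x] by (intro mult_right_mono) auto
    show "runs (Seq (Assign (d + 1) (Var d)) (Seq (Pl (d + 1))
      (Seq (Assign (d + 2) (Var d)) (Seq (Pa (d + 2)) (Seq (Loop (Var (d + 1)) (body d)) (Assign d (Var (d + 2))))))))
      s ((1 + enc_size x) + (pl (enc_size x) + ((1 + enc_size x) + (pa (enc_size x) +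
        (h (enc_size x) * K (enc_size x) + (1 + g (enc_size x)))))))
      (\<lambda>s'. s' d = encode (fold (F x) (l x) (a x)) \<and> (\<forall>y<d. s' y = s y))"
      apply (rule runs_Seq[where R = "\<lambda>s'. s' (d + 1) = encode x \<and> (\<forall>y\<le>d. s' y = s y)", OF runs_Assign _ order_refl])
        apply (simp add: s)
       apply (simp add: s)
      apply (rule runs_Seq[where R = "\<lambda>s'. s' (d + 1) = encode (l x) \<and> (\<forall>y\<le>d. s' y = s y)", OF runs_weaken[OF Pl] _ order_refl])
         apply simp
        apply simp
       apply simp
      apply (rule runs_Seq[where R = "\<lambda>s'. s' (d + 2) = encode x \<and> s' (d + 1) = encode (l x) \<and> (\<forall>y\<le>d. s' y = s y)", OF runs_Assign _ order_refl])
        apply (simp add: s)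
       apply (simp add: s)
      apply (rule runs_Seq[where R = "\<lambda>s'. s' (d + 2) = encode (a x) \<and> s' (d + 1) = encode (l x) \<and> (\<forall>y\<le>d. s' y = s y)", OF runs_weaken[OF Pa] _ order_refl])
         apply simp
        apply simp
       apply simp
      apply (rule runs_Seq[where R = "\<lambda>s'. s' (d + 2) = encode (fold (F x) (l x) (a x)) \<and> (\<forall>y\<le>d. s' y = s y)",
            OF runs_weaken[OF loop[of x "[]" "l x"] len] _ order_refl])
           apply (simp_all add: s)
      apply (rule runs_Assign)
      using bound[of x "l x" "[]"] by auto
  qed
qed

text \<open>If the growth per step does not depend on the accumulator, the total growth is at most
  the number of steps times a polynomial. This supplies the bound for
  \<open>polytime_fold_bounded\<close>.\<close>

lemma polytime_fold:
  fixes F :: "'a::encodable \<Rightarrow> 'b::encodable \<Rightarrow> 'c::encodable \<Rightarrow> 'c"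
  assumes l: "polytime l" and a: "polytime a"
    and step: "polytime (\<lambda>p. F (fst (fst p)) (snd (fst p)) (snd p))"
    and g: "poly_bounded g"
    and bound: "\<And>x y b. enc_size (F x y b) \<le> enc_size b + g (enc_size x + enc_size y)"
  shows "polytime (\<lambda>x. fold (F x) (l x) (a x))"
proof -
  from l obtain h where h: "poly_bounded h" and lh: "\<And>x. enc_size (l x) \<le> h (enc_size x)"
    by (rule polytime_enc_size) (rule that)
  from a obtain k where k: "poly_bounded k" and ak: "\<And>x. enc_size (a x) \<le> k (enc_size x)"
    by (rule polytime_enc_size) (rule that)
  \<comment> \<open>Each element is charged with the size of a fixed list \<open>zs\<close>, so that
    the bound does not change while the induction shortens \<open>ys\<close>.\<close>
  have size: "enc_size (fold (F x) ys b) \<le> enc_size b + length ys * g (enc_size x + enc_size zs)"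
    if "set ys \<subseteq> set zs" for x ys b and zs :: "'b list"
    using that
  proof (induction ys arbitrary: b)
    case (Cons y ys)
    have "g (enc_size x + enc_size y) \<le> g (enc_size x + enc_size zs)"
      using Cons.prems enc_size_member[of y zs] by (intro poly_bounded_mono[OF g]) auto
    with bound[of x y b] Cons.IH[of "F x y b"] Cons.prems show ?case by auto
  qed simp
  show ?thesis
  proof (rule polytime_fold_bounded[OF l a step, where g = "\<lambda>n. k n + h n * g (n + h n)"])
    show "poly_bounded (\<lambda>n. k n + h n * g (n + h n))"
      by (intro poly_bounded_add poly_bounded_mult poly_bounded_compose[OF g] poly_bounded_id h k)
    fix x ys zs assume l: "l x = ys @ zs"
    have "enc_size (fold (F x) ys (a x)) \<le> enc_size (a x) + length ys * g (enc_size x + enc_size (l x))"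
      using size[of ys "l x" x "a x"] l by simp
    also have "\<dots> \<le> k (enc_size x) + h (enc_size x) * g (enc_size x + h (enc_size x))"
      using ak[of x] lh[of x] length_le_enc_size[of "l x"] l
      by (intro add_mono mult_mono poly_bounded_mono[OF g]) auto
    finally show "enc_size (fold (F x) ys (a x)) \<le> k (enc_size x) + h (enc_size x) * g (enc_size x + h (enc_size x))" .
  qed
qed

text \<open>Only the codes matter, so \<open>f\<close> and \<open>g\<close> may even have different
  result types. This identifies numbers with lists of bits below.\<close>

lemma polytime_recode:
  assumes "polytime f" and "\<And>x. encode (g x) = encode (f x)"
  shows "polytime g"
  using assms unfolding polytime_def by simp

lemma polytime_not: "polytime b \<Longrightarrow> polytime (\<lambda>x. \<not> b x)"
  by (rule polytime_recode[OF polytime_if[of b "\<lambda>_. False" "\<lambda>_. True"]])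
    (auto intro: polytime_const)

lemma polytime_conj: "polytime a \<Longrightarrow> polytime b \<Longrightarrow> polytime (\<lambda>x. a x \<and> b x)"
  by (rule polytime_recode[OF polytime_if[of a b "\<lambda>_. False"]]) (auto intro: polytime_const)

lemma polytime_disj: "polytime a \<Longrightarrow> polytime b \<Longrightarrow> polytime (\<lambda>x. a x \<or> b x)"
  by (rule polytime_recode[OF polytime_if[of a "\<lambda>_. True" b]]) (auto intro: polytime_const)

lemmas polytime_basic =
  polytime_id polytime_const polytime_fst polytime_snd polytime_Pair polytime_if polytime_eq
  polytime_Cons polytime_tl polytime_not polytime_conj polytime_disj

section \<open>List operations and bounded quantifiers\<close>

lemma polytime_rev:
  assumes "polytime l"
  shows "polytime (\<lambda>x. rev (l x))"
proof -
  have "polytime (\<lambda>x. fold (\<lambda>y b. y # b) (l x) [])"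
    by (rule polytime_fold[where g = "\<lambda>n. 1 + n"])
      (auto intro!: polytime_basic assms poly_bounded_intros)
  then show ?thesis by (simp add: fold_Cons_rev)
qed

lemma polytime_append:
  assumes "polytime l" and "polytime m"
  shows "polytime (\<lambda>x. l x @ m x)"
proof -
  have "polytime (\<lambda>x. fold (\<lambda>y b. y # b) (rev (l x)) (m x))"
    by (rule polytime_fold[where g = "\<lambda>n. 1 + n"])
      (auto intro!: polytime_basic polytime_rev assms poly_bounded_intros)
  then show ?thesis by (simp add: fold_Cons_rev)
qed

lemma polytime_map:
  assumes l: "polytime l" and F: "polytime (\<lambda>p. F (fst p) (snd p))"
  shows "polytime (\<lambda>x. map (F x) (l x))"
proof -
  from F obtain g where g: "poly_bounded g" and Fg: "\<And>p. enc_size (F (fst p) (snd p)) \<le> g (enc_size p)"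
    by (rule polytime_enc_size) (rule that)
  have *: "polytime (\<lambda>x. fold (\<lambda>y b. F x y # b) (l x) [])"
  proof (rule polytime_fold[where g = "\<lambda>n. 1 + g (1 + n)"])
    show "polytime (\<lambda>p. F (fst (fst p)) (snd (fst p)) # snd p)"
      using polytime_compose[OF F polytime_fst'] by (intro polytime_basic)
    show "poly_bounded (\<lambda>n. 1 + g (1 + n))"
      by (intro poly_bounded_intros poly_bounded_compose[OF g])
    show "enc_size (F x y # b) \<le> enc_size b + (1 + g (1 + (enc_size x + enc_size y)))" for x y b
      using Fg[of "(x, y)"] by (simp add: add.assoc)
  qed (auto intro: l polytime_basic)
  have **: "fold (\<lambda>y b. F x y # b) ys zs = rev (map (F x) ys) @ zs" for x ys zs
    by (induction ys arbitrary: zs) auto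
  show ?thesis
    by (rule polytime_recode[OF polytime_rev[OF *]]) (simp add: **)
qed

lemma polytime_filter:
  assumes l: "polytime l" and P: "polytime (\<lambda>p. P (fst p) (snd p))"
  shows "polytime (\<lambda>x. filter (P x) (l x))"
proof -
  have *: "polytime (\<lambda>x. fold (\<lambda>y b. if P x y then y # b else b) (l x) [])"
  proof (rule polytime_fold[where g = "\<lambda>n. 1 + n"])
    show "polytime (\<lambda>p. if P (fst (fst p)) (snd (fst p)) then snd (fst p) # snd p else snd p)"
      using polytime_compose[OF P polytime_fst'] by (intro polytime_basic)
  qed (auto intro!: l polytime_basic poly_bounded_intros)
  have **: "fold (\<lambda>y b. if P x y then y # b else b) ys zs = rev (filter (P x) ys) @ zs" for x ys zs
    by (induction ys arbitrary: zs) auto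
  show ?thesis
    by (rule polytime_recode[OF polytime_rev[OF *]]) (simp add: **)
qed

lemma polytime_concat:
  fixes l :: "'a::encodable \<Rightarrow> 'b::encodable list list"
  assumes "polytime l"
  shows "polytime (\<lambda>x. concat (l x))"
proof -
  have step: "enc_size (b @ y) \<le> enc_size b + (enc_size (x :: 'a) + enc_size y)" for x and b y :: "'b list"
    using enc_size_append[of b y] by simp
  have *: "polytime (\<lambda>x. fold (\<lambda>y b. b @ y) (l x) [])"
    by (rule polytime_fold[where g = "\<lambda>n. n"])
      (rule step | intro polytime_basic polytime_append assms poly_bounded_intros)+
  have **: "fold (\<lambda>y b. b @ y) ys zs = zs @ concat ys" for ys and zs :: "'b list"
    by (induction ys arbitrary: zs) auto
  show ?thesis
    by (rule polytime_recode[OF *]) (simp add: **)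
qed

lemma polytime_bex:
  assumes l: "polytime l" and P: "polytime (\<lambda>p. P (fst p) (snd p))"
  shows "polytime (\<lambda>x. \<exists>y\<in>set (l x). P x y)"
proof (rule polytime_recode)
  show "polytime (\<lambda>x. filter (P x) (l x) \<noteq> [])"
    by (intro polytime_basic polytime_filter l P)
qed (simp add: filter_empty_conv)

lemma polytime_ball:
  assumes l: "polytime l" and P: "polytime (\<lambda>p. P (fst p) (snd p))"
  shows "polytime (\<lambda>x. \<forall>y\<in>set (l x). P x y)"
proof (rule polytime_recode)
  show "polytime (\<lambda>x. \<not> (\<exists>y\<in>set (l x). \<not> P x y))"
    by (intro polytime_basic polytime_bex l P)
qed simp

lemma polytime_member:
  assumes a: "polytime a" and l: "polytime l"
  shows "polytime (\<lambda>x. a x \<in> set (l x))"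
proof (rule polytime_recode)
  show "polytime (\<lambda>x. \<exists>y\<in>set (l x). a x = y)"
    by (intro polytime_basic polytime_bex l polytime_compose[OF a])
qed simp

text \<open>The library's \<open>remdups\<close> is not a left-to-right fold.\<close>

definition dedup :: "'a list \<Rightarrow> 'a list" where
  "dedup xs = fold List.insert xs []"

lemma set_dedup [simp]: "set (dedup xs) = set xs"
proof -
  have "set (fold List.insert xs ys) = set xs \<union> set ys" for ys
    by (induction xs arbitrary: ys) auto
  then show ?thesis by (simp add: dedup_def)
qed

lemma distinct_dedup [simp]: "distinct (dedup xs)"
proof -
  have "distinct ys \<Longrightarrow> distinct (fold List.insert xs ys)" for ys
    by (induction xs arbitrary: ys) auto
  then show ?thesis by (simp add: dedup_def)
qed

lemma polytime_dedup:
  assumes "polytime l"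
  shows "polytime (\<lambda>x. dedup (l x))"
  unfolding dedup_def List.insert_def
  by (rule polytime_fold[where g = "\<lambda>n. 1 + n"])
    (auto intro!: polytime_basic polytime_member assms poly_bounded_intros)

text \<open>Lengths are compared without arithmetic: after one element of \<open>m x\<close> is
  dropped for each element of \<open>l x\<close>, something is left exactly if \<open>m x\<close> is
  longer.\<close>

lemma polytime_length_less:
  fixes l :: "'a::encodable \<Rightarrow> 'b::encodable list" and m :: "'a \<Rightarrow> 'c::encodable list"
  assumes "polytime l" and "polytime m"
  shows "polytime (\<lambda>x. length (l x) < length (m x))"
proof (rule polytime_recode)
  have "enc_size (tl b) \<le> enc_size b" for b :: "'c list"
    by (cases b) auto
  then show "polytime (\<lambda>x. fold (\<lambda>_. tl) (l x) (m x) \<noteq> [])"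
    by (intro polytime_basic polytime_fold[where g = "\<lambda>_. 0"])
      (auto intro!: polytime_basic assms poly_bounded_intros)
  have "(fold (\<lambda>_. tl) ys zs \<noteq> []) = (length ys < length zs)" for ys :: "'b list" and zs :: "'c list"
    by (induction ys arbitrary: zs) auto
  then show "encode (length (l x) < length (m x)) = encode (fold (\<lambda>_. tl) (l x) (m x) \<noteq> [])" for x
    by simp
qed

section \<open>Binary numbers\<close>

fun bits :: "nat \<Rightarrow> bool list" where
  "bits n = (if n = 0 then [] else odd n # bits (n div 2))"

declare bits.simps [simp del]

text \<open>A number and its list of bits have the same code, so programs on lists do arithmetic
  without any conversion.\<close>

lemma encode_bits: "encode (bits n) = encode n"
proof (induction n rule: less_induct)
  case (less n)
  then show ?case
    by (cases "n = 0")
      (auto simp: bits.simps[of n] bits.simps[of 0] encode_nat_def enc_nat.simps[of n] enc_nat.simps[of 0])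
qed

text \<open>The state of the fold consists of the carry and the digits produced so far, most recent
  first. A carry that survives becomes a new leading digit.\<close>

definition increment :: "bool list \<Rightarrow> bool list" where
  "increment bs = (let p = fold (\<lambda>b p. (fst p \<and> b, (fst p \<noteq> b) # snd p)) bs (True, [])
     in rev (if fst p then True # snd p else snd p))"

lemma increment_bits: "increment (bits n) = bits (Suc n)"
proof -
  let ?f = "fold (\<lambda>b p. (fst p \<and> b, (fst p \<noteq> b) # snd p))"
  let ?g = "\<lambda>p. rev (if fst p then True # snd p else snd p)"
  \<comment> \<open>The induction needs an arbitrary incoming carry \<open>c\<close> and arbitrary
    earlier output \<open>r\<close>.\<close>
  have "?g (?f (bits n) (c, r)) = rev r @ bits (n + of_bool c)" for c r
  proof (induction n arbitrary: c r rule: less_induct)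
    case (less n)
    show ?case
    proof (cases "n = 0")
      case True
      then show ?thesis by (auto simp: bits.simps)
    next
      case False
      have "(n + of_bool c) div 2 = n div 2 + of_bool (c \<and> odd n)" "odd (n + of_bool c) \<longleftrightarrow> c \<noteq> odd n"
        by (cases c; auto; presburger)+
      then have e2: "bits (n + of_bool c) = (c \<noteq> odd n) # bits (n div 2 + of_bool (c \<and> odd n))"
        using False by (subst bits.simps) simp
      have e1: "bits n = odd n # bits (n div 2)"
        using False by (subst bits.simps) simp
      have "?g (?f (bits n) (c, r)) = ?g (?f (bits (n div 2)) (c \<and> odd n, (c \<noteq> odd n) # r))"
        by (simp only: e1 fold_simps fst_conv snd_conv)
      also have "\<dots> = rev ((c \<noteq> odd n) # r) @ bits (n div 2 + of_bool (c \<and> odd n))"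
        using False by (intro less) simp
      also have "\<dots> = rev r @ bits (n + of_bool c)"
        by (simp only: e2 rev.simps append_assoc append_Cons append_Nil)
      finally show ?thesis .
    qed
  qed
  from this[of True "[]"] show ?thesis
    by (simp only: increment_def Let_def rev.simps append_Nil of_bool_eq Suc_eq_plus1)
qed

lemma polytime_Suc:
  assumes "polytime f"
  shows "polytime (\<lambda>x. Suc (f x))"
proof -
  have fold: "polytime (\<lambda>bs. fold (\<lambda>b p. (fst p \<and> b, (fst p \<noteq> b) # snd p)) bs (True, []))"
    by (rule polytime_fold[where g = "\<lambda>_. 8"])
      (auto intro!: polytime_basic poly_bounded_intros simp: encode_prod_def encode_bool_def)
  have "polytime increment"
    unfolding increment_def Let_def
    by (intro polytime_basic polytime_rev polytime_compose[OF polytime_fst' fold] polytime_compose[OF polytime_snd' fold])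
  moreover have "polytime bits"
    by (rule polytime_recode[OF polytime_id]) (simp add: encode_bits)
  ultimately have "polytime (\<lambda>n. increment (bits n))"
    by (rule polytime_compose)
  then have "polytime Suc"
    by (rule polytime_recode) (simp add: increment_bits flip: encode_bits)
  from polytime_compose[OF this assms] show ?thesis .
qed

text \<open>The true size is logarithmic, but the numbers measured with this bound are lengths,
  positions and a capped target, for which a linear bound is enough.\<close>

lemma enc_size_nat: "enc_size n \<le> 4 * n + 1" for n :: nat
proof (induction n rule: less_induct)
  case (less n)
  show ?case
  proof (cases "n = 0")
    case False
    then have "n div 2 < n" by simp
    with less[OF this] False show ?thesis
      by (auto simp: encode_nat_def enc_nat.simps[of n])
  qed (simp add: encode_nat_def enc_nat.simps)
qed

lemma polytime_length:
  fixes l :: "'a::encodable \<Rightarrow> 'b::encodable list"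
  assumes l: "polytime l"
  shows "polytime (\<lambda>x. length (l x))"
proof -
  have len: "fold (\<lambda>_. Suc) ys n = n + length ys" for ys :: "'b list" and n
    by (induction ys arbitrary: n) auto
  from l obtain h where h: "poly_bounded h" and lh: "\<And>x. enc_size (l x) \<le> h (enc_size x)"
    by (rule polytime_enc_size) (rule that)
  have "polytime (\<lambda>x. fold (\<lambda>_. Suc) (l x) 0)"
  proof (rule polytime_fold_bounded[where g = "\<lambda>n. 4 * h n + 1"])
    fix x ys zs assume "l x = ys @ zs"
    then have "length ys \<le> h (enc_size x)"
      using length_le_enc_size[of "l x"] lh[of x] by simp
    then show "enc_size (fold (\<lambda>_. Suc) ys 0) \<le> 4 * h (enc_size x) + 1"
      using enc_size_nat[of "length ys"] by (simp add: len)
  qed (auto intro!: l polytime_basic polytime_Suc poly_bounded_intros h)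
  then show ?thesis by (simp add: len)
qed

lemmas polytime_intros = polytime_basic polytime_rev polytime_append polytime_map polytime_filter
  polytime_concat polytime_bex polytime_ball polytime_member polytime_dedup polytime_length_less
  polytime_Suc polytime_length

section \<open>Independent sets and treedepth\<close>

text \<open>No vertex set is fixed: the reduction keeps passing to subsets while the adjacency
  remains the same, so all notions take the vertex set as an argument.\<close>

locale graph =
  fixes adj :: "'v \<Rightarrow> 'v \<Rightarrow> bool"
  assumes adj_sym: "adj u v \<Longrightarrow> adj v u" and adj_irrefl: "\<not> adj u u"
begin

definition indep :: "'v set \<Rightarrow> bool" where
  "indep S \<longleftrightarrow> (\<forall>u\<in>S. \<forall>v\<in>S. \<not> adj u v)"

definition indep_num :: "'v set \<Rightarrow> nat" where
  "indep_num U = Max (card ` {S. S \<subseteq> U \<and> indep S})"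

definition apart :: "'v set \<Rightarrow> 'v set \<Rightarrow> bool" where
  "apart U W \<longleftrightarrow> (\<forall>u\<in>U. \<forall>w\<in>W. \<not> adj u w)"

definition nbhd :: "'v set \<Rightarrow> 'v set" where
  "nbhd S = {u. \<exists>s\<in>S. adj s u}"

lemma apart_commute: "apart U W \<longleftrightarrow> apart W U"
  unfolding apart_def using adj_sym by blast

lemma apart_mono: "apart U W \<Longrightarrow> U' \<subseteq> U \<Longrightarrow> W' \<subseteq> W \<Longrightarrow> apart U' W'"
  unfolding apart_def by blast

lemma indep_subset: "indep S \<Longrightarrow> T \<subseteq> S \<Longrightarrow> indep T"
  unfolding indep_def by blast

lemma indep_Un: "indep (S \<union> T) \<longleftrightarrow> indep S \<and> indep T \<and> apart S T"
  unfolding indep_def apart_def using adj_sym by blast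

lemma indep_empty [simp]: "indep {}"
  by (simp add: indep_def)

lemma card_le_indep_num: "finite U \<Longrightarrow> S \<subseteq> U \<Longrightarrow> indep S \<Longrightarrow> card S \<le> indep_num U"
  unfolding indep_num_def by (intro Max_ge finite_imageI) auto

lemma indep_numE:
  assumes "finite U"
  obtains S where "S \<subseteq> U" and "indep S" and "card S = indep_num U"
proof -
  have "indep_num U \<in> card ` {S. S \<subseteq> U \<and> indep S}"
    unfolding indep_num_def using assms by (intro Max_in finite_imageI) auto
  then show thesis using that by auto
qed

lemma indep_num_mono:
  assumes "finite U" and "W \<subseteq> U"
  shows "indep_num W \<le> indep_num U"
proof -
  have "finite W" using assms finite_subset by blast
  then obtain S where "S \<subseteq> W" "indep S" "card S = indep_num W"
    by (rule indep_numE)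
  with assms show ?thesis by (metis card_le_indep_num subset_trans)
qed

lemma indep_num_empty [simp]: "indep_num {} = 0"
proof -
  have "{S :: 'v set. S \<subseteq> {} \<and> indep S} = {{}}" by auto
  then show ?thesis by (simp add: indep_num_def)
qed

lemma indep_num_Un_le:
  assumes "finite U" and "finite W"
  shows "indep_num (U \<union> W) \<le> indep_num U + indep_num W"
proof -
  obtain S where S: "S \<subseteq> U \<union> W" "indep S" "card S = indep_num (U \<union> W)"
    using assms indep_numE[of "U \<union> W"] by blast
  then have "card S \<le> card (S \<inter> U) + card (S \<inter> W)"
    by (metis Int_Un_distrib Int_absorb2 card_Un_le)
  also have "\<dots> \<le> indep_num U + indep_num W"
    using assms S by (intro add_mono card_le_indep_num) (auto intro: indep_subset)
  finally show ?thesis using S by simp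
qed

lemma indep_num_Un:
  assumes fin: "finite U" "finite W" and "U \<inter> W = {}" and "apart U W"
  shows "indep_num (U \<union> W) = indep_num U + indep_num W"
proof (rule antisym[OF indep_num_Un_le[OF fin]])
  obtain S where S: "S \<subseteq> U" "indep S" "card S = indep_num U"
    using fin(1) by (rule indep_numE)
  obtain T where T: "T \<subseteq> W" "indep T" "card T = indep_num W"
    using fin(2) by (rule indep_numE)
  have "card (S \<union> T) \<le> indep_num (U \<union> W)"
    using S T assms apart_mono[of U W S T] by (intro card_le_indep_num) (auto simp: indep_Un)
  moreover have "card (S \<union> T) = card S + card T"
    using S T assms by (intro card_Un_disjoint) (auto intro: finite_subset)
  ultimately show "indep_num U + indep_num W \<le> indep_num (U \<union> W)"
    using S T by simp
qed

text \<open>The recursion for treedepth at most \<open>c\<close>: unions without edges in between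
  are free, and one further vertex costs at most one level. Rule induction then replaces reasoning
  about forests. The parts of a union need not be connected, which makes heredity
  (\<open>tdepth_subset\<close>) straightforward.\<close>

inductive tdepth :: "nat \<Rightarrow> 'v set \<Rightarrow> bool" where
  empty: "tdepth c {}"
| union: "tdepth c U \<Longrightarrow> tdepth c W \<Longrightarrow> U \<inter> W = {} \<Longrightarrow> apart U W \<Longrightarrow> tdepth c (U \<union> W)"
| root: "tdepth c U \<Longrightarrow> tdepth (Suc c) (insert r U)"

lemma tdepth_finite: "tdepth c U \<Longrightarrow> finite U"
  by (induction rule: tdepth.induct) auto

lemma tdepth_0: "tdepth c U \<Longrightarrow> c = 0 \<Longrightarrow> U = {}"
  by (induction rule: tdepth.induct) auto

lemma tdepth_Suc: "tdepth c U \<Longrightarrow> tdepth (Suc c) U"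
  by (induction rule: tdepth.induct) (auto intro: tdepth.intros)

lemma tdepth_subset: "tdepth c U \<Longrightarrow> W \<subseteq> U \<Longrightarrow> tdepth c W"
proof (induction arbitrary: W rule: tdepth.induct)
  case (union c U1 U2)
  have "tdepth c ((W \<inter> U1) \<union> (W \<inter> U2))"
    using union by (intro tdepth.union) (auto simp: apart_def)
  moreover have "(W \<inter> U1) \<union> (W \<inter> U2) = W" using union.prems by auto
  ultimately show ?case by simp
next
  case (root c U r)
  show ?case
  proof (cases "r \<in> W")
    case True
    have "tdepth (Suc c) (insert r (W - {r}))"
      by (intro tdepth.root root.IH) (use root.prems in auto)
    with True show ?thesis by (simp add: insert_absorb)
  next
    case False
    with root have "tdepth c W" by auto
    then show ?thesis by (rule tdepth_Suc)
  qed
qed (auto intro: tdepth.empty)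

text \<open>The empty set is connected in this sense, so nonemptiness is demanded separately in
  \<open>tdepth_conn\<close> and \<open>component_list\<close>.\<close>

definition conn :: "'v set \<Rightarrow> bool" where
  "conn U \<longleftrightarrow> (\<forall>A\<subseteq>U. A \<noteq> {} \<and> apart A (U - A) \<longrightarrow> A = U)"

text \<open>In a derivation for a connected set, a union step must have an empty part, so a root
  step is reached eventually. This guarantees that the search for a root of a component
  succeeds.\<close>

lemma tdepth_conn:
  "tdepth c U \<Longrightarrow> conn U \<Longrightarrow> U \<noteq> {} \<Longrightarrow> \<exists>c' r. c = Suc c' \<and> r \<in> U \<and> tdepth c' (U - {r})"
proof (induction rule: tdepth.induct)
  case (union c U W)
  show ?case
  proof (cases "U = {}")
    case False
    have "U \<union> W - U = W" using union.hyps by auto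
    with union.prems union.hyps False have "U = U \<union> W"
      unfolding conn_def by auto
    with union False show ?thesis by auto
  qed (use union in auto)
next
  case (root c U r)
  have "tdepth c (insert r U - {r})"
    by (rule tdepth_subset[OF root.hyps]) auto
  then show ?case by blast
qed auto

text \<open>
  Splitting off the root doubles the bound: one set blocks the independent sets avoiding the root,
  another one those containing it.
\<close>

lemma blocking_set:
  assumes "tdepth c U" and "W \<subseteq> U" and "indep_num (W - B) < indep_num W"
  shows "\<exists>B'\<subseteq>B. finite B' \<and> card B' \<le> 2 ^ c \<and> indep_num (W - B') < indep_num W"
  using assms
proof (induction arbitrary: W B rule: tdepth.induct)
  case (empty c)
  then show ?case by auto
next
  case (union c U1 U2)
  let ?W1 = "W \<inter> U1" and ?W2 = "W \<inter> U2"
  have fin: "finite U1" "finite U2" using union.hyps tdepth_finite by auto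
  have eq: "indep_num (W - C) = indep_num (?W1 - C) + indep_num (?W2 - C)" for C
  proof -
    have "W - C = (?W1 - C) \<union> (?W2 - C)" using union.prems by auto
    also have "indep_num \<dots> = indep_num (?W1 - C) + indep_num (?W2 - C)"
      using fin union.hyps by (intro indep_num_Un) (auto simp: apart_def)
    finally show ?thesis .
  qed
  have le: "indep_num (?W1 - C) \<le> indep_num ?W1" "indep_num (?W2 - C) \<le> indep_num ?W2" for C
    using fin by (auto intro!: indep_num_mono)
  consider "indep_num (?W1 - B) < indep_num ?W1" | "indep_num (?W2 - B) < indep_num ?W2"
    using union.prems(2) eq[of B] eq[of "{}"] by fastforce
  then show ?case
  proof cases
    case 1
    then obtain B' where "B' \<subseteq> B" "finite B'" "card B' \<le> 2 ^ c" "indep_num (?W1 - B') < indep_num ?W1"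
      using union.IH(1)[of ?W1 B] by auto
    then show ?thesis using eq[of B'] eq[of "{}"] le(2)[of B'] by (intro exI[of _ B']) auto
  next
    case 2
    then obtain B' where "B' \<subseteq> B" "finite B'" "card B' \<le> 2 ^ c" "indep_num (?W2 - B') < indep_num ?W2"
      using union.IH(2)[of ?W2 B] by auto
    then show ?thesis using eq[of B'] eq[of "{}"] le(1)[of B'] by (intro exI[of _ B']) auto
  qed
next
  case (root c U r)
  have fin: "finite U" using root.hyps tdepth_finite by auto
  then have finW: "finite W" using root.prems finite_subset by (metis finite_insert)
  let ?a = "indep_num W" and ?U = "W - {r}" and ?N = "W - {r} - nbhd {r}"
  have sub: "?U \<subseteq> U" "?N \<subseteq> U" using root.prems by auto
  \<comment> \<open>If leaving out \<open>r\<close> already lowers the number, nothing has to be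
    blocked; otherwise \<open>?U\<close> attains \<open>?a\<close> and the induction hypothesis
    applies to it.\<close>
  obtain B1 where B1: "B1 \<subseteq> B" "finite B1" "card B1 \<le> 2 ^ c" "indep_num (?U - B1) < ?a"
  proof (cases "indep_num ?U < ?a")
    case True
    then show ?thesis using that[of "{}"] by auto
  next
    case False
    then have "indep_num ?U = ?a"
      using indep_num_mono[OF finW, of ?U] by auto
    moreover have "indep_num (?U - B) \<le> indep_num (W - B)"
      using finW by (intro indep_num_mono) auto
    ultimately show ?thesis
      using root.IH[OF sub(1), of B] root.prems that by auto
  qed
  \<comment> \<open>If \<open>r\<close> itself lies in \<open>B\<close>, the singleton blocks every
    set containing \<open>r\<close>. Otherwise such a set leaves at most \<open>?a - 1\<close>
    vertices for \<open>?N\<close>, and the induction hypothesis is applied there.\<close>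
  obtain B2 where B2: "B2 \<subseteq> B" "finite B2" "card B2 \<le> 2 ^ c"
      "r \<in> W \<Longrightarrow> r \<notin> B2 \<Longrightarrow> Suc (indep_num (?N - B2)) < ?a"
  proof (cases "r \<in> W - B")
    case False
    show ?thesis
    proof (cases "r \<in> B")
      case True
      then show ?thesis using that[of "{r}"] by auto
    next
      case False
      then show ?thesis using that[of "{}"] \<open>r \<notin> W - B\<close> by auto
    qed
  next
    case True
    have ge: "Suc (indep_num (?N - C)) \<le> indep_num (W - C)" if "r \<notin> C" for C
    proof -
      have "finite (?N - C)" using finW by auto
      then obtain S where S: "S \<subseteq> ?N - C" "indep S" "card S = indep_num (?N - C)"
        by (rule indep_numE)
      have "card (insert r S) \<le> indep_num (W - C)"
      proof (rule card_le_indep_num)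
        have "apart {r} S" using S(1) unfolding apart_def nbhd_def by auto
        then show "indep (insert r S)"
          using indep_Un[of "{r}" S] S(2) adj_irrefl by (auto simp: indep_def)
      qed (use S True that finW in auto)
      moreover have "r \<notin> S" "finite S" using S(1) finite_subset[OF _ finW, of S] by auto
      ultimately show ?thesis using S(3) by simp
    qed
    show ?thesis
    proof (cases "Suc (indep_num ?N) < ?a")
      case True
      then show ?thesis using that[of "{}"] by auto
    next
      case False
      then have "Suc (indep_num ?N) = ?a" using ge[of "{}"] by auto
      moreover have "Suc (indep_num (?N - B)) < ?a"
        using ge[of B] True root.prems by auto
      ultimately obtain B' where "B' \<subseteq> B" "finite B'" "card B' \<le> 2 ^ c" "indep_num (?N - B') < indep_num ?N"
        using root.IH[OF sub(2), of B] by auto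
      then show ?thesis using that[of B'] \<open>Suc (indep_num ?N) = ?a\<close> by auto
    qed
  qed
  have "indep_num (W - (B1 \<union> B2)) < ?a"
  proof -
    obtain S where S: "S \<subseteq> W - (B1 \<union> B2)" "indep S" "card S = indep_num (W - (B1 \<union> B2))"
      using finW indep_numE[of "W - (B1 \<union> B2)"] by blast
    have "card S < ?a"
    proof (cases "r \<in> S")
      case False
      then have "card S \<le> indep_num (?U - B1)"
        using S finW by (intro card_le_indep_num) auto
      then show ?thesis using B1 by simp
    next
      case True
      then have "S - {r} \<subseteq> ?N - B2"
        using S(1,2) unfolding indep_def nbhd_def by auto
      then have "card (S - {r}) \<le> indep_num (?N - B2)"
        using S(2) finW by (intro card_le_indep_num) (auto intro: indep_subset)
      moreover have "card S = Suc (card (S - {r}))"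
        using True S(1) finW finite_subset by (metis Diff_subset card_Suc_Diff1)
      moreover have "r \<in> W" "r \<notin> B2" using True S(1) by auto
      ultimately show ?thesis using B2(4) by simp
    qed
    with S show ?thesis by simp
  qed
  moreover have "card (B1 \<union> B2) \<le> 2 ^ Suc c"
    using card_Un_le[of B1 B2] B1 B2 by simp
  ultimately show ?case
    using B1 B2 by (intro exI[of _ "B1 \<union> B2"]) auto
qed

end

section \<open>From forests to the recursive description of treedepth\<close>

text \<open>Parents are unique, so the ancestors of \<open>u\<close> form a chain.\<close>

lemma single_valued_rtrancl_linear:
  assumes "single_valued P" and "(u, v) \<in> P\<^sup>*" and "(u, w) \<in> P\<^sup>*"
  shows "(v, w) \<in> P\<^sup>* \<or> (w, v) \<in> P\<^sup>*"
  using assms(2,3)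
proof (induction rule: converse_rtrancl_induct)
  case (step a b)
  from step.prems show ?case
  proof (cases rule: converse_rtranclE)
    case base
    then show ?thesis using step by (meson converse_rtrancl_into_rtrancl)
  next
    case (step b')
    then have "b' = b" using \<open>(a, b) \<in> P\<close> assms(1) by (auto dest: single_valuedD)
    then show ?thesis using step \<open>(b, w) \<in> P\<^sup>* \<Longrightarrow> _\<close> by blast
  qed
qed auto

definition depth :: "('v \<times> 'v) set \<Rightarrow> 'v \<Rightarrow> nat" where
  "depth P v = card {u. (v, u) \<in> P\<^sup>*}"

lemma ancestors_subset:
  assumes "rooted_forest W P" and "v \<in> W"
  shows "{u. (v, u) \<in> P\<^sup>*} \<subseteq> W"
proof
  fix u assume "u \<in> {u. (v, u) \<in> P\<^sup>*}"
  then have "(v, u) \<in> P\<^sup>*" by simp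
  then show "u \<in> W" using assms by (induction) (auto simp: rooted_forest_def)
qed

lemma depth_less:
  assumes "rooted_forest W P" and "v \<in> W" and "(v, u) \<in> P\<^sup>+"
  shows "depth P u < depth P v"
  unfolding depth_def
proof (rule psubset_card_mono)
  show "finite {u. (v, u) \<in> P\<^sup>*}"
    using ancestors_subset[OF assms(1,2)] assms(1) by (auto simp: rooted_forest_def intro: finite_subset)
  have "(u, v) \<notin> P\<^sup>*"
    using assms by (auto simp: rooted_forest_def acyclic_def dest: trancl_rtrancl_trancl)
  then show "{w. (u, w) \<in> P\<^sup>*} \<subset> {w. (v, w) \<in> P\<^sup>*}"
    using assms(3) by (auto dest: trancl_into_rtrancl intro: rtrancl_trans)
qed

text \<open>\<open>U\<close> need not be closed under ancestors, so what is bounded is the window of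
  depths that it meets. A vertex \<open>r\<close> of least depth is split off together with its
  descendants in \<open>U\<close>, and the proper descendants fit into a window with one level less.
  An edge from a descendant of \<open>r\<close> to a vertex \<open>v\<close> of the rest would make
  \<open>v\<close> a proper ancestor of \<open>r\<close>, since ancestors form a chain, against the
  choice of \<open>r\<close>.\<close>

lemma (in graph) forest_tdepth:
  assumes F: "rooted_forest W P"
    and cmp: "\<And>u v. u \<in> U \<Longrightarrow> v \<in> U \<Longrightarrow> adj u v \<Longrightarrow> (u, v) \<in> P\<^sup>* \<or> (v, u) \<in> P\<^sup>*"
    and "U \<subseteq> W" and "\<And>v. v \<in> U \<Longrightarrow> j < depth P v \<and> depth P v \<le> j + c"
  shows "tdepth c U"
proof -
  have "finite U" using F assms(3) by (auto simp: rooted_forest_def intro: finite_subset)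
  then show ?thesis using assms(2-4)
  proof (induction "card U" arbitrary: U j c rule: less_induct)
    case less
    show ?case
    proof (cases "U = {}")
      case True
      then show ?thesis by (simp add: tdepth.empty)
    next
      case False
      obtain r where r: "r \<in> U" "\<And>v. v \<in> U \<Longrightarrow> depth P r \<le> depth P v"
        using arg_min_if_finite[OF \<open>finite U\<close> False, of "depth P"] by (metis not_less)
      obtain c' where c: "c = Suc c'"
        using less.prems(4)[OF r(1)] by (cases c) auto
      let ?A = "{v \<in> U. (v, r) \<in> P\<^sup>*}"
      have A: "tdepth c' (?A - {r})"
      proof (rule less.hyps[where j = "Suc j"])
        show "card (?A - {r}) < card U"
          using r(1) less.prems(1) by (intro psubset_card_mono) auto
        fix v assume v: "v \<in> ?A - {r}"
        then have "(v, r) \<in> P\<^sup>+" by (auto simp: rtrancl_eq_or_trancl)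
        then have "depth P r < depth P v"
          using depth_less[OF F] v less.prems(3) by auto
        then show "Suc j < depth P v \<and> depth P v \<le> Suc j + c'"
          using less.prems(4)[OF r(1)] less.prems(4)[of v] v c by auto
      qed (use less.prems in auto)
      have "tdepth c (insert r (?A - {r}))"
        unfolding c by (rule tdepth.root[OF A])
      moreover have "insert r (?A - {r}) = ?A" using r(1) by auto
      ultimately have "tdepth c ?A" by simp
      moreover have "tdepth c (U - ?A)"
        using r(1) less.prems by (intro less.hyps[where j = j] psubset_card_mono) auto
      moreover have "apart ?A (U - ?A)"
        unfolding apart_def
      proof (intro ballI notI)
        fix u v assume u: "u \<in> ?A" and v: "v \<in> U - ?A" and "adj u v"
        from less.prems(2)[of u v] u v \<open>adj u v\<close> have "(u, v) \<in> P\<^sup>* \<or> (v, u) \<in> P\<^sup>*" by auto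
        then show False
        proof
          assume "(v, u) \<in> P\<^sup>*"
          then show False using u v by (auto intro: rtrancl_trans)
        next
          assume "(u, v) \<in> P\<^sup>*"
          then have "(v, r) \<in> P\<^sup>* \<or> (r, v) \<in> P\<^sup>*"
            using single_valued_rtrancl_linear[of P u v r] F u by (auto simp: rooted_forest_def)
          then have "(r, v) \<in> P\<^sup>+" using v by (auto simp: rtrancl_eq_or_trancl)
          then have "depth P v < depth P r"
            using depth_less[OF F] r(1) less.prems(3) by auto
          then show False using r(2)[of v] v by auto
        qed
      qed
      ultimately have "tdepth c (?A \<union> (U - ?A))"
        by (intro tdepth.union) auto
      moreover have "?A \<union> (U - ?A) = U" by auto
      ultimately show ?thesis by simp
    qed
  qed
qed

section \<open>The reduction\<close>

text \<open>Components are maintained under insertion of a single vertex, so that a fold computes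
  them without any graph search.\<close>

definition add_vertex :: "('v \<Rightarrow> 'v \<Rightarrow> bool) \<Rightarrow> 'v \<Rightarrow> 'v list list \<Rightarrow> 'v list list" where
  "add_vertex adj v cs = (v # concat (filter (\<lambda>C. \<exists>w\<in>set C. adj v w) cs))
     # filter (\<lambda>C. \<not> (\<exists>w\<in>set C. adj v w)) cs"

definition components :: "('v \<Rightarrow> 'v \<Rightarrow> bool) \<Rightarrow> 'v list \<Rightarrow> 'v list list" where
  "components adj U = fold (add_vertex adj) U []"

primrec tdepth_test :: "nat \<Rightarrow> ('v \<Rightarrow> 'v \<Rightarrow> bool) \<Rightarrow> 'v list \<Rightarrow> bool" where
  "tdepth_test 0 adj U \<longleftrightarrow> U = []"
| "tdepth_test (Suc c) adj U \<longleftrightarrow>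
     (\<forall>C\<in>set (components adj U). \<exists>r\<in>set C. tdepth_test c adj (filter (\<lambda>u. u \<noteq> r) C))"

definition longest :: "'v list list \<Rightarrow> 'v list" where
  "longest ls = fold (\<lambda>l b. if length b < length l then l else b) ls []"

text \<open>Branching on the root of a component leaves a set of smaller treedepth. As the root is
  unknown, all vertices compete.\<close>

primrec max_indep :: "nat \<Rightarrow> ('v \<Rightarrow> 'v \<Rightarrow> bool) \<Rightarrow> 'v list \<Rightarrow> 'v list" where
  "max_indep 0 adj U = []"
| "max_indep (Suc c) adj U = concat (map (\<lambda>C. longest (concat (map (\<lambda>r.
       [max_indep c adj (filter (\<lambda>u. u \<noteq> r) C),
        r # max_indep c adj (filter (\<lambda>u. u \<noteq> r \<and> \<not> adj r u) C)]) C))) (components adj U))"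

definition conflict :: "nat \<Rightarrow> ('v \<Rightarrow> 'v \<Rightarrow> bool) \<Rightarrow> 'v list \<Rightarrow> 'v list \<Rightarrow> bool" where
  "conflict c adj Y C \<longleftrightarrow>
     length (max_indep c adj (filter (\<lambda>u. \<not> (\<exists>y\<in>set Y. adj y u)) C)) < length (max_indep c adj C)"

text \<open>Words of length at most \<open>m\<close>, with repeated letters, and many words are
  listed several times. This is harmless, since only their sets matter, and the total number is
  exactly \<open>Suc (length xs) ^ m\<close>.\<close>

primrec chunks :: "nat \<Rightarrow> 'v list \<Rightarrow> 'v list list" where
  "chunks 0 xs = [[]]"
| "chunks (Suc m) xs = chunks m xs @ concat (map (\<lambda>x. map (\<lambda>ys. x # ys) (chunks m xs)) xs)"

text \<open>Without an admissible root, the value is the default \<open>z\<close>.\<close>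

definition root_of :: "nat \<Rightarrow> ('v \<Rightarrow> 'v \<Rightarrow> bool) \<Rightarrow> 'v \<Rightarrow> 'v list \<Rightarrow> 'v" where
  "root_of c adj z C =
     fold (\<lambda>r b. if tdepth_test c adj (filter (\<lambda>u. u \<noteq> r) C) then r else b) C z"

definition heavy :: "nat \<Rightarrow> ('v \<Rightarrow> 'v \<Rightarrow> bool) \<Rightarrow> 'v list \<Rightarrow> 'v list list \<Rightarrow> 'v list \<Rightarrow> bool" where
  "heavy c adj xs cs Y \<longleftrightarrow> length xs < length (filter (conflict c adj Y) cs)"

definition marked :: "nat \<Rightarrow> ('v \<Rightarrow> 'v \<Rightarrow> bool) \<Rightarrow> 'v list \<Rightarrow> 'v list list \<Rightarrow> 'v list list" where
  "marked c adj xs cs = filter (\<lambda>C. \<exists>Y\<in>set (filter (\<lambda>Y. \<not> heavy c adj xs cs Y) (chunks (2 ^ c) xs)).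
     conflict c adj Y C) cs"

text \<open>Here \<open>c\<close> is the treedepth bound after the round: components have depth
  \<open>Suc c\<close> before it, while a root has to leave depth \<open>c\<close> behind.\<close>

definition reduce_modulator :: "nat \<Rightarrow> ('v \<Rightarrow> 'v \<Rightarrow> bool) \<Rightarrow> 'v \<Rightarrow> 'v list \<Rightarrow> 'v list \<Rightarrow> 'v list" where
  "reduce_modulator c adj z xs rs =
     map (root_of c adj z) (marked (Suc c) adj xs (components adj rs)) @ xs"

definition reduce_remainder :: "nat \<Rightarrow> ('v \<Rightarrow> 'v \<Rightarrow> bool) \<Rightarrow> 'v \<Rightarrow> 'v list \<Rightarrow> 'v list \<Rightarrow> 'v list" where
  "reduce_remainder c adj z xs rs = concat (map (\<lambda>C. filter (\<lambda>u. u \<noteq> root_of c adj z C) C)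
     (marked (Suc c) adj xs (components adj rs)))"

definition reduce_hyperedges :: "nat \<Rightarrow> ('v \<Rightarrow> 'v \<Rightarrow> bool) \<Rightarrow> 'v list \<Rightarrow> 'v list \<Rightarrow> 'v list list" where
  "reduce_hyperedges c adj xs rs =
     filter (heavy (Suc c) adj xs (components adj rs)) (chunks (2 ^ Suc c) xs)"

primrec reduce :: "nat \<Rightarrow> ('v \<Rightarrow> 'v \<Rightarrow> bool) \<Rightarrow> 'v \<Rightarrow> 'v list \<times> 'v list \<times> 'v list list
    \<Rightarrow> 'v list \<times> 'v list \<times> 'v list list" where
  "reduce 0 adj z p = p"
| "reduce (Suc c) adj z p = reduce c adj z
     (reduce_modulator c adj z (fst p) (fst (snd p)),
      reduce_remainder c adj z (fst p) (fst (snd p)),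
      reduce_hyperedges c adj (fst p) (fst (snd p)) @ snd (snd p))"

section \<open>Correctness of the components, the treedepth test and the independence number\<close>

lemma concat_filter_disj:
  "distinct (concat cs) \<Longrightarrow> set (concat (filter P cs)) \<inter> set (concat (filter (\<lambda>C. \<not> P C) cs)) = {}"
  by (induction cs) auto

lemma distinct_concat_filter: "distinct (concat cs) \<Longrightarrow> distinct (concat (filter P cs))"
  by (induction cs) auto

lemma set_concat_filter_Un:
  "set (concat (filter P cs)) \<union> set (concat (filter (\<lambda>C. \<not> P C) cs)) = set (concat cs)"
  by (induction cs) auto

lemma longest_in: "longest ls = [] \<or> longest ls \<in> set ls"
proof -
  have "fold (\<lambda>l b. if length b < length l then l else b) ls b \<in> insert b (set ls)" for b
    by (induction ls arbitrary: b) auto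
  from this[of "[]"] show ?thesis by (simp add: longest_def)
qed

lemma longest_ge:
  assumes "l \<in> set ls"
  shows "length l \<le> length (longest ls)"
proof -
  let ?f = "fold (\<lambda>l b. if length b < length l then l else b)"
  have "length b \<le> length (?f ls b) \<and> (\<forall>l\<in>set ls. length l \<le> length (?f ls b))" for b
  proof (induction ls arbitrary: b)
    case (Cons l ls)
    show ?case using Cons[of b] Cons[of l] by auto
  qed simp
  with assms show ?thesis by (simp add: longest_def)
qed

context graph
begin

lemma indep_singleton: "indep {r}"
  by (simp add: indep_def adj_irrefl)

definition component_list :: "'v list list \<Rightarrow> 'v set \<Rightarrow> bool" where
  "component_list cs U \<longleftrightarrow> distinct (concat cs) \<and> set (concat cs) = U \<and> [] \<notin> set cs \<and>
     (\<forall>C\<in>set cs. conn (set C) \<and> apart (set C) (U - set C))"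

text \<open>Let \<open>A\<close> be a part without edges to its complement. If it contains
  \<open>v\<close>, each member of the family has a point in \<open>A\<close> (a neighbour of
  \<open>v\<close>) and, being connected, lies in \<open>A\<close>. If it avoids \<open>v\<close>,
  the same argument applies to its complement.\<close>

lemma conn_union_vertex:
  assumes conn: "\<And>C. C \<in> \<C> \<Longrightarrow> conn C" and adj: "\<And>C. C \<in> \<C> \<Longrightarrow> \<exists>w\<in>C. adj v w"
  shows "conn (insert v (\<Union>\<C>))"
proof -
  let ?U = "insert v (\<Union>\<C>)"
  have key: "A = ?U" if A: "A \<subseteq> ?U" "v \<in> A" "apart A (?U - A)" for A
  proof (rule ccontr)
    assume "A \<noteq> ?U"
    then obtain u C where u: "u \<in> C" "C \<in> \<C>" "u \<notin> A" using A by auto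
    have "C - A \<noteq> {}" "apart (C - A) (C - (C - A))"
      using u A apart_commute[of A "?U - A"] apart_mono[of "?U - A" A "C - A" "C - (C - A)"] by auto
    then have "C - A = C" using conn[OF u(2)] unfolding conn_def by blast
    moreover obtain w where "w \<in> C" "adj v w" using adj[OF u(2)] by auto
    ultimately show False using A u unfolding apart_def by blast
  qed
  show ?thesis
    unfolding conn_def
  proof (intro allI impI)
    fix A assume A: "A \<subseteq> ?U" "A \<noteq> {} \<and> apart A (?U - A)"
    show "A = ?U"
    proof (cases "v \<in> A")
      case False
      have dd: "?U - (?U - A) = A" using A(1) by blast
      then have "apart (?U - A) (?U - (?U - A))" using A(2) apart_commute by simp
      then have "?U - A = ?U" using False by (intro key) auto
      with dd have "A = {}" by (metis Diff_cancel)
      with A(2) show ?thesis by simp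
    next
      case True
      then show ?thesis using A by (intro key) simp_all
    qed
  qed
qed

lemma component_list_add_vertex:
  assumes cs: "component_list cs U" and v: "v \<notin> U"
  shows "component_list (add_vertex adj v cs) (insert v U)"
proof -
  let ?P = "\<lambda>C. \<exists>w\<in>set C. adj v w"
  let ?near = "filter ?P cs" and ?far = "filter (\<lambda>C. \<not> ?P C) cs"
  let ?N = "v # concat ?near"
  have U: "set (concat cs) = U" "distinct (concat cs)" using cs by (auto simp: component_list_def)
  have disj: "set (concat ?near) \<inter> set (concat ?far) = {}"
    by (rule concat_filter_disj[OF U(2)])
  have un: "set (concat ?near) \<union> set (concat ?far) = U"
    using set_concat_filter_Un[of ?P cs] U(1) by simp
  have dis: "distinct (concat ?near)" "distinct (concat ?far)"
    using U(2) by (simp_all add: distinct_concat_filter)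
  have far: "conn (set C) \<and> apart (set C) (insert v U - set C)" if "C \<in> set ?far" for C
  proof -
    have C: "C \<in> set cs" "\<forall>w\<in>set C. \<not> adj v w" using that by auto
    then have "conn (set C)" "apart (set C) (U - set C)" using cs by (auto simp: component_list_def)
    moreover have "apart (set C) {v}" using C(2) adj_sym unfolding apart_def by blast
    ultimately show ?thesis unfolding apart_def by blast
  qed
  have "conn (insert v (\<Union>(set ` set ?near)))"
    using cs by (intro conn_union_vertex) (auto simp: component_list_def)
  then have conn: "conn (set ?N)" by simp
  have N: "apart (set ?N) (insert v U - set ?N)"
    unfolding apart_def
  proof (intro ballI notI)
    fix u w assume u: "u \<in> set ?N" and w: "w \<in> insert v U - set ?N" and "adj u w"
    from w un obtain C where C: "C \<in> set ?far" "w \<in> set C" by auto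
    have "u \<in> insert v U - set C" using u C un v disj by auto
    with far[OF C(1)] C(2) \<open>adj u w\<close> show False
      using adj_sym unfolding apart_def by blast
  qed
  have "[] \<notin> set (?N # ?far)" using cs by (auto simp: component_list_def)
  moreover have "distinct (concat (?N # ?far))"
    using dis disj un v by auto
  moreover have "set (concat (?N # ?far)) = insert v U"
    using un by auto
  ultimately show ?thesis
    using far conn N unfolding component_list_def add_vertex_def by simp
qed

lemma component_list_components:
  assumes "distinct U"
  shows "component_list (components adj U) (set U)"
proof -
  have "component_list (fold (add_vertex adj) us cs) (set us \<union> W)"
    if "component_list cs W" "distinct us" "set us \<inter> W = {}" for us cs W
    using that
  proof (induction us arbitrary: cs W)
    case (Cons u us)
    have "component_list (fold (add_vertex adj) us (add_vertex adj u cs)) (set us \<union> insert u W)"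
      using Cons.prems by (intro Cons.IH component_list_add_vertex) auto
    then show ?case by simp
  qed simp
  from this[of "[]" "{}" U] assms show ?thesis
    by (simp add: components_def component_list_def)
qed

text \<open>What remains of \<open>component_list\<close> when some of the components are discarded.
  It suffices for adding up independence numbers.\<close>

definition separated :: "'v list list \<Rightarrow> bool" where
  "separated cs \<longleftrightarrow> distinct (concat cs) \<and> (\<forall>C\<in>set cs. apart (set C) (set (concat cs) - set C))"

lemma component_list_separated: "component_list cs U \<Longrightarrow> separated cs"
  by (auto simp: component_list_def separated_def)

lemma separated_Cons:
  assumes "separated (C # cs)"
  shows "separated cs" and "set C \<inter> set (concat cs) = {}" and "apart (set C) (set (concat cs))"
    and "distinct C"
  using assms unfolding separated_def apart_def by auto

lemma separated_filter:
  assumes "separated cs"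
  shows "separated (filter P cs)"
  using assms unfolding separated_def apart_def by (auto simp: distinct_concat_filter)

lemma indep_num_concat:
  assumes "separated cs"
  shows "indep_num (set (concat cs) - B) = (\<Sum>C\<leftarrow>cs. indep_num (set C - B))"
  using assms
proof (induction cs)
  case (Cons C cs)
  note sep = separated_Cons[OF Cons.prems]
  have "set (concat (C # cs)) - B = (set C - B) \<union> (set (concat cs) - B)" by auto
  also have "indep_num \<dots> = indep_num (set C - B) + indep_num (set (concat cs) - B)"
    using sep(2) apart_mono[OF sep(3)] by (intro indep_num_Un) auto
  finally show ?case using Cons.IH[OF sep(1)] by simp
qed simp

lemma tdepth_concat:
  assumes "separated cs" and "\<And>C. C \<in> set cs \<Longrightarrow> f C \<subseteq> set C" and "\<And>C. C \<in> set cs \<Longrightarrow> tdepth c (f C)"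
  shows "tdepth c (\<Union>C\<in>set cs. f C)"
  using assms
proof (induction cs)
  case Nil
  then show ?case by (simp add: tdepth.empty)
next
  case (Cons C cs)
  note sep = separated_Cons[OF Cons.prems(1)]
  have sub: "f C \<subseteq> set C" "(\<Union>C\<in>set cs. f C) \<subseteq> set (concat cs)"
    using Cons.prems(2) by fastforce+
  have "tdepth c (f C \<union> (\<Union>C\<in>set cs. f C))"
  proof (rule tdepth.union)
    show "tdepth c (f C)" "tdepth c (\<Union>C\<in>set cs. f C)"
      using Cons.prems Cons.IH[OF sep(1)] by auto
    show "f C \<inter> (\<Union>C\<in>set cs. f C) = {}" using sub sep(2) by blast
    show "apart (f C) (\<Union>C\<in>set cs. f C)" by (rule apart_mono[OF sep(3) sub])
  qed
  then show ?case by simp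
qed

lemma tdepth_test_iff: "distinct U \<Longrightarrow> tdepth_test c adj U \<longleftrightarrow> tdepth c (set U)"
proof (induction c arbitrary: U)
  case 0
  then show ?case using tdepth_0[of 0] by (auto intro: tdepth.empty)
next
  case (Suc c)
  note cs = component_list_components[OF Suc.prems]
  note sep = component_list_separated[OF cs]
  have D: "distinct C" if "C \<in> set (components adj U)" for C
    using that sep by (auto simp: separated_def distinct_concat_iff)
  have IH: "tdepth_test c adj (filter (\<lambda>u. u \<noteq> r) C) \<longleftrightarrow> tdepth c (set C - {r})"
    if "C \<in> set (components adj U)" for C r
    using Suc.IH[of "filter (\<lambda>u. u \<noteq> r) C"] D[OF that] by (simp add: set_diff_eq)
  show ?case
  proof
    assume t: "tdepth_test (Suc c) adj U"
    have "tdepth (Suc c) (\<Union>C\<in>set (components adj U). set C)"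
    proof (rule tdepth_concat[OF sep])
      fix C assume C: "C \<in> set (components adj U)"
      then obtain r where "r \<in> set C" "tdepth c (set C - {r})"
        using t IH by auto
      then show "tdepth (Suc c) (set C)"
        using tdepth.root[of c "set C - {r}" r] by (simp add: insert_absorb)
    qed simp
    then show "tdepth (Suc c) (set U)" using cs by (simp add: component_list_def)
  next
    assume t: "tdepth (Suc c) (set U)"
    have "\<exists>r\<in>set C. tdepth c (set C - {r})" if C: "C \<in> set (components adj U)" for C
    proof -
      have "set C \<subseteq> set U" "conn (set C)" "set C \<noteq> {}"
        using cs C by (auto simp: component_list_def)
      with tdepth_conn[OF tdepth_subset[OF t]] show ?thesis by auto
    qed
    then show "tdepth_test (Suc c) adj U" using IH by simp
  qed
qed

text \<open>No bound on the treedepth is assumed: branching on an unsuitable vertex still yields an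
  independent set, possibly one that is too small.\<close>

lemma max_indep_sound:
  "distinct U \<Longrightarrow> distinct (max_indep c adj U) \<and> set (max_indep c adj U) \<subseteq> set U \<and> indep (set (max_indep c adj U))"
proof (induction c arbitrary: U)
  case (Suc c)
  note cs = component_list_components[OF Suc.prems]
  note sep = component_list_separated[OF cs]
  let ?best = "\<lambda>C. longest (concat (map (\<lambda>r. [max_indep c adj (filter (\<lambda>u. u \<noteq> r) C),
        r # max_indep c adj (filter (\<lambda>u. u \<noteq> r \<and> \<not> adj r u) C)]) C))"
  have best: "distinct (?best C) \<and> set (?best C) \<subseteq> set C \<and> indep (set (?best C))" if C: "distinct C" for C
  proof -
    let ?ls = "concat (map (\<lambda>r. [max_indep c adj (filter (\<lambda>u. u \<noteq> r) C),
        r # max_indep c adj (filter (\<lambda>u. u \<noteq> r \<and> \<not> adj r u) C)]) C)"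
    have "distinct l \<and> set l \<subseteq> set C \<and> indep (set l)" if "l \<in> set ?ls" for l
    proof -
      from that obtain r where r: "r \<in> set C" and l: "l = max_indep c adj (filter (\<lambda>u. u \<noteq> r) C) \<or>
          l = r # max_indep c adj (filter (\<lambda>u. u \<noteq> r \<and> \<not> adj r u) C)" by auto
      from l show ?thesis
      proof
        assume "l = max_indep c adj (filter (\<lambda>u. u \<noteq> r) C)"
        with Suc.IH[of "filter (\<lambda>u. u \<noteq> r) C"] C show ?thesis by auto
      next
        assume l: "l = r # max_indep c adj (filter (\<lambda>u. u \<noteq> r \<and> \<not> adj r u) C)"
        let ?m = "max_indep c adj (filter (\<lambda>u. u \<noteq> r \<and> \<not> adj r u) C)"
        have m: "distinct ?m" "set ?m \<subseteq> set (filter (\<lambda>u. u \<noteq> r \<and> \<not> adj r u) C)" "indep (set ?m)"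
          using Suc.IH[of "filter (\<lambda>u. u \<noteq> r \<and> \<not> adj r u) C"] C by auto
        have "apart {r} (set ?m)" using m(2) by (auto simp: apart_def)
        with m(3) have "indep ({r} \<union> set ?m)"
          unfolding indep_Un by (simp add: indep_singleton)
        then show ?thesis using m r unfolding l by auto
      qed
    qed
    with longest_in[of ?ls] show ?thesis by (auto simp del: set_concat)
  qed
  have "distinct (concat (map ?best L)) \<and> set (concat (map ?best L)) \<subseteq> set (concat L) \<and>
      indep (set (concat (map ?best L)))" if "separated L" for L
    using that
  proof (induction L)
    case (Cons C L)
    note sep = separated_Cons[OF Cons.prems]
    note b = best[OF sep(4)] and IH = Cons.IH[OF sep(1)]
    have "apart (set (?best C)) (set (concat (map ?best L)))"
      using b IH by (intro apart_mono[OF sep(3)]) auto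
    moreover have "set (?best C) \<inter> set (concat (map ?best L)) = {}"
      using b IH sep(2) by blast
    moreover have "set (concat (map ?best L)) \<subseteq> set (concat L)" "set (?best C) \<subseteq> set C"
      using b IH by blast+
    ultimately show ?case
      using b IH by (simp only: list.map concat.simps set_append distinct_append indep_Un) auto
  qed simp
  from this[OF sep] cs show ?case by (simp add: component_list_def)
qed simp

text \<open>For the lower bound, one of the vertices tried is a genuine root \<open>r\<close>, and a
  largest independent set either avoids \<open>r\<close> or contains it and avoids its neighbours.
  These are the two branches.\<close>

lemma length_max_indep:
  "distinct U \<Longrightarrow> tdepth c (set U) \<Longrightarrow> length (max_indep c adj U) = indep_num (set U)"
proof (rule antisym)
  assume "distinct U"
  from max_indep_sound[OF this, of c] show "length (max_indep c adj U) \<le> indep_num (set U)"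
    by (metis List.finite_set card_le_indep_num distinct_card)
next
  show "distinct U \<Longrightarrow> tdepth c (set U) \<Longrightarrow> indep_num (set U) \<le> length (max_indep c adj U)"
  proof (induction c arbitrary: U)
    case 0
    then show ?case using tdepth_0[of 0 "set U"] by simp
  next
    case (Suc c)
    note cs = component_list_components[OF Suc.prems(1)]
    note sep = component_list_separated[OF cs]
    let ?ls = "\<lambda>C. concat (map (\<lambda>r. [max_indep c adj (filter (\<lambda>u. u \<noteq> r) C),
          r # max_indep c adj (filter (\<lambda>u. u \<noteq> r \<and> \<not> adj r u) C)]) C)"
    have best: "indep_num (set C) \<le> length (longest (?ls C))" if C: "C \<in> set (components adj U)" for C
    proof -
      have D: "distinct C" using C sep by (auto simp: separated_def distinct_concat_iff)
      have "set C \<subseteq> set U" "conn (set C)" "set C \<noteq> {}"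
        using cs C by (auto simp: component_list_def)
      with tdepth_conn[OF tdepth_subset[OF Suc.prems(2)]]
      obtain r where r: "r \<in> set C" "tdepth c (set C - {r})" by auto
      obtain S where S: "S \<subseteq> set C" "indep S" "card S = indep_num (set C)"
        using indep_numE[of "set C"] by auto
      show ?thesis
      proof (cases "r \<in> S")
        case False
        let ?m = "max_indep c adj (filter (\<lambda>u. u \<noteq> r) C)"
        have "set (filter (\<lambda>u. u \<noteq> r) C) = set C - {r}" by auto
        then have "indep_num (set C - {r}) \<le> length ?m"
          using Suc.IH[of "filter (\<lambda>u. u \<noteq> r) C"] D r by simp
        moreover have "card S \<le> indep_num (set C - {r})"
          using S False by (intro card_le_indep_num) auto
        moreover have "?m \<in> set (?ls C)" using r(1) by auto
        ultimately show ?thesis using longest_ge[of ?m "?ls C"] S(3) by linarith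
      next
        case True
        let ?D = "set (filter (\<lambda>u. u \<noteq> r \<and> \<not> adj r u) C)"
        let ?m = "r # max_indep c adj (filter (\<lambda>u. u \<noteq> r \<and> \<not> adj r u) C)"
        have "tdepth c ?D" by (rule tdepth_subset[OF r(2)]) auto
        then have "Suc (indep_num ?D) \<le> length ?m"
          using Suc.IH[of "filter (\<lambda>u. u \<noteq> r \<and> \<not> adj r u) C"] D by simp
        moreover have "card (S - {r}) \<le> indep_num ?D"
          using S True by (intro card_le_indep_num) (auto simp: indep_def)
        moreover have "finite S" using S(1) finite_subset by blast
        then have "card S = Suc (card (S - {r}))"
          using True by (metis card_Suc_Diff1)
        moreover have "?m \<in> set (?ls C)" using r(1) by auto
        ultimately show ?thesis using longest_ge[of ?m "?ls C"] S(3) by linarith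
      qed
    qed
    have "indep_num (set U) = (\<Sum>C\<leftarrow>components adj U. indep_num (set C))"
      using indep_num_concat[OF sep, of "{}"] cs by (simp add: component_list_def)
    also have "\<dots> \<le> (\<Sum>C\<leftarrow>components adj U. length (longest (?ls C)))"
      using best by (rule sum_list_mono)
    finally show ?case by (simp add: length_concat comp_def)
  qed
qed

end

section \<open>Chunks, roots and the growth in one round\<close>

lemma chunks_subset: "ys \<in> set (chunks m xs) \<Longrightarrow> set ys \<subseteq> set xs"
  by (induction m arbitrary: ys) (simp, fastforce)

lemma Nil_in_chunks: "[] \<in> set (chunks m xs)"
  by (induction m) auto

lemma chunks_complete:
  assumes "Y \<subseteq> set xs" and "card Y \<le> m"
  obtains ys where "ys \<in> set (chunks m xs)" and "set ys = Y"
proof -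
  have "\<exists>ys\<in>set (chunks m xs). set ys = Y"
    using assms
  proof (induction m arbitrary: Y)
    case 0
    then have "finite Y" by (meson List.finite_set finite_subset)
    with 0 have "Y = {}" by simp
    then show ?case by simp
  next
    case (Suc m)
    show ?case
    proof (cases "Y = {}")
      case True
      then show ?thesis using Nil_in_chunks[of "Suc m" xs] by (metis list.set(1))
    next
      case False
      then obtain y where y: "y \<in> Y" by auto
      have "finite Y" using Suc.prems(1) by (meson List.finite_set finite_subset)
      then have "card (Y - {y}) \<le> m" using y Suc.prems(2) by simp
      then obtain ys where "ys \<in> set (chunks m xs)" "set ys = Y - {y}"
        using Suc.IH[of "Y - {y}"] Suc.prems(1) by blast
      then have "y # ys \<in> set (chunks (Suc m) xs)" "set (y # ys) = Y"
        using y Suc.prems(1) by auto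
      then show ?thesis by blast
    qed
  qed
  then show thesis using that by blast
qed

lemma length_chunks: "length (chunks m xs) = Suc (length xs) ^ m"
proof (induction m)
  case (Suc m)
  have "(\<Sum>x\<leftarrow>xs. length (map (\<lambda>ys. x # ys) (chunks m xs))) = length xs * length (chunks m xs)"
    by (simp add: sum_list_triv)
  with Suc show ?case by (simp add: length_concat comp_def)
qed simp

lemma root_of_correct:
  assumes "r \<in> set C" and "tdepth_test c adj (filter (\<lambda>u. u \<noteq> r) C)"
  shows "root_of c adj z C \<in> set C"
    and "tdepth_test c adj (filter (\<lambda>u. u \<noteq> root_of c adj z C) C)"
proof -
  let ?Q = "\<lambda>r. tdepth_test c adj (filter (\<lambda>u. u \<noteq> r) C)"
  let ?f = "fold (\<lambda>r b. if ?Q r then r else b)"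
  have "(b \<in> set C \<and> ?Q b \<or> (\<exists>r\<in>set L. ?Q r)) \<Longrightarrow> set L \<subseteq> set C \<Longrightarrow> ?f L b \<in> set C \<and> ?Q (?f L b)" for L b
    by (induction L arbitrary: b) auto
  from this[of z C] assms show "root_of c adj z C \<in> set C"
    and "tdepth_test c adj (filter (\<lambda>u. u \<noteq> root_of c adj z C) C)"
    unfolding root_of_def by blast+
qed

lemma length_filter_bex_le:
  "length (filter (\<lambda>C. \<exists>y\<in>set L. P y C) cs) \<le> (\<Sum>y\<leftarrow>L. length (filter (P y) cs))"
proof (induction L)
  case (Cons y L)
  have "length (filter (\<lambda>C. P y C \<or> Q C) cs) \<le> length (filter (P y) cs) + length (filter Q cs)" for Q
    by (induction cs) auto
  from this[of "\<lambda>C. \<exists>y\<in>set L. P y C"] Cons show ?case by simp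
qed simp

lemma length_marked: "length (marked c adj xs cs) \<le> Suc (length xs) ^ (2 ^ c) * length xs"
proof -
  let ?small = "filter (\<lambda>Y. \<not> heavy c adj xs cs Y) (chunks (2 ^ c) xs)"
  have "length (marked c adj xs cs) \<le> (\<Sum>Y\<leftarrow>?small. length (filter (conflict c adj Y) cs))"
    unfolding marked_def by (rule length_filter_bex_le)
  also have "\<dots> \<le> (\<Sum>Y\<leftarrow>?small. length xs)"
    by (rule sum_list_mono) (auto simp: heavy_def)
  also have "\<dots> \<le> Suc (length xs) ^ (2 ^ c) * length xs"
    using length_filter_le[of "\<lambda>Y. \<not> heavy c adj xs cs Y" "chunks (2 ^ c) xs"]
    by (simp add: sum_list_triv length_chunks)
  finally show ?thesis .
qed

text \<open>Stated for the length plus one, so that over several rounds the exponents simply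
  multiply.\<close>

lemma length_reduce_modulator:
  "Suc (length (reduce_modulator c adj z xs rs)) \<le> Suc (length xs) ^ (2 ^ Suc c + 1)"
proof -
  let ?n = "length xs" and ?m = "2 ^ Suc c :: nat"
  have "Suc ?n ^ 1 \<le> Suc ?n ^ ?m" by (intro power_increasing) auto
  \<comment> \<open>The right-hand side is \<open>Suc ?n ^ ?m * ?n + Suc ?n ^ ?m\<close>, and the
    last summand pays for \<open>Suc ?n\<close>.\<close>
  then have "Suc (?n + Suc ?n ^ ?m * ?n) \<le> Suc ?n ^ (?m + 1)" by simp
  then show ?thesis
    using length_marked[of "Suc c" adj xs "components adj rs"] by (simp add: reduce_modulator_def mult.commute[of "length xs"])
qed

lemma length_reduce_hyperedges: "length (reduce_hyperedges c adj xs rs) \<le> Suc (length xs) ^ 2 ^ Suc c"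
  unfolding reduce_hyperedges_def using length_filter_le[of _ "chunks (2 ^ Suc c) xs"]
  by (simp add: length_chunks del: power_Suc chunks.simps)

text \<open>Between integers, a strict inequality leaves a gap of at least one; the gaps are
  counted.\<close>

lemma sum_list_plus_filter_le:
  fixes f g :: "'a \<Rightarrow> nat"
  assumes "\<And>x. x \<in> set xs \<Longrightarrow> f x \<le> g x" and "\<And>x. x \<in> set xs \<Longrightarrow> P x \<Longrightarrow> f x < g x"
  shows "(\<Sum>x\<leftarrow>xs. f x) + length (filter P xs) \<le> (\<Sum>x\<leftarrow>xs. g x)"
  using assms
proof (induction xs)
  case (Cons x xs)
  have "(\<Sum>x\<leftarrow>xs. f x) + length (filter P xs) \<le> (\<Sum>x\<leftarrow>xs. g x)"
    using Cons by simp
  moreover have "f x + (if P x then 1 else 0) \<le> g x"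
    using Cons.prems(1)[of x] Cons.prems(2)[of x] by auto
  ultimately show ?case by (auto split: if_splits)
qed simp

primrec modulator_exp :: "nat \<Rightarrow> nat" where
  "modulator_exp 0 = 1"
| "modulator_exp (Suc c) = (2 ^ Suc c + 1) * modulator_exp c"

context graph
begin

definition solvable :: "'v set \<Rightarrow> 'v list list \<Rightarrow> nat \<Rightarrow> bool" where
  "solvable V hs k \<longleftrightarrow> (\<exists>S\<subseteq>V. indep S \<and> (\<forall>h\<in>set hs. \<not> set h \<subseteq> S) \<and> k \<le> card S)"

text \<open>
  The vertices in neither \<open>xs\<close> nor \<open>rs\<close> have been taken out of the remainder: an admissible
  choice in the modulator never reduces the independence number of the graph they induce.
\<close>

definition reduced :: "nat \<Rightarrow> 'v set \<Rightarrow> 'v list \<Rightarrow> 'v list \<Rightarrow> 'v list list \<Rightarrow> bool" where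
  "reduced c V xs rs hs \<longleftrightarrow> finite V \<and> distinct (xs @ rs) \<and> set (xs @ rs) \<subseteq> V \<and> tdepth c (set rs) \<and>
     (\<forall>h\<in>set hs. set h \<subseteq> set xs) \<and> apart (V - set xs - set rs) (set rs) \<and>
     (\<forall>A\<subseteq>set xs. (\<forall>h\<in>set hs. \<not> set h \<subseteq> A) \<longrightarrow>
        indep_num (V - set xs - set rs - nbhd A) = indep_num (V - set xs - set rs))"

lemma conflict_iff:
  assumes "distinct C" and "tdepth c (set C)"
  shows "conflict c adj Y C \<longleftrightarrow> indep_num (set C - nbhd (set Y)) < indep_num (set C)"
proof -
  let ?C = "filter (\<lambda>u. \<not> (\<exists>y\<in>set Y. adj y u)) C"
  have C: "set ?C = set C - nbhd (set Y)" by (auto simp: nbhd_def)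
  have "tdepth c (set ?C)" by (rule tdepth_subset[OF assms(2)]) auto
  then have "length (max_indep c adj ?C) = indep_num (set ?C)"
    using assms(1) by (intro length_max_indep) simp_all
  then show ?thesis
    using assms length_max_indep[of C c] unfolding conflict_def C by simp
qed

section \<open>One round of the reduction\<close>

context
  fixes c :: nat and V :: "'v set" and xs rs :: "'v list" and hs :: "'v list list" and z :: 'v
  assumes red: "reduced (Suc c) V xs rs hs"
begin

abbreviation "dropped \<equiv> V - set xs - set rs"
abbreviation "comps \<equiv> components adj rs"
abbreviation "marks \<equiv> marked (Suc c) adj xs comps"
abbreviation "rt \<equiv> root_of c adj z"

lemma reducedD:
  shows finite_V: "finite V" and parts_distinct: "distinct xs" "distinct rs" "set xs \<inter> set rs = {}"
    and parts_subset: "set xs \<subseteq> V" "set rs \<subseteq> V" and rest_tdepth: "tdepth (Suc c) (set rs)"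
    and hyper_subset: "\<And>h. h \<in> set hs \<Longrightarrow> set h \<subseteq> set xs"
    and dropped_apart: "apart dropped (set rs)"
    and dropped_free: "\<And>A. A \<subseteq> set xs \<Longrightarrow> (\<And>h. h \<in> set hs \<Longrightarrow> \<not> set h \<subseteq> A) \<Longrightarrow>
      indep_num (dropped - nbhd A) = indep_num dropped"
  using red unfolding reduced_def by auto

lemma component_list_comps: "component_list comps (set rs)"
  by (rule component_list_components[OF parts_distinct(2)])

lemma comps_separated: "separated comps"
  by (rule component_list_separated[OF component_list_comps])

lemma comp_facts:
  assumes "C \<in> set comps"
  shows "distinct C" and "set C \<subseteq> set rs" and "tdepth (Suc c) (set C)"
    and "rt C \<in> set C" and "tdepth c (set C - {rt C})"
proof -
  show C: "distinct C" "set C \<subseteq> set rs"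
    using assms component_list_comps by (auto simp: component_list_def distinct_concat_iff)
  show t: "tdepth (Suc c) (set C)"
    by (rule tdepth_subset[OF rest_tdepth C(2)])
  have "conn (set C)" "set C \<noteq> {}" using assms component_list_comps by (auto simp: component_list_def)
  from tdepth_conn[OF t this] obtain r where r: "r \<in> set C" "tdepth c (set C - {r})" by auto
  have eq: "set (filter (\<lambda>u. u \<noteq> s) C) = set C - {s}" for s by auto
  have test: "tdepth_test c adj (filter (\<lambda>u. u \<noteq> s) C) \<longleftrightarrow> tdepth c (set C - {s})" for s
    using tdepth_test_iff[of "filter (\<lambda>u. u \<noteq> s) C" c] C(1) unfolding eq by simp
  show "rt C \<in> set C" "tdepth c (set C - {rt C})"
    using root_of_correct[of r C c adj z] r unfolding test by auto
qed

lemma marks_subset: "set marks \<subseteq> set comps"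
  by (auto simp: marked_def)

lemma conflict_comp:
  "C \<in> set comps \<Longrightarrow> conflict (Suc c) adj Y C \<longleftrightarrow> indep_num (set C - nbhd (set Y)) < indep_num (set C)"
  by (intro conflict_iff comp_facts)

lemma indep_num_outside: "indep_num (V - set xs) = indep_num dropped + indep_num (set rs)"
proof -
  have "V - set xs = dropped \<union> set rs" using parts_distinct parts_subset by auto
  moreover have "indep_num (dropped \<union> set rs) = indep_num dropped + indep_num (set rs)"
    using finite_V dropped_apart by (intro indep_num_Un) auto
  ultimately show ?thesis by simp
qed

text \<open>
  Each conflicting component costs one vertex, and there are more of them than the modulator
  can make up for.
\<close>

lemma heavy_not_optimal:
  assumes S: "S \<subseteq> V" "indep S" and Y: "set Y \<subseteq> S" and h: "heavy (Suc c) adj xs comps Y"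
  shows "card S < indep_num (V - set xs)"
proof -
  have finS: "finite S" using S finite_V finite_subset by auto
  have "card S \<le> card (S \<inter> set xs) + card (S \<inter> dropped) + card (S \<inter> set rs)"
  proof -
    have "S = (S \<inter> set xs) \<union> (S \<inter> dropped) \<union> (S \<inter> set rs)" using S(1) by auto
    then show ?thesis by (metis (no_types, lifting) add_le_mono1 card_Un_le le_trans)
  qed
  also have "card (S \<inter> set xs) \<le> length xs"
    by (metis Int_lower2 List.finite_set card_length card_mono le_trans)
  also have "card (S \<inter> dropped) \<le> indep_num dropped"
    using finite_V S by (intro card_le_indep_num) (auto intro: indep_subset)
  also have "card (S \<inter> set rs) \<le> indep_num (set rs - nbhd (set Y))"
    using S Y by (intro card_le_indep_num) (auto intro: indep_subset simp: nbhd_def indep_def)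
  also have "indep_num (set rs - nbhd (set Y)) = (\<Sum>C\<leftarrow>comps. indep_num (set C - nbhd (set Y)))"
    using indep_num_concat[OF comps_separated, of "nbhd (set Y)"] component_list_comps by (simp add: component_list_def)
  finally have 1: "card S \<le> length xs + indep_num dropped + (\<Sum>C\<leftarrow>comps. indep_num (set C - nbhd (set Y)))"
    by simp
  have "(\<Sum>C\<leftarrow>comps. indep_num (set C - nbhd (set Y))) + length (filter (conflict (Suc c) adj Y) comps)
      \<le> (\<Sum>C\<leftarrow>comps. indep_num (set C))"
    by (rule sum_list_plus_filter_le) (auto simp: conflict_comp intro: indep_num_mono)
  also have "\<dots> = indep_num (set rs)"
    using indep_num_concat[OF comps_separated, of "{}"] component_list_comps by (simp add: component_list_def)
  finally show ?thesis
    using 1 h indep_num_outside by (simp add: heavy_def)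
qed

text \<open>A solution that contains a heavy chunk is exchanged for a largest independent set
  outside the modulator, which is bigger by \<open>heavy_not_optimal\<close>.\<close>

lemma solvable_reduce:
  "solvable V (reduce_hyperedges c adj xs rs @ hs) k \<longleftrightarrow> solvable V hs k"
proof
  assume "solvable V hs k"
  then obtain S where S: "S \<subseteq> V" "indep S" "\<And>h. h \<in> set hs \<Longrightarrow> \<not> set h \<subseteq> S" "k \<le> card S"
    unfolding solvable_def by auto
  show "solvable V (reduce_hyperedges c adj xs rs @ hs) k"
  proof (cases "\<exists>Y\<in>set (reduce_hyperedges c adj xs rs). set Y \<subseteq> S")
    case False
    with S show ?thesis unfolding solvable_def by auto
  next
    case True
    then obtain Y where "set Y \<subseteq> S" "heavy (Suc c) adj xs comps Y"
      by (auto simp: reduce_hyperedges_def)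
    from heavy_not_optimal[OF S(1,2) this] have lt: "card S < indep_num (V - set xs)" .
    obtain T where T: "T \<subseteq> V - set xs" "indep T" "card T = indep_num (V - set xs)"
      using finite_V indep_numE[of "V - set xs"] by blast
    \<comment> \<open>Hyperedges lie in the modulator and \<open>T\<close> avoids it, so only an
      empty hyperedge could be violated. An old one would exclude \<open>S\<close> as well, and the
      empty chunk conflicts with no component and is never heavy.\<close>
    have "\<not> set h \<subseteq> T" if h: "h \<in> set (reduce_hyperedges c adj xs rs @ hs)" for h
    proof
      assume hT: "set h \<subseteq> T"
      have "set h \<subseteq> set xs"
        using h hyper_subset chunks_subset[of h _ xs] by (auto simp: reduce_hyperedges_def simp del: chunks.simps)
      with hT T(1) have "x \<notin> set h" for x by blast
      then have h0: "set h = {}" by (metis equals0I)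
      show False
      proof (cases "h \<in> set hs")
        case True
        from S(3)[OF this] h0 show False by simp
      next
        case False
        with h have "heavy (Suc c) adj xs comps h" by (auto simp: reduce_hyperedges_def)
        moreover have "nbhd (set h) = {}" using h0 by (simp add: nbhd_def)
        then have "filter (conflict (Suc c) adj h) comps = []"
          by (simp add: filter_empty_conv conflict_comp)
        ultimately show False by (simp add: heavy_def)
      qed
    qed
    moreover have "T \<subseteq> V" "k \<le> card T" using T lt S(4) by auto
    ultimately show ?thesis using T(2) unfolding solvable_def by blast
  qed
qed (auto simp: solvable_def)

text \<open>\<open>blocking_set\<close> bounds a set of vertices inside \<open>C\<close>. Choosing
  for each of them a neighbour in \<open>A\<close> turns it into a chunk contained in
  \<open>A\<close> that still conflicts with \<open>C\<close>. This chunk is not heavy, as it would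
  be a hyperedge inside \<open>A\<close>, so \<open>C\<close> would be marked.\<close>

lemma unmarked_free:
  assumes C: "C \<in> set comps" "C \<notin> set marks" and A: "A \<subseteq> set xs"
    and H: "\<And>h. h \<in> set (reduce_hyperedges c adj xs rs) \<Longrightarrow> \<not> set h \<subseteq> A"
  shows "indep_num (set C - nbhd A) = indep_num (set C)"
proof (rule ccontr)
  assume "indep_num (set C - nbhd A) \<noteq> indep_num (set C)"
  moreover have "indep_num (set C - nbhd A) \<le> indep_num (set C)"
    by (rule indep_num_mono) auto
  ultimately have "indep_num (set C - (nbhd A \<inter> set C)) < indep_num (set C)"
    by (simp add: Diff_Int_distrib2 Diff_Int)
  from blocking_set[OF comp_facts(3)[OF C(1)] order_refl this]
  obtain B where B: "B \<subseteq> nbhd A \<inter> set C" "finite B" "card B \<le> 2 ^ Suc c"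
      "indep_num (set C - B) < indep_num (set C)"
    by auto
  have "\<forall>b\<in>B. \<exists>a\<in>A. adj a b" using B(1) by (auto simp: nbhd_def)
  then obtain p where p: "\<forall>b\<in>B. p b \<in> A \<and> adj (p b) b" by metis
  have "card (p ` B) \<le> 2 ^ Suc c" using card_image_le[OF B(2), of p] B(3) by linarith
  moreover have "p ` B \<subseteq> set xs" using p A by auto
  ultimately obtain Y where Y: "Y \<in> set (chunks (2 ^ Suc c) xs)" "set Y = p ` B"
    using chunks_complete[of "p ` B" xs "2 ^ Suc c"] by blast
  have "indep_num (set C - nbhd (set Y)) \<le> indep_num (set C - B)"
    using p Y(2) by (intro indep_num_mono) (auto simp: nbhd_def)
  then have conf: "conflict (Suc c) adj Y C"
    using B(4) C(1) by (simp add: conflict_comp)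
  have "\<not> heavy (Suc c) adj xs comps Y"
  proof
    assume "heavy (Suc c) adj xs comps Y"
    then have "Y \<in> set (reduce_hyperedges c adj xs rs)"
      using Y(1) unfolding reduce_hyperedges_def by (simp del: chunks.simps power_Suc)
    with H[of Y] p Y(2) show False by auto
  qed
  then have "C \<in> set marks"
    using conf Y(1) C(1) unfolding marked_def by (auto simp del: chunks.simps power_Suc)
  with C(2) show False by simp
qed

text \<open>The vertices outside the new parts are the old \<open>dropped\<close> together with the
  unmarked components, without edges in between. Their independence number is a sum, in which
  \<open>dropped_free\<close> takes care of the first term and \<open>unmarked_free\<close> of the
  others.\<close>

lemma reduced_reduce:
  "reduced c V (reduce_modulator c adj z xs rs) (reduce_remainder c adj z xs rs)
     (reduce_hyperedges c adj xs rs @ hs)"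
proof -
  let ?xs = "reduce_modulator c adj z xs rs" and ?rs = "reduce_remainder c adj z xs rs"
  let ?hs = "reduce_hyperedges c adj xs rs @ hs"
  let ?P = "\<lambda>C. \<exists>Y\<in>set (filter (\<lambda>Y. \<not> heavy (Suc c) adj xs comps Y) (chunks (2 ^ Suc c) xs)).
     conflict (Suc c) adj Y C"
  let ?un = "filter (\<lambda>C. \<not> ?P C) comps"
  have marks: "marks = filter ?P comps" by (simp add: marked_def)
  have sepm: "separated marks" unfolding marks by (rule separated_filter[OF comps_separated])
  have sepu: "separated ?un" by (rule separated_filter[OF comps_separated])
  have rsU: "set (concat comps) = set rs" "distinct (concat comps)"
    using component_list_comps by (auto simp: component_list_def)
  have split: "set (concat marks) \<union> set (concat ?un) = set rs"
      "set (concat marks) \<inter> set (concat ?un) = {}"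
    unfolding marks using set_concat_filter_Un[of ?P comps] concat_filter_disj[OF rsU(2), of ?P] rsU(1)
    by (simp_all only:)
  have m: "C \<in> set comps" if "C \<in> set marks" for C using that marks_subset by auto
  have set_rs: "set ?rs = (\<Union>C\<in>set marks. set C - {rt C})"
    unfolding reduce_remainder_def by auto
  have set_xs: "set ?xs = rt ` set marks \<union> set xs"
    unfolding reduce_modulator_def by auto
  have union: "rt ` set marks \<union> set ?rs = set (concat marks)"
    unfolding set_rs using comp_facts(4) m by auto
  have djm: "C = C'" if "C \<in> set marks" "C' \<in> set marks" "u \<in> set C" "u \<in> set C'" for C C' u
    using that sepm by (auto simp: separated_def distinct_concat_iff)
  have disj: "rt ` set marks \<inter> set ?rs = {}"
  proof -
    have False if "C \<in> set marks" "C' \<in> set marks" "rt C \<in> set C' - {rt C'}" for C C'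
      using djm[of C C' "rt C"] comp_facts(4)[OF m[OF that(1)]] that by auto
    then show ?thesis unfolding set_rs by blast
  qed
  have dropped': "V - set ?xs - set ?rs = dropped \<union> set (concat ?un)"
  proof -
    have "V - set ?xs - set ?rs = V - set xs - set (concat marks)"
      unfolding set_xs using union by blast
    also have "\<dots> = dropped \<union> set (concat ?un)"
      using split parts_subset parts_distinct(3) by blast
    finally show ?thesis .
  qed
  have crossing: "apart (set (concat ?un)) (set (concat marks))"
    unfolding apart_def
  proof (intro ballI notI)
    fix u w assume u: "u \<in> set (concat ?un)" and w: "w \<in> set (concat marks)" and "adj u w"
    obtain C where C: "C \<in> set ?un" "u \<in> set C" using u by auto
    then have "w \<notin> set C" using w split(2) by auto
    moreover have "w \<in> set rs" using w split(1) by auto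
    moreover have "apart (set C) (set rs - set C)" using C(1) component_list_comps by (auto simp: component_list_def)
    ultimately show False using C(2) \<open>adj u w\<close> unfolding apart_def by blast
  qed
  have mrs: "set (concat marks) \<subseteq> set rs" using split(1) by blast
  have ap': "apart (dropped \<union> set (concat ?un)) (set (concat marks))"
    using crossing apart_mono[OF dropped_apart order_refl mrs] unfolding apart_def by blast
  have "distinct (map rt marks)"
  proof -
    have "inj_on rt (set marks)"
      using djm comp_facts(4) m by (intro inj_onI) metis
    moreover have "distinct marks"
      using sepm component_list_comps unfolding marks
      by (intro distinct_filter) (auto simp: component_list_def distinct_concat_iff)
    ultimately show ?thesis by (simp add: distinct_map)
  qed
  moreover have "distinct ?rs"
  proof -
    have "distinct (concat (map (\<lambda>C. filter (\<lambda>u. u \<noteq> rt C) C) cs))" if "distinct (concat cs)" for cs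
      using that by (induction cs) auto
    then show ?thesis using sepm unfolding reduce_remainder_def separated_def by simp
  qed
  moreover have "set ?rs \<inter> set xs = {}" "rt ` set marks \<inter> set xs = {}"
    using union mrs parts_distinct(3) by blast+
  ultimately have D: "distinct (?xs @ ?rs)"
    using disj parts_distinct(1) unfolding reduce_modulator_def by auto
  have V': "set (?xs @ ?rs) \<subseteq> V"
    using union mrs parts_subset set_xs by auto
  have T: "tdepth c (set ?rs)"
    unfolding set_rs using comp_facts(5) m by (intro tdepth_concat[OF sepm]) auto
  have H: "set h \<subseteq> set ?xs" if "h \<in> set ?hs" for h
    using that hyper_subset chunks_subset[of h "2 ^ Suc c" xs] unfolding set_xs
    by (auto simp: reduce_hyperedges_def simp del: chunks.simps power_Suc)
  have ap'': "apart (V - set ?xs - set ?rs) (set ?rs)"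
    unfolding dropped' using union by (intro apart_mono[OF ap']) auto
  have F: "indep_num (V - set ?xs - set ?rs - nbhd A) = indep_num (V - set ?xs - set ?rs)"
    if A: "A \<subseteq> set ?xs" and hA: "\<forall>h\<in>set ?hs. \<not> set h \<subseteq> A" for A
  proof -
    let ?A = "A \<inter> set xs"
    have D_sum: "indep_num (dropped \<union> set (concat ?un) - B) =
        indep_num (dropped - B) + (\<Sum>C\<leftarrow>?un. indep_num (set C - B))" for B
    proof -
      have 1: "set (concat ?un) \<subseteq> set rs" using split(1) by blast
      have "dropped \<union> set (concat ?un) - B = (dropped - B) \<union> (set (concat ?un) - B)" by blast
      also have "indep_num \<dots> = indep_num (dropped - B) + indep_num (set (concat ?un) - B)"
      proof (rule indep_num_Un)
        show "finite (dropped - B)" using finite_V by simp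
        show "finite (set (concat ?un) - B)" by simp
        show "(dropped - B) \<inter> (set (concat ?un) - B) = {}" using 1 by blast
        show "apart (dropped - B) (set (concat ?un) - B)"
          using 1 by (intro apart_mono[OF dropped_apart]) blast+
      qed
      finally show ?thesis using indep_num_concat[OF sepu, of B] by simp
    qed
    \<comment> \<open>A new root comes from a marked component, so it has no neighbour among the
      vertices considered here. Only the old part of \<open>A\<close> counts, to which the old
      invariant applies.\<close>
    have nb: "dropped \<union> set (concat ?un) - nbhd A = dropped \<union> set (concat ?un) - nbhd ?A"
    proof -
      have "u \<in> nbhd ?A" if u: "u \<in> dropped \<union> set (concat ?un)" "u \<in> nbhd A" for u
      proof -
        obtain a where a: "a \<in> A" "adj a u" using u(2) by (auto simp: nbhd_def)
        have "a \<notin> set (concat marks)"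
          using ap' u(1) a(2) adj_sym unfolding apart_def by blast
        then have "a \<in> set xs" using a(1) A union unfolding set_xs by blast
        then show ?thesis using a by (auto simp: nbhd_def)
      qed
      moreover have "nbhd ?A \<subseteq> nbhd A" by (auto simp: nbhd_def)
      ultimately show ?thesis by blast
    qed
    have hA': "\<not> set h \<subseteq> ?A" if "h \<in> set ?hs" for h using hA that by blast
    have 1: "indep_num (dropped - nbhd ?A) = indep_num dropped"
      using hA' by (intro dropped_free) auto
    have "indep_num (set C - nbhd ?A) = indep_num (set C)" if "C \<in> set ?un" for C
    proof (rule unmarked_free)
      show "C \<in> set comps" "C \<notin> set marks" using that unfolding marks by auto
    qed (use hA' in auto)
    then have "map (\<lambda>C. indep_num (set C - nbhd ?A)) ?un = map (\<lambda>C. indep_num (set C)) ?un"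
      by (intro map_cong refl)
    then have "indep_num (dropped \<union> set (concat ?un) - nbhd A) =
        indep_num (dropped - {}) + (\<Sum>C\<leftarrow>?un. indep_num (set C - {}))"
      by (simp only: nb D_sum 1 Diff_empty)
    also have "\<dots> = indep_num (dropped \<union> set (concat ?un) - {})"
      by (rule D_sum[symmetric])
    finally show ?thesis unfolding dropped' by (simp only: Diff_empty)
  qed
  show ?thesis
    unfolding reduced_def using finite_V D V' T H ap'' F by blast
qed

end

text \<open>The old hyperedges stay visible as the tail of \<open>hs' @ hs\<close>, because their
  number must not decrease. In the bound for \<open>hs'\<close>, each of the \<open>c\<close> rounds
  is charged with the final power.\<close>

lemma reduce_correct:
  assumes "reduced c V xs rs hs"
  shows "\<exists>xs' hs'. reduce c adj z (xs, rs, hs) = (xs', [], hs' @ hs) \<and> reduced 0 V xs' [] (hs' @ hs) \<and>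
    (\<forall>k. solvable V (hs' @ hs) k \<longleftrightarrow> solvable V hs k) \<and>
    Suc (length xs') \<le> Suc (length xs) ^ modulator_exp c \<and>
    length hs' \<le> c * Suc (length xs) ^ modulator_exp c"
  using assms
proof (induction c arbitrary: xs rs hs)
  case 0
  then have "rs = []" using tdepth_0[of 0 "set rs"] by (simp add: reduced_def)
  with 0 show ?case by (intro exI[of _ xs] exI[of _ "[]"]) simp
next
  case (Suc c)
  let ?xs = "reduce_modulator c adj z xs rs" and ?rs = "reduce_remainder c adj z xs rs"
  let ?h = "reduce_hyperedges c adj xs rs" and ?n = "Suc (length xs)"
  from Suc.IH[OF reduced_reduce[OF Suc.prems]] obtain xs' hs' where
    1: "reduce c adj z (?xs, ?rs, ?h @ hs) = (xs', [], hs' @ ?h @ hs)" "reduced 0 V xs' [] (hs' @ ?h @ hs)"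
      "\<And>k. solvable V (hs' @ ?h @ hs) k \<longleftrightarrow> solvable V (?h @ hs) k"
    and 2: "Suc (length xs') \<le> Suc (length ?xs) ^ modulator_exp c"
    and 3: "length hs' \<le> c * Suc (length ?xs) ^ modulator_exp c"
    by blast
  have le: "Suc (length ?xs) ^ modulator_exp c \<le> ?n ^ modulator_exp (Suc c)"
    using power_mono[OF length_reduce_modulator, of c adj z xs rs "modulator_exp c"]
    by (simp only: modulator_exp.simps power_mult)
  have "0 < modulator_exp c" by (induction c) auto
  then have "2 ^ Suc c * 1 \<le> (2 ^ Suc c + 1) * modulator_exp c"
    by (intro mult_le_mono) auto
  then have "?n ^ 2 ^ Suc c \<le> ?n ^ modulator_exp (Suc c)"
    by (intro power_increasing) auto
  with length_reduce_hyperedges[of c adj xs rs] have "length ?h \<le> ?n ^ modulator_exp (Suc c)"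
    by (rule order_trans)
  then have "length (hs' @ ?h) \<le> c * ?n ^ modulator_exp (Suc c) + ?n ^ modulator_exp (Suc c)"
    unfolding length_append by (intro add_mono order_trans[OF 3 mult_le_mono2[OF le]])
  then have "length (hs' @ ?h) \<le> Suc c * ?n ^ modulator_exp (Suc c)"
    by (simp only: mult_Suc add.commute)
  with 1 2 le solvable_reduce[OF Suc.prems] show ?case
    by (intro exI[of _ xs'] exI[of _ "hs' @ ?h"]) (auto simp del: modulator_exp.simps)
qed

text \<open>With an empty remainder, all vertices outside the modulator are governed by the
  invariant: they contribute the same amount to every admissible \<open>A\<close>. This constant is
  subtracted from the target.\<close>

lemma solvable_reduced_0:
  assumes red: "reduced 0 V xs [] hs"
  shows "solvable V hs k \<longleftrightarrow>
    (\<exists>A\<subseteq>set xs. indep A \<and> (\<forall>h\<in>set hs. \<not> set h \<subseteq> A) \<and> k \<le> card A + indep_num (V - set xs))"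
proof
  have V: "finite V" "set xs \<subseteq> V" "\<And>h. h \<in> set hs \<Longrightarrow> set h \<subseteq> set xs"
    using red by (auto simp: reduced_def)
  {
    assume "solvable V hs k"
    then obtain S where S: "S \<subseteq> V" "indep S" "\<And>h. h \<in> set hs \<Longrightarrow> \<not> set h \<subseteq> S" "k \<le> card S"
      unfolding solvable_def by auto
    have "card (S - set xs) \<le> indep_num (V - set xs)"
      using S V by (intro card_le_indep_num) (auto intro: indep_subset)
    moreover have "card S \<le> card (S \<inter> set xs) + card (S - set xs)"
      by (metis Int_Diff_Un card_Un_le)
    ultimately show "\<exists>A\<subseteq>set xs. indep A \<and> (\<forall>h\<in>set hs. \<not> set h \<subseteq> A) \<and> k \<le> card A + indep_num (V - set xs)"
      using S by (intro exI[of _ "S \<inter> set xs"]) (auto intro: indep_subset)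
  next
    assume "\<exists>A\<subseteq>set xs. indep A \<and> (\<forall>h\<in>set hs. \<not> set h \<subseteq> A) \<and> k \<le> card A + indep_num (V - set xs)"
    then obtain A where A: "A \<subseteq> set xs" "indep A" "\<forall>h\<in>set hs. \<not> set h \<subseteq> A"
        "k \<le> card A + indep_num (V - set xs)" by auto
    have eq: "indep_num (V - set xs - nbhd A) = indep_num (V - set xs)"
      using red A unfolding reduced_def by simp
    obtain T where T: "T \<subseteq> V - set xs - nbhd A" "indep T" "card T = indep_num (V - set xs)"
      using V(1) indep_numE[of "V - set xs - nbhd A"] eq by auto
    have "apart A T" using T(1) by (auto simp: apart_def nbhd_def)
    then have "indep (A \<union> T)" using A T by (simp add: indep_Un)
    moreover have "\<not> set h \<subseteq> A \<union> T" if h: "h \<in> set hs" for h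
    proof
      assume "set h \<subseteq> A \<union> T"
      with V(3)[OF h] T(1) have "set h \<subseteq> A" by blast
      with A(3) h show False by auto
    qed
    moreover have "finite A" "finite T" using A(1) T(1) V(1) by (auto intro: finite_subset)
    then have "card (A \<union> T) = card A + card T"
      using A(1) T(1) by (intro card_Un_disjoint) auto
    ultimately show "solvable V hs k"
      using A(1,4) T(1,3) V(2) unfolding solvable_def by (intro exI[of _ "A \<union> T"]) auto
  }
qed

end

section \<open>The reduction runs in polynomial time\<close>

definition adjacent :: "('v \<times> 'v) list \<Rightarrow> 'v \<Rightarrow> 'v \<Rightarrow> bool" where
  "adjacent es u v \<longleftrightarrow> (u, v) \<in> set es \<or> (v, u) \<in> set es"

text \<open>This form lets an induction hypothesis about a function on pairs be applied to two
  computed arguments.\<close>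

lemma polytime_compose2:
  assumes "polytime (\<lambda>p. f (fst p) (snd p))" and "polytime a" and "polytime b"
  shows "polytime (\<lambda>x. f (a x) (b x))"
  using polytime_compose[OF assms(1) polytime_Pair[OF assms(2,3)]] by simp

lemma polytime_adjacent:
  assumes "polytime e" and "polytime a" and "polytime b"
  shows "polytime (\<lambda>x. adjacent (e x) (a x) (b x))"
  unfolding adjacent_def by (intro polytime_intros assms)

text \<open>Each old component is either merged or kept, never copied, so the size grows only by the
  new vertex and a constant.\<close>

lemma enc_size_add_vertex: "enc_size (add_vertex adj v cs) \<le> enc_size cs + (3 + enc_size v)"
proof -
  have "enc_size (concat (filter P cs)) + enc_size (filter (\<lambda>C. \<not> P C) cs) \<le> enc_size cs + 1" for P
  proof (induction cs)
    case (Cons C cs)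
    then show ?case using enc_size_append[of C "concat (filter P cs)"] by auto
  qed simp
  from this[of "\<lambda>C. \<exists>w\<in>set C. adj v w"] show ?thesis by (simp add: add_vertex_def)
qed

lemma polytime_components:
  assumes "polytime e" and "polytime l"
  shows "polytime (\<lambda>x. components (adjacent (e x)) (l x))"
proof -
  have "polytime (\<lambda>p :: ('b \<times> 'b) list \<times> 'b list. fold (add_vertex (adjacent (fst p))) (snd p) [])"
  proof (rule polytime_fold[where g = "\<lambda>n. 3 + n"])
    show "enc_size (add_vertex (adjacent (fst p)) v cs) \<le> enc_size cs + (3 + (enc_size p + enc_size v))"
      for p :: "('b \<times> 'b) list \<times> 'b list" and v cs
      using enc_size_add_vertex[of "adjacent (fst p)" v cs] by simp
    show "polytime (\<lambda>p :: ((('b \<times> 'b) list \<times> 'b list) \<times> 'b) \<times> 'b list list.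
        add_vertex (adjacent (fst (fst (fst p)))) (snd (fst p)) (snd p))"
      unfolding add_vertex_def by (intro polytime_intros polytime_adjacent)
  qed (intro polytime_intros poly_bounded_intros)+
  from polytime_compose2[where f = "\<lambda>e l. fold (add_vertex (adjacent e)) l []", OF this assms]
  show ?thesis by (simp add: components_def)
qed

lemma polytime_longest:
  assumes "polytime l"
  shows "polytime (\<lambda>x. longest (l x))"
  unfolding longest_def
  by (rule polytime_fold[where g = "\<lambda>n. n"])
    (auto intro!: polytime_intros assms poly_bounded_intros)

text \<open>\<open>c\<close> is not part of the input: the induction constructs a separate program
  for each \<open>c\<close>, with its own polynomial. The same holds for the other recursions on
  \<open>c\<close> and for \<open>chunks\<close>.\<close>

lemma polytime_tdepth_test:
  assumes "polytime e" and "polytime l"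
  shows "polytime (\<lambda>x. tdepth_test c (adjacent (e x)) (l x))"
proof -
  have "polytime (\<lambda>p :: ('b \<times> 'b) list \<times> 'b list. tdepth_test c (adjacent (fst p)) (snd p))"
  proof (induction c)
    case 0
    show ?case by (simp, intro polytime_intros)
  next
    case (Suc c)
    note IH = polytime_compose2[where f = "\<lambda>e l. tdepth_test c (adjacent e) l", OF Suc]
    show ?case by (simp, intro polytime_intros polytime_components IH)
  qed
  from polytime_compose2[where f = "\<lambda>e l. tdepth_test c (adjacent e) l", OF this assms]
  show ?thesis .
qed

lemma polytime_max_indep:
  assumes "polytime e" and "polytime l"
  shows "polytime (\<lambda>x. max_indep c (adjacent (e x)) (l x))"
proof -
  have "polytime (\<lambda>p :: ('b \<times> 'b) list \<times> 'b list. max_indep c (adjacent (fst p)) (snd p))"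
  proof (induction c)
    case 0
    show ?case by (simp, intro polytime_intros)
  next
    case (Suc c)
    note IH = polytime_compose2[where f = "\<lambda>e l. max_indep c (adjacent e) l", OF Suc]
    show ?case
      unfolding max_indep.simps
      by (intro polytime_intros polytime_components polytime_longest polytime_adjacent IH)
  qed
  from polytime_compose2[where f = "\<lambda>e l. max_indep c (adjacent e) l", OF this assms]
  show ?thesis .
qed

lemma polytime_conflict:
  assumes "polytime e" and "polytime Y" and "polytime C"
  shows "polytime (\<lambda>x. conflict c (adjacent (e x)) (Y x) (C x))"
proof -
  have "polytime (\<lambda>p :: ('b \<times> 'b) list \<times> 'b list \<times> 'b list.
      conflict c (adjacent (fst p)) (fst (snd p)) (snd (snd p)))"
    unfolding conflict_def by (intro polytime_intros polytime_max_indep polytime_adjacent)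
  from polytime_compose[OF this polytime_Pair[OF assms(1) polytime_Pair[OF assms(2,3)]]]
  show ?thesis by simp
qed

lemma polytime_chunks:
  assumes "polytime l"
  shows "polytime (\<lambda>x. chunks m (l x))"
proof -
  have "polytime (\<lambda>xs :: 'b list. chunks m xs)"
  proof (induction m)
    case (Suc m)
    show ?case
      unfolding chunks.simps by (intro polytime_intros polytime_compose[OF Suc])
  qed (simp add: polytime_const)
  from polytime_compose[OF this assms] show ?thesis .
qed

lemma polytime_root_of:
  assumes "polytime e" and "polytime l"
  shows "polytime (\<lambda>x. root_of c (adjacent (e x)) z (l x))"
proof -
  have "polytime (\<lambda>p :: ('b \<times> 'b) list \<times> 'b list. root_of c (adjacent (fst p)) z (snd p))"
    unfolding root_of_def
  proof (rule polytime_fold[where g = "\<lambda>n. n"])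
    show "polytime (\<lambda>p :: ((('b \<times> 'b) list \<times> 'b list) \<times> 'b) \<times> 'b.
        if tdepth_test c (adjacent (fst (fst (fst p))))
          (filter (\<lambda>u. u \<noteq> snd (fst p)) (snd (fst (fst p)))) then snd (fst p) else snd p)"
      by (intro polytime_intros polytime_tdepth_test)
  qed (auto intro: polytime_intros poly_bounded_intros)
  from polytime_compose2[where f = "\<lambda>e l. root_of c (adjacent e) z l", OF this assms]
  show ?thesis .
qed

lemma polytime_heavy:
  assumes "polytime e" and "polytime xs" and "polytime cs" and "polytime Y"
  shows "polytime (\<lambda>x. heavy c (adjacent (e x)) (xs x) (cs x) (Y x))"
proof -
  have "polytime (\<lambda>p :: ('b \<times> 'b) list \<times> 'b list \<times> 'b list list \<times> 'b list.
      heavy c (adjacent (fst p)) (fst (snd p)) (fst (snd (snd p))) (snd (snd (snd p))))"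
    unfolding heavy_def by (intro polytime_intros polytime_conflict)
  from polytime_compose[OF this polytime_Pair[OF assms(1) polytime_Pair[OF assms(2) polytime_Pair[OF assms(3,4)]]]]
  show ?thesis by simp
qed

lemma polytime_marked:
  assumes "polytime e" and "polytime xs" and "polytime cs"
  shows "polytime (\<lambda>x. marked c (adjacent (e x)) (xs x) (cs x))"
proof -
  have "polytime (\<lambda>p :: ('b \<times> 'b) list \<times> 'b list \<times> 'b list list.
      marked c (adjacent (fst p)) (fst (snd p)) (snd (snd p)))"
    unfolding marked_def
    by (intro polytime_intros polytime_conflict polytime_heavy polytime_chunks)
  from polytime_compose[OF this polytime_Pair[OF assms(1) polytime_Pair[OF assms(2,3)]]]
  show ?thesis by simp
qed

lemma polytime_reduce:
  assumes "polytime e" and "polytime q"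
  shows "polytime (\<lambda>x. reduce c (adjacent (e x)) z (q x))"
proof -
  have "polytime (\<lambda>p :: ('b \<times> 'b) list \<times> 'b list \<times> 'b list \<times> 'b list list.
      reduce c (adjacent (fst p)) z (snd p))"
  proof (induction c)
    case (Suc c)
    note IH = polytime_compose2[where f = "\<lambda>e l. reduce c (adjacent e) z l", OF Suc]
    show ?case
      unfolding reduce.simps reduce_modulator_def reduce_remainder_def reduce_hyperedges_def
      by (intro IH polytime_intros polytime_marked polytime_components polytime_heavy
          polytime_chunks polytime_root_of)
  qed (simp, intro polytime_intros)
  from polytime_compose2[where f = "\<lambda>e l. reduce c (adjacent e) z l", OF this assms]
  show ?thesis .
qed

section \<open>The output instance\<close>

definition indexed :: "'v list \<Rightarrow> (nat \<times> 'v) list" where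
  "indexed xs = fold (\<lambda>x l. (length l, x) # l) xs []"

lemma indexed_eq: "indexed xs = rev (zip [0..<length xs] xs)"
  unfolding indexed_def by (induction xs rule: rev_induct) auto

lemma indexed_eq_map: "indexed xs = map (\<lambda>i. (i, xs ! i)) (rev [0..<length xs])"
proof -
  have "zip [0..<length xs] xs = map (\<lambda>i. (i, xs ! i)) [0..<length xs]"
    by (rule nth_equalityI) auto
  then show ?thesis by (simp add: indexed_eq rev_map)
qed

lemma enc_size_list_le:
  assumes "\<And>x. x \<in> set xs \<Longrightarrow> enc_size x \<le> b"
  shows "enc_size xs \<le> 1 + length xs * (1 + b)"
  using assms by (induction xs) fastforce+

text \<open>A step writes down \<open>length l\<close>, so its growth depends on the accumulator and
  \<open>polytime_fold\<close> does not apply. The bound comes from the explicit form of the partial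
  results.\<close>

lemma polytime_indexed:
  fixes l :: "'a::encodable \<Rightarrow> 'b::encodable list"
  assumes l: "polytime l"
  shows "polytime (\<lambda>x. indexed (l x))"
proof -
  from l obtain h where h: "poly_bounded h" and lh: "\<And>x. enc_size (l x) \<le> h (enc_size x)"
    by (rule polytime_enc_size) (rule that)
  show ?thesis
    unfolding indexed_def
  proof (rule polytime_fold_bounded[where g = "\<lambda>n. 1 + h n * (1 + (2 + 4 * h n + h n))"])
    fix x ys zs assume "l x = ys @ zs"
    then have len: "length ys \<le> h (enc_size x)" and mem: "\<And>y. y \<in> set ys \<Longrightarrow> enc_size y \<le> h (enc_size x)"
      using length_le_enc_size[of "l x"] lh[of x] enc_size_member[of _ "l x"] by fastforce+
    have "enc_size (indexed ys) \<le> 1 + length (indexed ys) * (1 + (2 + 4 * h (enc_size x) + h (enc_size x)))"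
    proof (rule enc_size_list_le)
      fix p assume "p \<in> set (indexed ys)"
      then obtain i where i: "i < length ys" "p = (i, ys ! i)" by (auto simp: indexed_eq_map)
      have "enc_size i \<le> 4 * h (enc_size x) + 1" using enc_size_nat[of i] i(1) len by simp
      then show "enc_size p \<le> 2 + 4 * h (enc_size x) + h (enc_size x)"
        using mem[of "ys ! i"] i by simp
    qed
    also have "\<dots> \<le> 1 + h (enc_size x) * (1 + (2 + 4 * h (enc_size x) + h (enc_size x)))"
      using len by (intro add_left_mono mult_right_mono) (auto simp: indexed_eq)
    finally show "enc_size (fold (\<lambda>x l. (length l, x) # l) ys [])
        \<le> 1 + h (enc_size x) * (1 + (2 + 4 * h (enc_size x) + h (enc_size x)))"
      by (simp add: indexed_def)
  qed (intro l polytime_intros poly_bounded_intros h)+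
qed

text \<open>The order of the result is dictated by \<open>xs\<close>, not by \<open>h\<close>.
  Hyperedges with the same elements thus become equal lists, and \<open>dedup\<close> on lists
  removes repeated sets.\<close>

definition rename :: "'v list \<Rightarrow> 'v list \<Rightarrow> nat list" where
  "rename xs h = map fst (filter (\<lambda>p. snd p \<in> set h) (indexed xs))"

definition out_hyperedges :: "('v \<times> 'v) list \<Rightarrow> 'v list \<Rightarrow> 'v list list \<Rightarrow> nat list list" where
  "out_hyperedges es xs hs = dedup (map (rename xs)
     (map (\<lambda>e. [fst e, snd e]) (filter (\<lambda>e. fst e \<in> set xs \<and> snd e \<in> set xs) es) @ hs))"

text \<open>
  The vertex \<open>length xs\<close> is new and isolated. It raises every independence number by one, which
  keeps the target of the output positive.
\<close>

definition out_vertices :: "'v list \<Rightarrow> nat list" where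
  "out_vertices xs = length xs # map fst (indexed xs)"

text \<open>A unary difference. The binary number \<open>k\<close> may be exponentially large in its
  size, so it is first capped at \<open>Suc (length vs)\<close>, a target that no set of vertices
  reaches either; the additional \<open>0\<close> in front of \<open>vs\<close> makes room for this
  value.\<close>

definition residual :: "nat list \<Rightarrow> nat \<Rightarrow> 'v list \<Rightarrow> bool list" where
  "residual vs k ws =
     fold (\<lambda>_. tl) ws (fold (\<lambda>_ u. if length u = k then u else True # u) (0 # vs) [])"

text \<open>A second cap, at \<open>Suc (length xs)\<close>, keeps the number small in terms of the
  parameter: no subset of the modulator is that large. The outer \<open>Suc\<close> accounts for the
  isolated vertex.\<close>

definition out_target :: "nat list \<Rightarrow> nat \<Rightarrow> 'v list \<Rightarrow> 'v list \<Rightarrow> nat" where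
  "out_target vs k xs ws = Suc (if length xs < length (residual vs k ws) then Suc (length xs)
     else length (residual vs k ws))"

lemma length_residual: "length (residual vs k ws) = min k (Suc (length vs)) - length ws"
proof -
  have "length u \<le> k \<Longrightarrow> length (fold (\<lambda>_ u. if length u = k then u else True # u) vs u) = min k (length u + length vs)"
    for u and vs :: "nat list"
    by (induction vs arbitrary: u) auto
  from this[of "[]" "0 # vs"] have "length (fold (\<lambda>_ u. if length u = k then u else True # u) (0 # vs) []) = min k (Suc (length vs))"
    by (simp del: fold_simps)
  moreover have "length (fold (\<lambda>_. tl) ws b) = length b - length ws" for b :: "bool list"
    by (induction ws arbitrary: b) auto
  ultimately show ?thesis by (simp add: residual_def del: fold_simps)
qed

lemma length_rename_le: "length (rename xs h) \<le> length xs"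
  unfolding rename_def indexed_eq
  by (simp, rule order_trans[OF length_filter_le]) simp

lemma rename_eq_filter: "rename xs h = filter (\<lambda>i. xs ! i \<in> set h) (rev [0..<length xs])"
  unfolding rename_def indexed_eq_map by (simp add: filter_map comp_def)

lemma set_rename: "set (rename xs h) = {i. i < length xs \<and> xs ! i \<in> set h}"
  by (auto simp: rename_eq_filter)

lemma distinct_rename: "distinct (rename xs h)"
  by (simp add: rename_eq_filter)

lemma rename_eq_iff: "rename xs h = rename xs h' \<longleftrightarrow> set (rename xs h) = set (rename xs h')"
proof
  assume "set (rename xs h) = set (rename xs h')"
  then show "rename xs h = rename xs h'"
    unfolding rename_eq_filter by (intro filter_cong) auto
qed simp

lemma out_vertices_eq: "out_vertices xs = rev [0..<Suc (length xs)]"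
  unfolding out_vertices_def indexed_eq_map by (simp add: comp_def)

definition kernel :: "nat \<Rightarrow> nat list \<times> (nat \<times> nat) list \<times> nat list list \<times> nat list \<times> nat \<Rightarrow>
    nat list \<times> (nat \<times> nat) list \<times> nat list list \<times> nat list \<times> nat" where
  "kernel c I = (
     let vs = fst I; es = fst (snd I); hs = fst (snd (snd I)); xs = fst (snd (snd (snd I)));
       k = snd (snd (snd (snd I)));
       p = reduce c (adjacent es) 0 (xs, filter (\<lambda>v. v \<notin> set xs) vs, hs);
       xs' = fst p;
       ws = max_indep c (adjacent es) (filter (\<lambda>v. v \<notin> set xs') vs)
     in (out_vertices xs', [], out_hyperedges es xs' (snd (snd p)), out_vertices xs',
       out_target vs k xs' ws))"

lemma polytime_rename:
  assumes "polytime l" and "polytime h"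
  shows "polytime (\<lambda>x. rename (l x) (h x))"
  unfolding rename_def by (intro polytime_intros polytime_indexed assms polytime_compose[OF assms(2)])

lemma polytime_out_hyperedges:
  assumes "polytime e" and "polytime l" and "polytime h"
  shows "polytime (\<lambda>x. out_hyperedges (e x) (l x) (h x))"
  unfolding out_hyperedges_def
  by (intro polytime_intros polytime_rename assms polytime_compose[OF assms(2)])

lemma polytime_out_vertices: "polytime l \<Longrightarrow> polytime (\<lambda>x. out_vertices (l x))"
  unfolding out_vertices_def by (intro polytime_intros polytime_indexed)

lemma polytime_residual:
  assumes v: "polytime v" and k: "polytime k" and w: "polytime w"
  shows "polytime (\<lambda>x. residual (v x) (k x) (w x))"
proof -
  have tl: "enc_size (tl b) \<le> enc_size b + 0" for b :: "bool list"
    by (cases b) auto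
  \<comment> \<open>Each further \<open>True\<close> adds 4 to the size of the list.\<close>
  have cap: "polytime (\<lambda>x. fold (\<lambda>_ u. if length u = k x then u else True # u) (0 # v x) [])"
    by (rule polytime_fold[where g = "\<lambda>_. 4"])
      (auto intro!: polytime_intros v polytime_compose[OF k] poly_bounded_intros simp del: fold_simps)
  show ?thesis
    unfolding residual_def
    by (rule polytime_fold[OF w cap, where g = "\<lambda>_. 0"])
      (intro polytime_intros poly_bounded_intros tl)+
qed

lemma polytime_out_target:
  assumes "polytime v" and "polytime k" and "polytime l" and "polytime w"
  shows "polytime (\<lambda>x. out_target (v x) (k x) (l x) (w x))"
  unfolding out_target_def by (intro polytime_intros polytime_residual assms)

lemma polytime_kernel: "polytime (kernel c)"
  unfolding kernel_def Let_def
  by (intro polytime_intros polytime_out_hyperedges polytime_out_vertices polytime_out_target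
      polytime_reduce polytime_max_indep)

section \<open>Correctness of the kernel\<close>

lemma enc_pair_eq: "enc_pair = encode"
  by (rule ext) (simp add: enc_pair_def encode_prod_def encode_nat_def)

lemma enc_nats_eq: "enc_list enc_nat = encode"
  by (rule ext) (simp add: encode_list_def encode_nat_def)

lemma encodesD:
  assumes "encodes t I"
  obtains vs es hs xs where "lists_once vs (verts I)"
    and "lists_once (map (\<lambda>(u, v). {u, v}) es) (edges I)"
    and "lists_once (map set hs) (hyperedges I)" and "lists_once xs (modulator I)"
    and "t = encode (vs, es, hs, xs, target I)"
proof -
  from assms show thesis
    unfolding encodes_def enc_pair_eq enc_nats_eq encode_list_def[symmetric] encode_nat_def[symmetric] encode_Pair[symmetric]
    using that by blast
qed

lemma encodesI:
  assumes "lists_once vs (verts I)" and "lists_once (map (\<lambda>(u, v). {u, v}) es) (edges I)"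
    and "lists_once (map set hs) (hyperedges I)" and "\<forall>h\<in>set hs. distinct h"
    and "lists_once xs (modulator I)"
  shows "encodes (encode (vs, es, hs, xs, target I)) I"
proof -
  show ?thesis
    unfolding encodes_def enc_pair_eq enc_nats_eq encode_list_def[symmetric] encode_nat_def[symmetric] encode_Pair[symmetric]
    using assms by blast
qed

text \<open>A positive target excludes the case in which no set is independent and
  \<open>alpha\<close> takes its default value 0.\<close>

lemma yes_instance_iff:
  assumes fin: "finite (verts I)" and "0 < target I"
  shows "yes_instance I \<longleftrightarrow> (\<exists>S. independent I S \<and> target I \<le> card S)"
proof -
  let ?C = "card ` {S. independent I S}"
  have finC: "finite ?C"
    using fin by (intro finite_imageI, rule_tac finite_subset[of _ "Pow (verts I)"]) (auto simp: independent_def)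
  show ?thesis
  proof
    assume y: "yes_instance I"
    have "?C \<noteq> {}"
    proof
      assume e: "?C = {}"
      have "alpha I = 0" unfolding alpha_def e by simp
      with y assms(2) show False by (simp add: yes_instance_def)
    qed
    then have "alpha I \<in> ?C"
      unfolding alpha_def using finC by (metis Max_in cSup_eq_Max)
    with y show "\<exists>S. independent I S \<and> target I \<le> card S"
      by (auto simp: yes_instance_def)
  next
    assume "\<exists>S. independent I S \<and> target I \<le> card S"
    then obtain S where S: "independent I S" "target I \<le> card S" by auto
    have "card S \<le> alpha I"
      unfolding alpha_def using S finC by (intro le_cSup_finite) auto
    with S show "yes_instance I" by (simp add: yes_instance_def)
  qed
qed

text \<open>\<open>treedepth\<close> is a \<open>LEAST\<close>, so some forest has to be exhibited: the path along the increasing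
  enumeration of the vertices.\<close>

lemma path_forest:
  fixes U :: "nat set"
  assumes "finite U" and E: "\<And>e. e \<in> E \<Longrightarrow> \<exists>u\<in>U. \<exists>v\<in>U. u \<noteq> v \<and> e = {u, v}"
  shows "\<exists>P. rooted_forest U P \<and> E \<subseteq> forest_closure P"
proof -
  define P where "P = {(u, v). u \<in> U \<and> v \<in> U \<and> u < v \<and> (\<forall>w\<in>U. u < w \<longrightarrow> v \<le> w)}"
  have less: "(u, v) \<in> P\<^sup>+ \<Longrightarrow> u < v" for u v
    by (induction rule: trancl_induct) (auto simp: P_def)
  have "acyclic P" using less by (intro acyclicI) blast
  moreover have "single_valued P" by (auto simp: P_def single_valued_def intro: antisym)
  ultimately have "rooted_forest U P"
    using assms(1) by (auto simp: rooted_forest_def P_def)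
  moreover have reach: "(u, v) \<in> P\<^sup>+" if "u \<in> U" "v \<in> U" "u < v" for u v
    using that
  proof (induction "v - u" arbitrary: u rule: less_induct)
    case less
    let ?s = "Min {w \<in> U. u < w}"
    have fin: "finite {w \<in> U. u < w}" using assms(1) by simp
    have s: "?s \<in> {w \<in> U. u < w}" "?s \<le> v"
      using less.prems Min_in[OF fin] Min_le[OF fin, of v] by blast+
    moreover have "\<forall>w\<in>U. u < w \<longrightarrow> ?s \<le> w" using Min_le[OF fin] by blast
    ultimately have "(u, ?s) \<in> P"
      using less.prems(1) unfolding P_def by blast
    show ?case
    proof (cases "?s = v")
      case True
      then show ?thesis using \<open>(u, ?s) \<in> P\<close> by auto
    next
      case False
      then have "(?s, v) \<in> P\<^sup>+" using s less.prems by (intro less.hyps) auto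
      then show ?thesis using \<open>(u, ?s) \<in> P\<close> by (rule trancl_into_trancl2[rotated])
    qed
  qed
  have "E \<subseteq> forest_closure P"
  proof
    fix e assume "e \<in> E"
    then obtain u v where e: "u \<in> U" "v \<in> U" "u \<noteq> v" "e = {u, v}" using E by blast
    then have "(u, v) \<in> P\<^sup>+ \<or> (v, u) \<in> P\<^sup>+" using reach by (meson nat_neq_iff)
    then show "e \<in> forest_closure P"
      unfolding forest_closure_def e(4) by (auto simp: insert_commute)
  qed
  ultimately show ?thesis by blast
qed

lemma treedepth_forest:
  fixes U :: "nat set"
  assumes "finite U" and "\<And>e. e \<in> E \<Longrightarrow> \<exists>u\<in>U. \<exists>v\<in>U. u \<noteq> v \<and> e = {u, v}"
  obtains W P where "rooted_forest W P" and "U \<subseteq> W" and "E \<subseteq> forest_closure P"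
    and "forest_height W P = treedepth U E"
proof -
  obtain P where "rooted_forest U P" "E \<subseteq> forest_closure P"
    using path_forest[OF assms] by blast
  then have "\<exists>h W P. rooted_forest W P \<and> U \<subseteq> W \<and> E \<subseteq> forest_closure P \<and> forest_height W P = h"
    by blast
  from LeastI_ex[OF this] show thesis using that unfolding treedepth_def by blast
qed

lemma treedepth_empty: "treedepth {} {} = 0"
proof -
  have "rooted_forest {} {} \<and> {} \<subseteq> ({} :: 'a set) \<and> {} \<subseteq> forest_closure ({} :: ('a \<times> 'a) set)
      \<and> forest_height {} ({} :: ('a \<times> 'a) set) = 0"
    by (simp add: rooted_forest_def forest_height_def acyclic_def)
  then have "\<exists>W P. rooted_forest W P \<and> {} \<subseteq> (W :: 'a set) \<and> {} \<subseteq> forest_closure P \<and> forest_height W P = 0"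
    by blast
  then show ?thesis unfolding treedepth_def by (intro Least_eq_0)
qed

lemma (in graph) treedepth_tdepth:
  assumes F: "rooted_forest W P" and U: "U \<subseteq> W" and E: "E \<subseteq> forest_closure P"
    and h: "forest_height W P \<le> c" and adj: "\<And>u v. u \<in> U \<Longrightarrow> v \<in> U \<Longrightarrow> adj u v \<Longrightarrow> {u, v} \<in> E"
  shows "tdepth c U"
proof (rule forest_tdepth[OF F _ U, where j = 0])
  show "(u, v) \<in> P\<^sup>* \<or> (v, u) \<in> P\<^sup>*" if "u \<in> U" "v \<in> U" "adj u v" for u v
  proof -
    have "{u, v} \<in> forest_closure P" using that adj E by blast
    then show ?thesis
      unfolding forest_closure_def by (auto simp: doubleton_eq_iff dest: trancl_into_rtrancl)
  qed
  show "0 < depth P v \<and> depth P v \<le> 0 + c" if "v \<in> U" for v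
  proof -
    have W: "finite W" "v \<in> W" using F U that by (auto simp: rooted_forest_def)
    have "depth P v \<le> forest_height W P"
      unfolding depth_def forest_height_def using W by (intro le_cSup_finite) auto
    moreover have "finite {u. (v, u) \<in> P\<^sup>*}"
      using ancestors_subset[OF F W(2)] W(1) finite_subset by blast
    then have "0 < depth P v" unfolding depth_def by (auto simp: card_gt_0_iff)
    ultimately show ?thesis using h by simp
  qed
qed

text \<open>Each factor \<open>2 ^ i + 1\<close> is at most \<open>2 ^ (i + 1)\<close>. Together
  with the leading 2 the exponents are 1, ..., c + 1, with sum
  \<open>(c + 1) * (c + 2) div 2\<close>.\<close>

lemma two_modulator_exp_le: "2 * modulator_exp c \<le> 2 ^ ((c + 1) * (c + 2) div 2)"
proof (induction c)
  case (Suc c)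
  have "(Suc c + 1) * (Suc c + 2) div 2 = (c + 1) * (c + 2) div 2 + (c + 2)"
    by (simp add: algebra_simps)
  then have e: "2 ^ ((Suc c + 1) * (Suc c + 2) div 2) = 2 ^ (c + 2) * (2 ^ ((c + 1) * (c + 2) div 2) :: nat)"
    by (simp only: power_add mult.commute)
  have "2 * modulator_exp (Suc c) = (2 ^ Suc c + 1) * (2 * modulator_exp c)" by simp
  also have "\<dots> \<le> 2 ^ (c + 2) * 2 ^ ((c + 1) * (c + 2) div 2)"
    using Suc by (intro mult_le_mono) auto
  finally show ?case unfolding e .
qed simp

text \<open>The vertex \<open>length xs\<close> occurs in no renamed hyperedge, so it can be added
  to any solution; hence \<open>Suc q\<close> on the left.\<close>

lemma renamed_solution_iff:
  assumes xs: "distinct xs" and hs: "\<And>h. h \<in> H \<Longrightarrow> set h \<subseteq> set xs"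
  shows "(\<exists>S\<subseteq>{..length xs}. (\<forall>h\<in>H. \<not> set (rename xs h) \<subseteq> S) \<and> Suc q \<le> card S) \<longleftrightarrow>
    (\<exists>A\<subseteq>set xs. (\<forall>h\<in>H. \<not> set h \<subseteq> A) \<and> q \<le> card A)"
proof
  assume "\<exists>S\<subseteq>{..length xs}. (\<forall>h\<in>H. \<not> set (rename xs h) \<subseteq> S) \<and> Suc q \<le> card S"
  then obtain S where S: "S \<subseteq> {..length xs}" "\<forall>h\<in>H. \<not> set (rename xs h) \<subseteq> S" "Suc q \<le> card S"
    by auto
  let ?T = "S - {length xs}"
  let ?A = "(!) xs ` ?T"
  have T: "i < length xs" if "i \<in> ?T" for i
    using that S(1) by (auto simp: order.order_iff_strict)
  have inj: "inj_on ((!) xs) ?T"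
    using T xs by (auto simp: inj_on_def nth_eq_iff_index_eq)
  have "q \<le> card ?T"
    using S(3) card_Diff1_le[of S "length xs"] by (cases "length xs \<in> S") auto
  then have "q \<le> card ?A" by (simp add: card_image[OF inj])
  moreover have "?A \<subseteq> set xs" using T nth_mem by blast
  moreover have "\<not> set h \<subseteq> ?A" if "h \<in> H" for h
  proof
    assume h: "set h \<subseteq> ?A"
    have "set (rename xs h) \<subseteq> S"
    proof
      fix i assume "i \<in> set (rename xs h)"
      then have i: "i < length xs" "xs ! i \<in> set h" by (auto simp: set_rename)
      with h obtain j where "j \<in> ?T" "xs ! i = xs ! j" by blast
      with T[of j] i xs show "i \<in> S" by (auto simp: nth_eq_iff_index_eq)
    qed
    with S(2) that show False by auto
  qed
  ultimately show "\<exists>A\<subseteq>set xs. (\<forall>h\<in>H. \<not> set h \<subseteq> A) \<and> q \<le> card A" by blast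
next
  assume "\<exists>A\<subseteq>set xs. (\<forall>h\<in>H. \<not> set h \<subseteq> A) \<and> q \<le> card A"
  then obtain A where A: "A \<subseteq> set xs" "\<forall>h\<in>H. \<not> set h \<subseteq> A" "q \<le> card A" by auto
  let ?T = "{i. i < length xs \<and> xs ! i \<in> A}"
  let ?S = "insert (length xs) ?T"
  have "(!) xs ` ?T = A" using A(1) by (auto simp: in_set_conv_nth image_iff subset_iff)
  then have "card A \<le> card ?T" using card_image_le[of ?T "(!) xs"] by simp
  then have "Suc q \<le> card ?S" using A(3) by simp
  moreover have "?S \<subseteq> {..length xs}" by auto
  moreover have "\<not> set (rename xs h) \<subseteq> ?S" if h: "h \<in> H" for h
  proof
    assume s: "set (rename xs h) \<subseteq> ?S"
    have "set h \<subseteq> A"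
    proof
      fix x assume x: "x \<in> set h"
      then obtain i where i: "i < length xs" "x = xs ! i" using hs[OF h] by (metis in_set_conv_nth subsetD)
      with x s show "x \<in> A" by (auto simp: set_rename)
    qed
    with A(2) h show False by auto
  qed
  ultimately show "\<exists>S\<subseteq>{..length xs}. (\<forall>h\<in>H. \<not> set (rename xs h) \<subseteq> S) \<and> Suc q \<le> card S" by blast
qed

text \<open>Looking up the positions undoes the renaming, so different hyperedges stay different and
  their number does not drop.\<close>

lemma image_nth_rename:
  assumes "set h \<subseteq> set xs"
  shows "(!) xs ` set (rename xs h) = set h"
proof
  show "set h \<subseteq> (!) xs ` set (rename xs h)"
  proof
    fix x assume x: "x \<in> set h"
    then obtain i where "i < length xs" "xs ! i = x"
      using assms by (meson in_set_conv_nth subsetD)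
    with x show "x \<in> (!) xs ` set (rename xs h)" by (auto simp: set_rename)
  qed
qed (auto simp: set_rename)

text \<open>The two assumptions say that \<open>a\<close> is below the cap in
  \<open>out_target\<close> and that \<open>a + length ws\<close> is below the one in
  \<open>residual\<close>, so neither cap changes the comparison.\<close>

lemma out_target_iff:
  assumes "a \<le> length xs" and "a + length ws \<le> length vs"
  shows "out_target vs k xs ws - 1 \<le> a \<longleftrightarrow> k \<le> a + length ws"
  using assms by (auto simp: out_target_def length_residual)

text \<open>\<open>M\<close> bounds the number of output vertices. In
  \<open>(c + 1) * (M * M)\<close>, one share is for the edges inside the final modulator and
  \<open>c\<close> shares are for the hyperedges added by the rounds.\<close>

lemma kernel_correct:
  assumes inst: "tdmod_instance c I" and enc: "encodes t I"
  defines "M \<equiv> Suc (card (modulator I)) ^ modulator_exp c"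
  obtains J I' where "t = encode J" and "encodes (encode (kernel c J)) I'" and "tdmod_instance c I'"
    and "equivalent_instances I I'" and "remainder I' = {}"
    and "card (modulator I') \<le> M" and "card (hyperedges I) \<le> card (hyperedges I')"
    and "card (hyperedges I') \<le> card (hyperedges I) + (c + 1) * (M * M)"
    and "enc_size (kernel c J) \<le>
      2 * (1 + M * (2 + 4 * M)) +
      (1 + (card (hyperedges I) + (c + 1) * (M * M)) * (2 + M * (2 + 4 * M))) + (4 * M + 10)"
proof -
  obtain vs es hs xs where vs: "lists_once vs (verts I)"
    and es: "lists_once (map (\<lambda>(u, v). {u, v}) es) (edges I)"
    and hs: "lists_once (map set hs) (hyperedges I)" and xs: "lists_once xs (modulator I)"
    and t: "t = encode (vs, es, hs, xs, target I)"
    using enc by (rule encodesD)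
  define J where "J = (vs, es, hs, xs, target I)"
  have setvs: "set vs = verts I" "distinct vs" and setxs: "set xs = modulator I" "distinct xs"
    using vs xs by (auto simp: lists_once_def)
  have edges: "edges I = (\<lambda>(u, v). {u, v}) ` set es" and hyper: "hyperedges I = set ` set hs"
    using es hs by (auto simp: lists_once_def)
  have fin: "finite (verts I)" and mod: "modulator I \<subseteq> verts I"
    and hmod: "\<And>h. h \<in> set hs \<Longrightarrow> set h \<subseteq> set xs" and k: "0 < target I"
    and td: "treedepth (remainder I) {e \<in> edges I. e \<subseteq> remainder I} \<le> c"
    using inst hyper setxs by (auto simp: tdmod_instance_def)
  have edge: "(\<exists>x\<in>modulator I. \<exists>r\<in>remainder I. e = {x, r}) \<or>
      (\<exists>r\<in>remainder I. \<exists>r'\<in>remainder I. r \<noteq> r' \<and> e = {r, r'})" if "e \<in> edges I" for e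
    using inst that by (simp add: tdmod_instance_def)
  have edge_adj: "{u, v} \<in> edges I \<longleftrightarrow> adjacent es u v" for u v
    unfolding edges adjacent_def by (force simp: doubleton_eq_iff image_iff)
  interpret graph "adjacent es"
  proof
    show "adjacent es v u" if "adjacent es u v" for u v
      using that by (auto simp: adjacent_def)
    \<comment> \<open>A loop would be a singleton edge, but the ends of an edge lie in different
      parts or are distinct by assumption.\<close>
    show "\<not> adjacent es u u" for u
    proof
      assume "adjacent es u u"
      then have "{u} \<in> edges I" using edge_adj[of u u] by simp
      from edge[OF this] show False
        by (auto simp: remainder_def)
    qed
  qed
  define rs where "rs = filter (\<lambda>v. v \<notin> set xs) vs"
  have setrs: "set rs = remainder I" "distinct rs"
    using setvs setxs by (auto simp: rs_def remainder_def)
  have tdR: "tdepth c (remainder I)"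
  proof -
    have "finite (remainder I)" using fin by (simp add: remainder_def)
    moreover have "\<exists>u\<in>remainder I. \<exists>v\<in>remainder I. u \<noteq> v \<and> e = {u, v}"
      if "e \<in> {e \<in> edges I. e \<subseteq> remainder I}" for e
      using edge[of e] that by (auto simp: remainder_def)
    ultimately obtain W P where WP: "rooted_forest W P" "remainder I \<subseteq> W"
        "{e \<in> edges I. e \<subseteq> remainder I} \<subseteq> forest_closure P"
        "forest_height W P = treedepth (remainder I) {e \<in> edges I. e \<subseteq> remainder I}"
      by (rule treedepth_forest)
    show ?thesis
      using WP(4) td edge_adj by (intro treedepth_tdepth[OF WP(1-3)]) auto
  qed
  \<comment> \<open>At the start nothing has been dropped, so the conditions of
    \<open>reduced\<close> on dropped vertices hold trivially.\<close>
  have "verts I - set xs - set rs = {}"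
    unfolding setrs setxs by (auto simp: remainder_def)
  then have red: "reduced c (verts I) xs rs hs"
    using fin mod setxs setrs tdR hmod unfolding reduced_def
    by (auto simp: remainder_def apart_def)
  obtain ys hs' where ys: "reduce c (adjacent es) 0 (xs, rs, hs) = (ys, [], hs' @ hs)"
    and red': "reduced 0 (verts I) ys [] (hs' @ hs)"
    and solv: "\<And>k. solvable (verts I) (hs' @ hs) k \<longleftrightarrow> solvable (verts I) hs k"
    and lenys: "Suc (length ys) \<le> Suc (length xs) ^ modulator_exp c"
    and lenhs': "length hs' \<le> c * Suc (length xs) ^ modulator_exp c"
    using reduce_correct[OF red, of 0] by blast
  have lenxs: "length xs = card (modulator I)"
    using setxs by (metis distinct_card)
  note M = lenys[unfolded lenxs, folded M_def] lenhs'[unfolded lenxs, folded M_def]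
  have ys_facts: "distinct ys" "set ys \<subseteq> verts I" and hys: "\<And>h. h \<in> set (hs' @ hs) \<Longrightarrow> set h \<subseteq> set ys"
    using red' by (auto simp: reduced_def)
  define ws where "ws = max_indep c (adjacent es) (filter (\<lambda>v. v \<notin> set ys) vs)"
  \<comment> \<open>The modulator only grows, so the vertices left over belong to the original
    remainder. Their treedepth is at most \<open>c\<close>, and \<open>max_indep\<close> is exact on
    them.\<close>
  have "set xs \<subseteq> set ys"
  proof -
    have "set (fst p) \<subseteq> set (fst (reduce c adj z p))" for c adj and z :: nat and p
    proof (induction c arbitrary: p)
      case (Suc c)
      have "set (fst p) \<subseteq> set (reduce_modulator c adj z (fst p) (fst (snd p)))"
        by (auto simp: reduce_modulator_def)
      also have "\<dots> \<subseteq> set (fst (reduce (Suc c) adj z p))"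
        using Suc.IH[of "(reduce_modulator c adj z (fst p) (fst (snd p)), _)"] by simp
      finally show ?case .
    qed simp
    from this[of "(xs, rs, hs)" c "adjacent es" 0] show ?thesis by (simp add: ys)
  qed
  then have wsR: "set (filter (\<lambda>v. v \<notin> set ys) vs) \<subseteq> remainder I"
    unfolding remainder_def using setvs setxs by auto
  have outside: "set (filter (\<lambda>v. v \<notin> set ys) vs) = verts I - set ys"
    using setvs by auto
  have lenws: "length ws = indep_num (verts I - set ys)"
    using length_max_indep[OF distinct_filter[OF setvs(2)] tdepth_subset[OF tdR wsR]]
    unfolding ws_def outside .
  have lenvs: "length vs = card (verts I)"
    using setvs by (metis distinct_card)
  define es' where "es' = filter (\<lambda>e. fst e \<in> set ys \<and> snd e \<in> set ys) es"
  define H where "H = map (\<lambda>e. [fst e, snd e]) es' @ hs' @ hs"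
  define oh where "oh = out_hyperedges es ys (hs' @ hs)"
  define T where "T = out_target vs (target I) ys ws"
  have seth: "set oh = rename ys ` set H" and dh: "distinct oh"
    by (auto simp: oh_def out_hyperedges_def H_def es'_def)
  have HY: "set h \<subseteq> set ys" if "h \<in> set H" for h
    using that hys by (auto simp: H_def es'_def)
  have kernel: "kernel c J = (out_vertices ys, [], oh, out_vertices ys, T)"
    unfolding kernel_def J_def Let_def T_def oh_def ws_def
    by (simp add: ys rs_def[symmetric])
  define I' where "I' = \<lparr>verts = {..length ys}, edges = {}, hyperedges = set ` set oh,
      modulator = {..length ys}, target = T\<rparr>"
  have oh_sub: "set h \<subseteq> {..<length ys}" if "h \<in> set oh" for h
    using that unfolding seth by (auto simp: set_rename)
  have inj: "inj_on set (set oh)"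
    unfolding seth by (auto simp: inj_on_def rename_eq_iff)
  have rem': "remainder I' = {}" by (simp add: remainder_def I'_def)
  have T: "0 < T" "T \<le> length ys + 2" by (auto simp: T_def out_target_def)
  have inst': "tdmod_instance c I'"
    using oh_sub T(1) unfolding tdmod_instance_def rem'
    by (force simp: I'_def treedepth_empty)
  have enc': "encodes (encode (kernel c J)) I'"
  proof -
    have "lists_once (out_vertices ys) {..length ys}"
      unfolding lists_once_def out_vertices_eq by (auto simp del: upt_Suc)
    moreover have "lists_once (map set oh) (set ` set oh)"
      using inj dh by (simp add: lists_once_def distinct_map)
    moreover have "\<forall>h\<in>set oh. distinct h" unfolding seth by (auto simp: distinct_rename)
    ultimately have "encodes (encode (out_vertices ys, [] :: (nat \<times> nat) list, oh, out_vertices ys, target I')) I'"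
      by - (rule encodesI, simp_all add: I'_def lists_once_def)
    then show ?thesis by (simp add: kernel I'_def)
  qed
  have indepI: "independent I S \<longleftrightarrow> S \<subseteq> verts I \<and> indep S \<and> (\<forall>h\<in>set hs. \<not> set h \<subseteq> S)" for S
  proof -
    have "(\<forall>e\<in>edges I. \<not> e \<subseteq> S) \<longleftrightarrow> indep S"
      unfolding edges indep_def adjacent_def by (auto; blast)
    then show ?thesis by (auto simp: independent_def hyper)
  qed
  have yes: "yes_instance I \<longleftrightarrow> solvable (verts I) hs (target I)"
    unfolding yes_instance_iff[OF fin k] indepI solvable_def by blast
  also have "\<dots> \<longleftrightarrow> solvable (verts I) (hs' @ hs) (target I)"
    by (simp only: solv)
  also have "\<dots> \<longleftrightarrow> (\<exists>A\<subseteq>set ys. indep A \<and> (\<forall>h\<in>set (hs' @ hs). \<not> set h \<subseteq> A) \<and>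
      target I \<le> card A + length ws)"
    unfolding lenws by (rule solvable_reduced_0[OF red'])
  \<comment> \<open>Edges with both ends in the modulator act as hyperedges with two elements, so
    independence of \<open>A\<close> is expressed by \<open>H\<close>.\<close>
  also have "\<dots> \<longleftrightarrow> (\<exists>A\<subseteq>set ys. (\<forall>h\<in>set H. \<not> set h \<subseteq> A) \<and> T - 1 \<le> card A)"
  proof -
    have "(indep A \<and> (\<forall>h\<in>set (hs' @ hs). \<not> set h \<subseteq> A) \<and> target I \<le> card A + length ws) \<longleftrightarrow>
        (\<forall>h\<in>set H. \<not> set h \<subseteq> A) \<and> T - 1 \<le> card A" if A: "A \<subseteq> set ys" for A
    proof -
      have indep_iff: "indep A \<longleftrightarrow> (\<forall>e\<in>set es'. \<not> set [fst e, snd e] \<subseteq> A)"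
        using A unfolding indep_def adjacent_def es'_def by (auto; blast)
      have "card A \<le> length ys"
        using A by (metis List.finite_set card_length card_mono le_trans)
      moreover have "card A + length ws \<le> length vs"
      proof -
        have "length ws \<le> card (verts I - set ys)"
          using fin indep_numE[of "verts I - set ys"] unfolding lenws
          by (metis card_mono finite_Diff)
        moreover have "card A \<le> card (set ys)" using A by (simp add: card_mono)
        moreover have "card (verts I) = card (set ys) + card (verts I - set ys)"
          using fin ys_facts(2) by (metis List.finite_set card_Diff_subset card_mono le_add_diff_inverse)
        ultimately show ?thesis using lenvs by simp
      qed
      ultimately have "T - 1 \<le> card A \<longleftrightarrow> target I \<le> card A + length ws"
        unfolding T_def by (intro out_target_iff)
      moreover have "(\<forall>h\<in>set H. \<not> set h \<subseteq> A) \<longleftrightarrow>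
          (\<forall>e\<in>set es'. \<not> set [fst e, snd e] \<subseteq> A) \<and> (\<forall>h\<in>set (hs' @ hs). \<not> set h \<subseteq> A)"
        by (simp only: H_def set_append set_map ball_Un ball_simps)
      ultimately show ?thesis using indep_iff by argo
    qed
    then show ?thesis by blast
  qed
  also have "\<dots> \<longleftrightarrow> (\<exists>S\<subseteq>{..length ys}. (\<forall>h\<in>set H. \<not> set (rename ys h) \<subseteq> S) \<and> Suc (T - 1) \<le> card S)"
    by (rule renamed_solution_iff[symmetric, OF ys_facts(1) HY])
  also have "\<dots> \<longleftrightarrow> (\<exists>S. independent I' S \<and> target I' \<le> card S)"
    using T(1) by (auto simp: independent_def I'_def seth)
  also have "\<dots> \<longleftrightarrow> yes_instance I'"
    using T(1) by (intro yes_instance_iff[symmetric]) (simp_all add: I'_def)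
  finally have equiv: "equivalent_instances I I'" by (simp add: equivalent_instances_def)
  have hcard: "card (hyperedges I) = length hs"
    using hs by (metis length_map distinct_card lists_once_def)
  have ohcard: "card (hyperedges I') = length oh"
    using inj dh by (simp add: I'_def card_image distinct_card)
  have lower: "length hs \<le> length oh"
  proof -
    have sub: "h \<in> set hs \<Longrightarrow> set h \<subseteq> set ys" for h using hys by simp
    have "set h = (!) ys ` set (rename ys h)" if "h \<in> set hs" for h
      by (rule image_nth_rename[OF sub[OF that], symmetric])
    then have "hyperedges I \<subseteq> (\<lambda>r. (!) ys ` set r) ` set oh"
      unfolding hyper seth H_def by auto
    then have "card (hyperedges I) \<le> card (set oh)"
      by (meson List.finite_set card_image_le card_mono finite_imageI le_trans)
    then show ?thesis using hcard dh by (simp add: distinct_card)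
  qed
  have upper: "length oh \<le> length hs + (c + 1) * (M * M)"
  proof -
    have "length oh \<le> length H"
      using dh by (metis List.finite_set card_image_le card_length distinct_card le_trans seth)
    moreover have "length es' \<le> M * M"
    proof -
      \<comment> \<open>No edge is listed twice, so the edges inside \<open>ys\<close> are counted
        by ordered pairs.\<close>
      have "distinct es" using es by (simp add: lists_once_def distinct_map)
      then have "length es' = card (set es')"
        unfolding es'_def by (intro distinct_card[symmetric] distinct_filter)
      also have "\<dots> \<le> card (set ys \<times> set ys)"
        by (intro card_mono) (auto simp: es'_def)
      also have "\<dots> = length ys * length ys"
        using ys_facts(1) by (simp add: card_cartesian_product distinct_card)
      also have "\<dots> \<le> M * M" using M(1) by (intro mult_le_mono) auto
      finally show ?thesis .
    qed
    moreover have "c * M \<le> c * (M * M)" by (cases M) auto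
    with M(2) have "length hs' \<le> c * (M * M)" by (rule order_trans)
    ultimately show ?thesis by (simp add: H_def)
  qed
  have sizeV: "enc_size (out_vertices ys) \<le> 1 + M * (2 + 4 * M)"
  proof -
    have "enc_size (out_vertices ys) \<le> 1 + length (out_vertices ys) * (1 + (1 + 4 * M))"
    proof (rule enc_size_list_le)
      fix i assume "i \<in> set (out_vertices ys)"
      then have "i \<le> M" using M(1) by (auto simp: out_vertices_eq)
      then show "enc_size i \<le> 1 + 4 * M" using enc_size_nat[of i] by simp
    qed
    also have "\<dots> \<le> 1 + M * (2 + 4 * M)"
      using M(1) by (intro add_left_mono mult_le_mono) (auto simp: out_vertices_eq)
    finally show ?thesis .
  qed
  have sizeH: "enc_size oh \<le> 1 + (length hs + (c + 1) * (M * M)) * (2 + M * (2 + 4 * M))"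
  proof -
    have "enc_size oh \<le> 1 + length oh * (1 + (1 + M * (2 + 4 * M)))"
    proof (rule enc_size_list_le)
      fix r assume r: "r \<in> set oh"
      have "enc_size r \<le> 1 + length r * (1 + (1 + 4 * M))"
      proof (rule enc_size_list_le)
        fix i assume "i \<in> set r"
        then have "i \<le> M" using M(1) oh_sub[OF r] by auto
        then show "enc_size i \<le> 1 + 4 * M" using enc_size_nat[of i] by simp
      qed
      also have "length r \<le> M"
        using r length_rename_le[of ys] M(1) unfolding seth by (metis Suc_leD image_iff le_trans)
      then have "1 + length r * (1 + (1 + 4 * M)) \<le> 1 + M * (2 + 4 * M)"
        by (intro add_left_mono mult_le_mono) auto
      finally show "enc_size r \<le> 1 + M * (2 + 4 * M)" .
    qed
    also have "\<dots> \<le> 1 + (length hs + (c + 1) * (M * M)) * (2 + M * (2 + 4 * M))"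
      using upper by (intro add_left_mono mult_le_mono) auto
    finally show ?thesis .
  qed
  have sizeT: "enc_size T \<le> 4 * M + 5"
    using enc_size_nat[of T] T(2) M(1) by simp
  show thesis
  proof (rule that[of J I'])
    show "t = encode J" by (simp add: t J_def)
    show "card (modulator I') \<le> M" using M(1) by (simp add: I'_def)
    show "card (hyperedges I) \<le> card (hyperedges I')" using lower by (simp add: hcard ohcard)
    show "card (hyperedges I') \<le> card (hyperedges I) + (c + 1) * (M * M)"
      using upper by (simp add: hcard ohcard)
    show "enc_size (kernel c J) \<le> 2 * (1 + M * (2 + 4 * M)) +
      (1 + (card (hyperedges I) + (c + 1) * (M * M)) * (2 + M * (2 + 4 * M))) + (4 * M + 10)"
    proof -
      have "enc_size (kernel c J) = 2 * enc_size (out_vertices ys) + enc_size oh + (enc_size T + 5)"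
        by (simp add: kernel)
      also have "\<dots> \<le> 2 * (1 + M * (2 + 4 * M)) +
          (1 + (length hs + (c + 1) * (M * M)) * (2 + M * (2 + 4 * M))) + (4 * M + 10)"
        using sizeT by (intro add_mono[OF add_mono[OF mult_le_mono2[OF sizeV] sizeH]]) simp
      finally show ?thesis unfolding hcard .
    qed
  qed (fact enc' inst' equiv rem')+
qed

text \<open>For positive \<open>x\<close>, \<open>Suc x\<close> is at most \<open>2 * x\<close>,
  which explains the factor \<open>2 ^ n\<close>. Powers of \<open>Suc x\<close> are used because
  the output has a vertex even if the modulator is empty.\<close>

lemma power_Suc_bigo:
  assumes "m \<le> n"
  shows "(\<lambda>x. real (a * Suc x ^ m)) \<in> O(\<lambda>x. real x ^ n)"
proof (rule bigoI[where c = "real a * 2 ^ n"])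
  show "\<forall>\<^sub>F x in at_top. norm (real (a * Suc x ^ m)) \<le> real a * 2 ^ n * norm (real x ^ n)"
  proof (rule eventually_mono[OF eventually_ge_at_top[of 1]])
    fix x :: nat assume x: "1 \<le> x"
    have "Suc x ^ m \<le> Suc x ^ n" using assms by (intro power_increasing) auto
    also have "\<dots> \<le> (2 * x) ^ n" using x by (intro power_mono) auto
    finally have "real (a * Suc x ^ m) \<le> real (a * (2 * x) ^ n)"
      by (intro of_nat_mono mult_le_mono2)
    then show "norm (real (a * Suc x ^ m)) \<le> real a * 2 ^ n * norm (real x ^ n)"
      by (simp add: power_mult_distrib mult.assoc)
  qed
qed

theorem theorem4:
  fixes c :: nat
  shows "(\<exists>(P :: com) (p :: nat poly) (f :: nat \<Rightarrow> real) (g :: nat \<Rightarrow> real).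
            f \<in> O(\<lambda>x. real x ^ (2 ^ ((c + 1) * (c + 2) div 2))) \<and>
            g \<in> O(\<lambda>x. real x ^ (2 ^ ((c + 1) * (c + 2) div 2))) \<and>
            (\<forall>I t. tdmod_instance c I \<and> encodes t I \<longrightarrow>
               (\<exists>n t' I'.
                  outputs_in_time P t t' n \<and> n \<le> poly p (tsize t) \<and>
                  encodes t' I' \<and> tdmod_instance c I' \<and> equivalent_instances I I' \<and>
                  real (card (modulator I')) \<le> f (card (modulator I)) \<and>
                  \<bar>real (card (hyperedges I')) - real (card (hyperedges I))\<bar>
                    \<le> g (card (modulator I)) \<and>
                  remainder I' = {})))
       \<and> polynomial_kernel (tdmod_instance c) yes_instance
           (\<lambda>I. card (modulator I) + card (hyperedges I)) encodes"
proof
  let ?E = "2 ^ ((c + 1) * (c + 2) div 2) :: nat"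
  let ?e = "modulator_exp c"
  obtain P g where "poly_bounded g" and P: "\<And>d s x. s d = encode x \<Longrightarrow>
      runs (P d) s (g (enc_size x)) (\<lambda>s'. s' d = encode (kernel c x) \<and> (\<forall>y<d. s' y = s y))"
    using polytime_kernel[of c] by (rule polytimeE) (rule that)
  then obtain p where p: "\<And>n. g n \<le> poly p n" by (auto simp: poly_bounded_def)
  \<comment> \<open>The input is in variable 0, so the stack starts there.\<close>
  have run: "\<exists>n. outputs_in_time (P 0) (encode x) (encode (kernel c x)) n \<and> n \<le> poly p (enc_size x)" for x
    using P[of "(\<lambda>_. Leaf)(0 := encode x)" 0 x] p[of "enc_size x"]
    unfolding runs_def outputs_in_time_def by (auto intro: order_trans)
  let ?f = "\<lambda>x. real (1 * Suc x ^ ?e)" and ?g = "\<lambda>x. real ((c + 1) * Suc x ^ (2 * ?e))"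
  have f: "?f \<in> O(\<lambda>x. real x ^ ?E)" and g: "?g \<in> O(\<lambda>x. real x ^ ?E)"
    using two_modulator_exp_le[of c] by (intro power_Suc_bigo; simp)+
  have sq: "Suc x ^ ?e * Suc x ^ ?e = Suc x ^ (2 * ?e)" for x
    by (simp only: power_add[symmetric] mult_2)
  have "\<exists>n t' I'. outputs_in_time (P 0) t t' n \<and> n \<le> poly p (tsize t) \<and>
      encodes t' I' \<and> tdmod_instance c I' \<and> equivalent_instances I I' \<and>
      real (card (modulator I')) \<le> ?f (card (modulator I)) \<and>
      \<bar>real (card (hyperedges I')) - real (card (hyperedges I))\<bar> \<le> ?g (card (modulator I)) \<and>
      remainder I' = {}" if I: "tdmod_instance c I" "encodes t I" for I t
  proof -
    obtain J I' where J: "t = encode J" "encodes (encode (kernel c J)) I'" "tdmod_instance c I'"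
        "equivalent_instances I I'" "remainder I' = {}"
      and m: "card (modulator I') \<le> Suc (card (modulator I)) ^ ?e"
      and h: "card (hyperedges I) \<le> card (hyperedges I')"
        "card (hyperedges I') \<le> card (hyperedges I) + (c + 1) * (Suc (card (modulator I)) ^ ?e * Suc (card (modulator I)) ^ ?e)"
      using I by (rule kernel_correct)
    have "real (card (hyperedges I')) \<le> real (card (hyperedges I) + (c + 1) * Suc (card (modulator I)) ^ (2 * ?e))"
      using h(2) unfolding sq by (rule of_nat_mono)
    then have "\<bar>real (card (hyperedges I')) - real (card (hyperedges I))\<bar> \<le> ?g (card (modulator I))"
      using h(1) unfolding of_nat_add by linarith
    moreover have "real (card (modulator I')) \<le> ?f (card (modulator I))"
      using of_nat_mono[OF m] by simp
    ultimately show ?thesis using run[of J] J by blast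
  qed
  with f g show "\<exists>(P :: com) (p :: nat poly) (f :: nat \<Rightarrow> real) (g :: nat \<Rightarrow> real).
            f \<in> O(\<lambda>x. real x ^ ?E) \<and> g \<in> O(\<lambda>x. real x ^ ?E) \<and>
            (\<forall>I t. tdmod_instance c I \<and> encodes t I \<longrightarrow>
               (\<exists>n t' I'.
                  outputs_in_time P t t' n \<and> n \<le> poly p (tsize t) \<and>
                  encodes t' I' \<and> tdmod_instance c I' \<and> equivalent_instances I I' \<and>
                  real (card (modulator I')) \<le> f (card (modulator I)) \<and>
                  \<bar>real (card (hyperedges I')) - real (card (hyperedges I))\<bar>
                    \<le> g (card (modulator I)) \<and>
                  remainder I' = {}))"
    by blast
  \<comment> \<open>The size bound of \<open>kernel_correct\<close> plus the bounds on the output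
    parameter, with both parts of the input parameter replaced by their sum
    \<open>m\<close>.\<close>
  define B where "B m = 2 * (1 + Suc m ^ ?e * (2 + 4 * Suc m ^ ?e)) +
      (1 + (m + (c + 1) * (Suc m ^ ?e * Suc m ^ ?e)) * (2 + Suc m ^ ?e * (2 + 4 * Suc m ^ ?e))) +
      (4 * Suc m ^ ?e + 10) + (Suc m ^ ?e + (m + (c + 1) * (Suc m ^ ?e * Suc m ^ ?e)))" for m
  have "poly_bounded B" unfolding B_def by (intro poly_bounded_intros)
  then obtain q where q: "\<And>n. B n \<le> poly q n" by (auto simp: poly_bounded_def)
  have "\<exists>n t' I'. outputs_in_time (P 0) t t' n \<and> n \<le> poly p (tsize t) \<and>
      tdmod_instance c I' \<and> encodes t' I' \<and> (yes_instance I \<longleftrightarrow> yes_instance I') \<and>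
      tsize t' + (card (modulator I') + card (hyperedges I')) \<le> poly q (card (modulator I) + card (hyperedges I))"
    if I: "tdmod_instance c I" "encodes t I" for I t
  proof -
    let ?m = "card (modulator I) + card (hyperedges I)"
    let ?M = "Suc (card (modulator I)) ^ ?e"
    obtain J I' where J: "t = encode J" "encodes (encode (kernel c J)) I'" "tdmod_instance c I'"
        "equivalent_instances I I'"
      and m: "card (modulator I') \<le> ?M"
      and h: "card (hyperedges I') \<le> card (hyperedges I) + (c + 1) * (?M * ?M)"
      and size: "enc_size (kernel c J) \<le> 2 * (1 + ?M * (2 + 4 * ?M)) +
        (1 + (card (hyperedges I) + (c + 1) * (?M * ?M)) * (2 + ?M * (2 + 4 * ?M))) + (4 * ?M + 10)"
      using I by (rule kernel_correct)
    have M: "?M \<le> Suc ?m ^ ?e" by (intro power_mono) auto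
    have "enc_size (kernel c J) + (card (modulator I') + card (hyperedges I')) \<le> B ?m"
      unfolding B_def
      by (intro add_mono order_trans[OF size] order_trans[OF m] order_trans[OF h] mult_le_mono M order_refl) auto
    then show ?thesis using run[of J] J q[of ?m] unfolding equivalent_instances_def
      by (meson order_trans)
  qed
  then show "polynomial_kernel (tdmod_instance c) yes_instance
           (\<lambda>I. card (modulator I) + card (hyperedges I)) encodes"
    unfolding polynomial_kernel_def by blast
qed

end
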